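(* Let $m,n\ge 0$ be integers, let $u_0,\dots,u_{2m+5}\in\mathbb C^*$ satisfy $q^{2n-2}\prod_{0\le r<2m+6}u_r=(pq)^{m+1}$, and let $v\in\mathbb C^*$. Let $G_n(x)$ be any $BC_1$-symmetric theta function of degree $n$, and let $C$ be any (possibly disconnected) closed contour with $C=C^{-1}$ whose interior contains all points $p^iq^ju_r$ ($i,j\ge0$, $0\le r<2m+6$) and all points $p^iv$, $p^{i+1}/v$ ($i\ge 0$). Then for any $x$ such that $C$ contains $p^ix$ and $p^{i+1}/x$ for all $i\ge0$, $$\frac{(p;p)^2}{2}\int_C\frac{F_n(z;v)G_n(z)}{\psi_p(x,z)\psi_p(v,z)}\Delta(z;u_0,\dots,u_{2m+5})\frac{dz}{2\pi\sqrt{-1}\,z}=G_n(x)\,x^{n+1}v^{n+1}\,\mathrm{II}_{n+1}(u_0,\dots,u_{2m+5},x,p/x,v,p/v).$$ In particular, if $n\ge1$ and $H_{n-1}(x)$ is a $BC_1$-symmetric theta function of degree $n-1$, then $$\int_C\frac{F_n(z;v)H_{n-1}(z)}{\psi_p(v,z)}\Delta(z;u_0,\dots,u_{2m+5})\frac{dz}{2\pi\sqrt{-1}\,z}=0.$$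
   Context: $p,q$ are fixed nonzero complex numbers with $|p|,|q|<1$ and $p^{\mathbb Z}\cap q^{\mathbb Z}=\{1\}$; $\mathbb C^*=\mathbb C\setminus\{0\}$. Put $(x;p)=\prod_{i\ge0}(1-p^ix)$, $\theta_p(z)=\prod_{i\ge0}(1-p^{i+1}/z)(1-p^iz)$, and $\Gamma_{p,q}(z)=\prod_{i,j\ge0}\frac{1-p^{i+1}q^{j+1}/z}{1-p^iq^jz}$. Multiple arguments (and $\pm$ signs in exponents) denote products, e.g. $\theta_p(xz^{\pm1})=\theta_p(xz)\theta_p(x/z)$, $\Gamma_{p,q}(z^{\pm2})=\Gamma_{p,q}(z^2)\Gamma_{p,q}(z^{-2})$. Put $\psi_p(x,z)=x^{-1}\theta_p(xz^{\pm1})$. A $BC_1$-symmetric theta function of degree $n$ is a holomorphic function $G$ on $\mathbb C^*$ with $G(1/x)=G(x)$ and $G(px)=(px^2)^{-n}G(x)$. For any even number $2M+6$ of parameters, $\Delta(z;a_0,\dots,a_{2M+5})=\dfrac{\prod_{0\le r<2M+6}\Gamma_{p,q}(a_rz^{\pm1})}{\Gamma_{p,q}(z^{\pm2})}$, and, when $q^{2N-2}\prod_ra_r=(pq)^{M+1}$, $$\mathrm{II}_N(a_0,\dots,a_{2M+5})=\frac{(p;p)^N(q;q)^N\Gamma_{p,q}(q)^N}{2^NN!}\int_{C^N}\prod_{1\le i<j\le N}\frac{\Gamma_{p,q}(qz_i^{\pm1}z_j^{\pm1})}{\Gamma_{p,q}(z_i^{\pm1}z_j^{\pm1})}\prod_{1\le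 i\le N}\Delta(z_i;a_0,\dots,a_{2M+5})\frac{dz_i}{2\pi\sqrt{-1}\,z_i},$$ where $C=C^{-1}$ is a (possibly disconnected) closed contour whose interior contains every point $p^iq^ja_r$, $i,j\ge0$ (points which are not actually poles of the integrand may be ignored; $C$ may be the unit circle if all $|a_r|<1$). This extends to a meromorphic function of the parameters; $\mathrm{II}_0=1$. With $u_0,\dots,u_{2m+5}$ as in the claim, $F_n(x;v)=x^{-n}v^n\,\mathrm{II}_n(u_0,\dots,u_{2m+5},qx,pq/x,v,p/v)$. It is a $BC_1$-symmetric theta function of degree $n$ in $x$. *)

theory Defs
  imports "HOL-Complex_Analysis.Complex_Analysis"
begin

definition qpoch :: "complex \<Rightarrow> complex \<Rightarrow> complex" where
  "qpoch p x = (\<Prod>i. 1 - p ^ i * x)"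

definition theta :: "complex \<Rightarrow> complex \<Rightarrow> complex" where
  "theta p z = (\<Prod>i. (1 - p ^ Suc i / z) * (1 - p ^ i * z))"

text \<open>
  At a pole the convention x / 0 = 0 gives the value 0. In the integrands below this differs from the
  removable-singularity value only on countably many points, which does not affect the integrals.
\<close>

definition egamma :: "complex \<Rightarrow> complex \<Rightarrow> complex \<Rightarrow> complex" where
  "egamma p q z = (\<Prod>i. \<Prod>j. (1 - p ^ Suc i * q ^ Suc j / z) / (1 - p ^ i * q ^ j * z))"

definition psi :: "complex \<Rightarrow> complex \<Rightarrow> complex \<Rightarrow> complex" where
  "psi p x z = inverse x * (theta p (x * z) * theta p (x / z))"

definition bc1_theta :: "complex \<Rightarrow> nat \<Rightarrow> (complex \<Rightarrow> complex) \<Rightarrow> bool" where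
  "bc1_theta p n G \<longleftrightarrow>
     G holomorphic_on (- {0}) \<and>
     (\<forall>x. x \<noteq> 0 \<longrightarrow> G (1 / x) = G x) \<and>
     (\<forall>x. x \<noteq> 0 \<longrightarrow> G (p * x) = inverse ((p * x\<^sup>2) ^ n) * G x)"

definition Delta :: "complex \<Rightarrow> complex \<Rightarrow> complex list \<Rightarrow> complex \<Rightarrow> complex" where
  "Delta p q as z =
     (\<Prod>a\<leftarrow>as. egamma p q (a * z) * egamma p q (a / z)) /
     (egamma p q (z\<^sup>2) * egamma p q (inverse (z\<^sup>2)))"


text \<open>
  A possibly disconnected closed contour in the punctured plane is a finite family of closed
  piecewise continuously differentiable paths. A point is in its interior if the
  total winding number around it is 1.
\<close>

type_synonym contour = "(real \<Rightarrow> complex) list"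

definition closed_contour :: "contour \<Rightarrow> bool" where
  "closed_contour C \<longleftrightarrow>
     (\<forall>\<gamma>\<in>set C. valid_path \<gamma> \<and> pathfinish \<gamma> = pathstart \<gamma> \<and> 0 \<notin> path_image \<gamma>)"

definition contour_image :: "contour \<Rightarrow> complex set" where
  "contour_image C = (\<Union>\<gamma>\<in>set C. path_image \<gamma>)"

definition contour_index :: "contour \<Rightarrow> complex \<Rightarrow> complex" where
  "contour_index C w = (\<Sum>\<gamma>\<leftarrow>C. winding_number \<gamma> w)"

definition contour_interior :: "contour \<Rightarrow> complex set" where
  "contour_interior C = {w. w \<notin> contour_image C \<and> contour_index C w = 1}"

text \<open>
  Since inversion exchanges interior and exterior, the image of a contour under inversion
  carries the reversed orientation (so the unit circle is its own inverse). Equality of contours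
  is equality up to parametrization and subdivision: same point set, same winding numbers.
\<close>

definition contour_inverse :: "contour \<Rightarrow> contour" where
  "contour_inverse C = map (\<lambda>\<gamma>. reversepath (\<lambda>t. inverse (\<gamma> t))) C"

definition same_contour :: "contour \<Rightarrow> contour \<Rightarrow> bool" where
  "same_contour C D \<longleftrightarrow>
     contour_image C = contour_image D \<and>
     (\<forall>w. w \<notin> contour_image C \<longrightarrow> contour_index C w = contour_index D w)"

definition symmetric_contour :: "contour \<Rightarrow> bool" where
  "symmetric_contour C \<longleftrightarrow> closed_contour C \<and> same_contour C (contour_inverse C)"

text \<open>The integral of f against the form dz / (2 pi i z), and its N-fold iteration.\<close>

definition dlog_integral :: "contour \<Rightarrow> (complex \<Rightarrow> complex) \<Rightarrow> complex" where
  "dlog_integral C f =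
     (\<Sum>\<gamma>\<leftarrow>C. contour_integral \<gamma> (\<lambda>z. f z / (2 * complex_of_real pi * \<i> * z)))"

primrec multi_dlog_integral ::
    "contour \<Rightarrow> nat \<Rightarrow> (complex list \<Rightarrow> complex) \<Rightarrow> complex" where
  "multi_dlog_integral C 0 f = f []"
| "multi_dlog_integral C (Suc N) f =
     dlog_integral C (\<lambda>z. multi_dlog_integral C N (\<lambda>zs. f (z # zs)))"


text \<open>
  The product of all the gamma factors with argument a z or a / z in \<^const>\<open>Delta\<close> equals
  I(z) I(1/z), where I is the function below: it collects the denominators of the factors with
  argument a / z, which produce the poles at the points p^i q^j a, and the numerators of the
  factors with argument a z, which are what can cancel such a pole identically in the parameters
  (as for the pair of parameters v, p / v, where only the points p^i v and p^(i+1) / v survive).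
\<close>

definition inner_factor :: "complex \<Rightarrow> complex \<Rightarrow> complex list \<Rightarrow> complex \<Rightarrow> complex" where
  "inner_factor p q as z =
     (\<Prod>a\<leftarrow>as. \<Prod>i. \<Prod>j. (1 - p ^ Suc i * q ^ Suc j / (a * z)) / (1 - p ^ i * q ^ j * a / z))"

text \<open>
  A point p^i q^j a may be ignored if it is not a pole of the integrand. It may also be ignored
  if it is not a pole of I, since it can then be a pole of the integrand only through an
  accidental coincidence with a pole of I(1/z); those are the poles that lie outside the contour.
  That 0 is in the interior is automatic when no point is ignored, because 0 is the limit of the
  points p^i q^j a; otherwise it has to be kept as a requirement.
\<close>

definition II_contour :: "complex \<Rightarrow> complex \<Rightarrow> complex list \<Rightarrow> contour \<Rightarrow> bool" where
  "II_contour p q as C \<longleftrightarrow>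
     symmetric_contour C \<and> 0 \<in> contour_interior C \<and>
     (\<forall>a\<in>set as. \<forall>i j.
        is_pole (Delta p q as) (p ^ i * q ^ j * a) \<and>
        is_pole (inner_factor p q as) (p ^ i * q ^ j * a) \<longrightarrow>
        p ^ i * q ^ j * a \<in> contour_interior C)"

definition II_cross :: "complex \<Rightarrow> complex \<Rightarrow> complex \<Rightarrow> complex \<Rightarrow> complex" where
  "II_cross p q z w =
     (egamma p q (q * z * w) * egamma p q (q * z / w) *
      egamma p q (q * w / z) * egamma p q (q / (z * w))) /
     (egamma p q (z * w) * egamma p q (z / w) * egamma p q (w / z) * egamma p q (1 / (z * w)))"

definition II_integral :: "complex \<Rightarrow> complex \<Rightarrow> nat \<Rightarrow> complex list \<Rightarrow> contour \<Rightarrow> complex" where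
  "II_integral p q N as C =
     qpoch p p ^ N * qpoch q q ^ N * egamma p q q ^ N / (2 ^ N * fact N) *
     multi_dlog_integral C N (\<lambda>zs.
       (\<Prod>j<N. \<Prod>i<j. II_cross p q (zs ! i) (zs ! j)) * (\<Prod>i<N. Delta p q as (zs ! i)))"

definition II_balanced :: "complex \<Rightarrow> complex \<Rightarrow> nat \<Rightarrow> complex list \<Rightarrow> bool" where
  "II_balanced p q N as \<longleftrightarrow>
     (\<exists>M. length as = 2 * M + 6 \<and> q powi (2 * int N - 2) * prod_list as = (p * q) ^ (M + 1))"

text \<open>
  If a suitable contour exists, the value is the integral, which does not depend on the contour.
  Otherwise it is the value of the extension to all balanced parameters, that is, the
  limit of the integrals along balanced parameters for which a suitable contour exists.
\<close>

definition II :: "complex \<Rightarrow> complex \<Rightarrow> nat \<Rightarrow> complex list \<Rightarrow> complex" where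
  "II p q N as =
     (if N = 0 then 1
      else if \<exists>C. II_contour p q as C then II_integral p q N as (SOME C. II_contour p q as C)
      else (THE L. \<forall>b C.
              (\<forall>k. length (b k) = length as \<and> 0 \<notin> set (b k) \<and>
                   II_balanced p q N (b k) \<and> II_contour p q (b k) (C k)) \<and>
              (\<forall>r<length as. (\<lambda>k. b k ! r) \<longlonglongrightarrow> as ! r) \<longrightarrow>
              (\<lambda>k. II_integral p q N (b k) (C k)) \<longlonglongrightarrow> L))"

definition F :: "complex \<Rightarrow> complex \<Rightarrow> complex list \<Rightarrow> nat \<Rightarrow> complex \<Rightarrow> complex \<Rightarrow> complex" where
  "F p q u n x v =
     inverse (x ^ n) * v ^ n * II p q n (u @ [q * x, p * q / x, v, p / v])"

end

theory Submission
  imports Defs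
begin

text \<open>
  For z on C the factors of the parameters qz and pq/z combine to theta functions, so that C is itself
  a contour for the n-fold integral in F(z;v), and the cross terms are squares \<open>\<psi>(z\<^sub>i, z\<^sub>j)\<^sup>2\<close>.
  The left-hand side is therefore an (n+1)-fold integral over C. Symmetrizing its integrand over
  the n+1 variables and applying Lagrange interpolation for theta functions of degree n turns it into
  the integrand of the right-hand side; the constants match because
  \<open>(q;q) \<Gamma>(q) = (p;p)\<close>. The second claim is the case \<open>G(z) = \<psi>(v, z) H(z)\<close>, \<open>x = v\<close>.

  As \<open>\<psi>(z, w)\<close> is of the form \<open>a(z) b(w) + a'(z) b'(w)\<close>, every iterated integral that occurs is a
  sum of products of one-variable integrals. Thus Fubini's theorem is not needed, and independence of
  the contour reduces to Cauchy's theorem in one variable.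
\<close>

section \<open>The infinite products\<close>

text \<open>All iterated integrals are compared against one weight \<open>W\<close>, that of the
  right-hand side. Replacing its pair x, p/x by qz, pq/z multiplies it by zx \<psi>(z,w)
  \<psi>(x,w). The left-hand integrand thus carries one factor \<psi>(z_0,z_i) where the squared
  Vandermonde product has two, and the ratio \<psi>(x,z_i)/\<psi>(z_0,z_i) between them is a factor
  of a Lagrange coefficient. The n+1 integration variables are the nodes, which is why degree n is
  the right degree for G.

  Two obstacles shape the proof. \<open>egamma\<close> takes default values at its poles, so
  identities between gamma products hold only off countable sets, in which a path may nevertheless
  stay for a positive time; the congruence rules for integrals therefore permit countable
  exceptions. And \<open>II\<close> picks an arbitrary admissible contour, so C must be shown to be
  admissible and the value to be the same for all choices: the parameters and the inversion symmetry
  together force the index at every pole.\<close>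

lemma
  fixes f :: "nat \<Rightarrow> complex \<Rightarrow> complex" and M :: "real \<Rightarrow> nat \<Rightarrow> real"
  assumes hol: "\<And>n. f n holomorphic_on UNIV"
    and bound: "\<And>R n z. norm z \<le> R \<Longrightarrow> norm (f n z - 1) \<le> M R n"
    and summable: "\<And>R. summable (M R)"
  shows convergent_prod_entire: "\<And>z. convergent_prod (\<lambda>n. f n z)"
    and holomorphic_prodinf_entire: "(\<lambda>z. \<Prod>n. f n z) holomorphic_on UNIV"
proof -
  show conv: "convergent_prod (\<lambda>n. f n z)" for z
  proof (intro abs_convergent_prod_imp_convergent_prod summable_imp_abs_convergent_prod)
    show "summable (\<lambda>n. norm (f n z - 1))"
      by (rule summable_comparison_test'[OF summable[of "norm z"]]) (use bound in auto)
  qed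
  have lim: "uniform_limit (cball 0 R) (\<lambda>N z. \<Prod>n<N. f n z) (\<lambda>z. \<Prod>n. f n z) sequentially" for R
  proof -
    have "uniformly_convergent_on (cball 0 R) (\<lambda>N z. \<Prod>n<N. f n z)"
    proof (rule uniformly_convergent_on_prod')
      show "uniformly_convergent_on (cball 0 R) (\<lambda>N z. \<Sum>n<N. norm (f n z - 1))"
        by (rule Weierstrass_m_test'[OF _ summable[of R]]) (simp add: bound)
      show "continuous_on (cball 0 R) (f n)" for n
        by (rule holomorphic_on_imp_continuous_on, rule holomorphic_on_subset[OF hol]) auto
    qed auto
    then obtain g where g: "uniform_limit (cball 0 R) (\<lambda>N z. \<Prod>n<N. f n z) g sequentially"
      by (auto simp: uniformly_convergent_on_def)
    \<comment> \<open>The abstract uniform limit agrees pointwise with the infinite product, both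
      being limits of the same partial products. The shift to \<open>Suc n\<close> matches products
      over \<open>{..<Suc n}\<close> with those over \<open>{..n}\<close>.\<close>
    also have "?this \<longleftrightarrow> ?thesis"
    proof (intro uniform_limit_cong)
      fix z :: complex assume "z \<in> cball 0 R"
      from LIMSEQ_Suc[OF tendsto_uniform_limitI[OF g this]]
      have "(\<lambda>n. \<Prod>k<Suc n. f k z) \<longlonglongrightarrow> g z" .
      moreover have "(\<lambda>n. \<Prod>k<Suc n. f k z) \<longlonglongrightarrow> (\<Prod>n. f n z)"
        using convergent_prod_LIMSEQ[OF conv[of z]] unfolding lessThan_Suc_atMost .
      ultimately show "g z = (\<Prod>n. f n z)"
        by (rule LIMSEQ_unique)
    qed auto
    finally show ?thesis .
  qed
  show "(\<lambda>z. \<Prod>n. f n z) holomorphic_on UNIV"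
  proof (rule holomorphic_uniform_sequence)
    fix z :: complex
    have "uniform_limit (cball z 1) (\<lambda>N z. \<Prod>n<N. f n z) (\<lambda>z. \<Prod>n. f n z) sequentially"
      by (rule uniform_limit_on_subset[OF lim[of "norm z + 1"]]) (simp add: cball_subset_cball_iff)
    thus "\<exists>d>0. cball z d \<subseteq> UNIV \<and>
        uniform_limit (cball z d) (\<lambda>N z. \<Prod>n<N. f n z) (\<lambda>z. \<Prod>n. f n z) sequentially"
      by (intro exI[of _ 1]) auto
  qed (auto intro!: holomorphic_intros hol)
qed

lemma prodinf_rec:
  fixes f :: "nat \<Rightarrow> 'a :: {real_normed_field}"
  assumes "convergent_prod f"
  shows "(\<Prod>n. f n) = f 0 * (\<Prod>n. f (Suc n))"
proof (cases "f 0 = 0")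
  case True
  have "(\<Prod>n. f n) = 0"
    by (rule has_prod_zeroI[OF convergent_prod_has_prod[OF assms] True])
  thus ?thesis using True by simp
next
  case False
  thus ?thesis using prodinf_split_head[OF assms False] by simp
qed

lemma prodinf_eq_0_iff:
  fixes f :: "nat \<Rightarrow> 'a :: {real_normed_field}"
  assumes "convergent_prod f"
  shows "(\<Prod>n. f n) = 0 \<longleftrightarrow> (\<exists>n. f n = 0)"
  using has_prod_eq_0_iff[OF convergent_prod_has_prod[OF assms]] by (auto simp: image_iff)

section \<open>The q-Pochhammer symbol and its double analogue\<close>

lemma
  assumes "norm p < 1"
  shows convergent_prod_qpoch: "convergent_prod (\<lambda>i. 1 - p ^ i * x)"
    and qpoch_entire: "qpoch p holomorphic_on UNIV"
proof -
  have 1: "(\<lambda>x. 1 - p ^ i * x) holomorphic_on UNIV" for i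
    by (intro holomorphic_intros)
  have 2: "norm (1 - p ^ i * x - 1) \<le> R * norm p ^ i" if "norm x \<le> R" for i x R
    using mult_right_mono[OF that, of "norm p ^ i"] by (simp add: norm_mult norm_power mult.commute)
  have 3: "summable (\<lambda>i. R * norm p ^ i)" for R
    using assms by (intro summable_mult summable_geometric) auto
  show "convergent_prod (\<lambda>i. 1 - p ^ i * x)"
    by (rule convergent_prod_entire[OF 1 2 3])
  have "qpoch p = (\<lambda>x. \<Prod>i. 1 - p ^ i * x)"
    by (auto simp: qpoch_def)
  thus "qpoch p holomorphic_on UNIV"
    using holomorphic_prodinf_entire[OF 1 2 3] by simp
qed

lemma qpoch_0_right [simp]: "qpoch p 0 = 1"
  by (simp add: qpoch_def)

lemma qpoch_eq_0_iff: "norm p < 1 \<Longrightarrow> qpoch p x = 0 \<longleftrightarrow> (\<exists>i. p ^ i * x = 1)"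
  unfolding qpoch_def by (subst prodinf_eq_0_iff[OF convergent_prod_qpoch]) auto

lemma qpoch_rec: "norm p < 1 \<Longrightarrow> qpoch p x = (1 - x) * qpoch p (p * x)"
  using prodinf_rec[OF convergent_prod_qpoch[of p x]] by (simp add: qpoch_def mult_ac)

lemma qpoch_nonzero_same:
  assumes "norm p < 1"
  shows "qpoch p p \<noteq> 0"
proof
  assume "qpoch p p = 0"
  then obtain i where "p ^ Suc i = 1"
    using qpoch_eq_0_iff[OF assms] by (auto simp: mult.commute)
  hence "norm p ^ Suc i = 1"
    by (metis norm_one norm_power)
  thus False
    using assms power_Suc_less_one[of "norm p" i] by (cases "norm p = 0") auto
qed

lemma theta_conv_qpoch:
  assumes "norm p < 1"
  shows "theta p z = qpoch p (p / z) * qpoch p z"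
  using prodinf_mult[OF convergent_prod_qpoch[OF assms, of "p / z"] convergent_prod_qpoch[OF assms, of z]]
  by (simp add: theta_def qpoch_def mult.commute)

text \<open>The double q-Pochhammer symbol, in terms of which
  \<open>\<Gamma>\<^bsub>p,q\<^esub>(z) = (pq/z; p, q) / (z; p, q)\<close>.\<close>

definition dpoch :: "complex \<Rightarrow> complex \<Rightarrow> complex \<Rightarrow> complex" where
  "dpoch p q x = (\<Prod>i. qpoch q (p ^ i * x))"

text \<open>\<open>qpoch q\<close> is entire with value 1 at 0, so a bound for its derivative on a
  disc gives |\<open>qpoch q y\<close> - 1| \<le> B |y| there. With y = p^i x this is a geometric
  majorant, and the double product becomes a simple product of entire functions.\<close>

lemma
  assumes "norm p < 1" "norm q < 1"
  shows convergent_prod_dpoch: "convergent_prod (\<lambda>i. qpoch q (p ^ i * x))"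
    and dpoch_entire: "dpoch p q holomorphic_on UNIV"
proof -
  have "\<exists>B. \<forall>y. norm y \<le> R \<longrightarrow> norm (qpoch q y - 1) \<le> B * norm y" for R
  proof -
    have "continuous_on (cball 0 R) (deriv (qpoch q))"
      by (intro holomorphic_on_imp_continuous_on holomorphic_on_subset[OF holomorphic_deriv[OF qpoch_entire]])
         (use assms in auto)
    hence "bounded (deriv (qpoch q) ` cball 0 R)"
      by (intro compact_imp_bounded compact_continuous_image) auto
    then obtain B where B: "norm (deriv (qpoch q) y) \<le> B" if "y \<in> cball 0 R" for y
      unfolding bounded_iff by blast
    have "norm (qpoch q y - qpoch q 0) \<le> B * norm (y - 0)" if "norm y \<le> R" for y
    proof (rule field_differentiable_bound[of "cball 0 R"])
      show "(qpoch q has_field_derivative deriv (qpoch q) z) (at z within cball 0 R)" for z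
        by (rule has_field_derivative_at_within, rule holomorphic_derivI[OF qpoch_entire[OF assms(2)] open_UNIV]) auto
    qed (use B that norm_ge_zero[of y] in \<open>auto simp del: norm_ge_zero\<close>)
    thus ?thesis by auto
  qed
  then obtain B where B: "\<And>R y. norm y \<le> R \<Longrightarrow> norm (qpoch q y - 1) \<le> B R * norm y"
    by metis
  define M where "M = (\<lambda>R i. \<bar>B R\<bar> * R * norm p ^ i)"
  have 1: "(\<lambda>x. qpoch q (p ^ i * x)) holomorphic_on UNIV" for i
    by (intro holomorphic_on_compose[OF _ holomorphic_on_subset[OF qpoch_entire[OF assms(2)]], unfolded o_def]
          holomorphic_intros) auto
  have 2: "norm (qpoch q (p ^ i * x) - 1) \<le> M R i" if "norm x \<le> R" for i x R
  proof -
    have R: "R \<ge> 0" using that norm_ge_zero order_trans by blast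
    have "norm p ^ i \<le> 1" using assms(1) by (simp add: power_le_one)
    hence "norm (p ^ i * x) \<le> 1 * R"
      unfolding norm_mult norm_power by (intro mult_mono that) auto
    hence "norm (qpoch q (p ^ i * x) - 1) \<le> B R * norm (p ^ i * x)"
      by (intro B) auto
    also have "\<dots> \<le> \<bar>B R\<bar> * (norm p ^ i * R)"
      unfolding norm_mult norm_power using that R by (intro mult_mono) auto
    finally show ?thesis by (simp add: M_def mult_ac)
  qed
  have 3: "summable (M R)" for R
    unfolding M_def using assms by (intro summable_mult summable_geometric) auto
  show "convergent_prod (\<lambda>i. qpoch q (p ^ i * x))"
    by (rule convergent_prod_entire[OF 1 2 3])
  have "dpoch p q = (\<lambda>x. \<Prod>i. qpoch q (p ^ i * x))"
    by (auto simp: dpoch_def)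
  thus "dpoch p q holomorphic_on UNIV"
    using holomorphic_prodinf_entire[OF 1 2 3] by simp
qed

lemma dpoch_eq_0_iff:
  assumes "norm p < 1" "norm q < 1"
  shows "dpoch p q x = 0 \<longleftrightarrow> (\<exists>i j. p ^ i * q ^ j * x = 1)"
  unfolding dpoch_def
  by (subst prodinf_eq_0_iff[OF convergent_prod_dpoch]) (use assms in \<open>auto simp: qpoch_eq_0_iff mult_ac\<close>)

lemma dpoch_rec_p:
  "norm p < 1 \<Longrightarrow> norm q < 1 \<Longrightarrow> dpoch p q x = qpoch q x * dpoch p q (p * x)"
  using prodinf_rec[OF convergent_prod_dpoch[of p q x]] by (simp add: dpoch_def mult_ac)

lemma dpoch_rec_q:
  assumes "norm p < 1" "norm q < 1"
  shows "dpoch p q x = qpoch p x * dpoch p q (q * x)"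
proof -
  have "dpoch p q x = (\<Prod>i. (1 - p ^ i * x) * qpoch q (p ^ i * (q * x)))"
    unfolding dpoch_def using qpoch_rec[OF assms(2)] by (metis mult.left_commute)
  thus ?thesis
    using prodinf_mult[OF convergent_prod_qpoch[OF assms(1), of x] convergent_prod_dpoch[OF assms, of "q * x"]]
    by (simp add: dpoch_def qpoch_def)
qed

text \<open>The arguments s and t are independent in order to cover both \<open>egamma\<close> (s =
  1/z, t = z) and \<open>inner_factor\<close> (s = 1/(az), t = a/z). The identity survives zeros of
  the denominator, where both sides are 0 by the convention x/0 = 0.\<close>

lemma prodinf_prodinf_dpoch:
  assumes "norm p < 1" "norm q < 1"
  shows "(\<Prod>i. \<Prod>j. (1 - p ^ Suc i * q ^ Suc j * s) / (1 - p ^ i * q ^ j * t)) =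
           dpoch p q (p * q * s) / dpoch p q t"
proof -
  have "(\<Prod>j. (1 - p ^ Suc i * q ^ Suc j * s) / (1 - p ^ i * q ^ j * t)) =
          qpoch q (p ^ i * (p * q * s)) / qpoch q (p ^ i * t)" for i
    using prodinf_divide[OF convergent_prod_qpoch[OF assms(2), of "p ^ i * (p * q * s)"]
            convergent_prod_qpoch[OF assms(2), of "p ^ i * t"]]
    unfolding qpoch_def by (simp add: mult_ac)
  thus ?thesis
    using prodinf_divide[OF convergent_prod_dpoch[OF assms, of "p * q * s"] convergent_prod_dpoch[OF assms, of t]]
    by (simp add: dpoch_def)
qed

lemma egamma_conv_dpoch:
  assumes "norm p < 1" "norm q < 1"
  shows "egamma p q z = dpoch p q (p * q / z) / dpoch p q z"
  using prodinf_prodinf_dpoch[OF assms, of "1 / z" z] by (simp add: egamma_def)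

lemma inner_factor_conv_dpoch:
  assumes "norm p < 1" "norm q < 1"
  shows "inner_factor p q as z = (\<Prod>a\<leftarrow>as. dpoch p q (p * q / (a * z)) / dpoch p q (a / z))"
  using prodinf_prodinf_dpoch[OF assms, of "1 / (a * z)" "a / z" for a] by (simp add: inner_factor_def)

text \<open>The condition \<open>qpoch p x \<noteq> 0\<close> avoids the points where a zero of
  theta cancels a pole of \<Gamma>: there the right-hand side is 0 by convention, while the
  left-hand side need not vanish.\<close>

lemma egamma_q_mult:
  assumes "norm p < 1" "norm q < 1" "x \<noteq> 0" "q \<noteq> 0" "qpoch p x \<noteq> 0"
  shows "egamma p q (q * x) = theta p x * egamma p q x"
proof -
  have "p * q / (q * x) = p / x" "dpoch p q (p / x) = qpoch p (p / x) * dpoch p q (p * q / x)"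
    using dpoch_rec_q[OF assms(1,2), of "p / x"] assms by (auto simp: field_simps)
  thus ?thesis
    using assms dpoch_rec_q[OF assms(1,2), of x]
    by (simp add: egamma_conv_dpoch theta_conv_qpoch)
qed

text \<open>\<Gamma>(q) is the quotient of (p;p,q) and (q;p,q). Splitting off (p;p) and (q;q)
  respectively leaves (pq;p,q) in both, which is nonzero because all p^(i+1) q^(j+1) have modulus
  less than 1.\<close>

lemma egamma_q:
  assumes "norm p < 1" "norm q < 1" "q \<noteq> 0"
  shows "qpoch q q * egamma p q q = qpoch p p"
proof -
  have "dpoch p q (p * q) \<noteq> 0"
  proof
    assume "dpoch p q (p * q) = 0"
    then obtain i j where "p ^ Suc i * q ^ Suc j = 1"
      by (auto simp: dpoch_eq_0_iff assms mult_ac)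
    hence "norm p ^ Suc i * norm q ^ Suc j = 1"
      by (metis norm_mult norm_one norm_power)
    moreover have "norm p ^ Suc i < 1"
      using assms power_Suc_less_one[of "norm p" i] by (cases "norm p = 0") auto
    moreover have "norm q ^ Suc j \<le> 1" using assms by (intro power_le_one) auto
    ultimately show False
      by (metis mult_left_le norm_ge_zero not_le zero_le_power)
  qed
  moreover have "dpoch p q p = qpoch p p * dpoch p q (p * q)"
    using dpoch_rec_q[OF assms(1,2), of p] by (simp only: mult.commute)
  moreover have "dpoch p q q = qpoch q q * dpoch p q (p * q)"
    by (rule dpoch_rec_p[OF assms(1,2)])
  moreover have "egamma p q q = dpoch p q p / dpoch p q q"
    using assms by (simp add: egamma_conv_dpoch)
  ultimately show ?thesis
    using qpoch_nonzero_same[OF assms(2)] by simp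
qed

lemma theta_inverse_arg:
  assumes "norm p < 1" "z \<noteq> 0"
  shows "theta p (1 / z) = - theta p z / z"
proof -
  have "theta p (1 / z) = qpoch p (p * z) * qpoch p (1 / z)"
    using assms by (simp add: theta_conv_qpoch)
  also have "qpoch p (1 / z) = (1 - 1 / z) * qpoch p (p / z)"
    using qpoch_rec[OF assms(1), of "1 / z"] by simp
  also have "qpoch p (p * z) * \<dots> = - (qpoch p (p / z) * ((1 - z) * qpoch p (p * z))) / z"
    using assms(2) by (simp add: field_simps)
  also have "(1 - z) * qpoch p (p * z) = qpoch p z"
    by (rule qpoch_rec[OF assms(1), symmetric])
  also have "qpoch p (p / z) * qpoch p z = theta p z"
    using assms by (simp add: theta_conv_qpoch)
  finally show ?thesis .
qed

lemma theta_mult_p: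
  assumes "norm p < 1" "p \<noteq> 0" "z \<noteq> 0"
  shows "theta p (p * z) = - theta p z / z"
proof -
  have "theta p (p * z) = theta p (1 / z)"
    using assms by (simp add: theta_conv_qpoch mult.commute)
  thus ?thesis using assms by (simp add: theta_inverse_arg)
qed

lemma theta_1 [simp]: "norm p < 1 \<Longrightarrow> theta p 1 = 0"
  by (auto simp: theta_conv_qpoch qpoch_eq_0_iff intro: exI[of _ 0])

lemma theta_eq_0_iff:
  assumes "norm p < 1" "z \<noteq> 0" "p \<noteq> 0"
  shows "theta p z = 0 \<longleftrightarrow> (\<exists>i. z = p ^ Suc i) \<or> (\<exists>i. p ^ i * z = 1)"
proof -
  have "(\<exists>i. p ^ i * (p / z) = 1) \<longleftrightarrow> (\<exists>i. z = p ^ Suc i)"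
    using assms by (auto simp: field_simps)
  thus ?thesis by (simp add: theta_conv_qpoch qpoch_eq_0_iff assms)
qed

lemma theta_holomorphic:
  assumes "norm p < 1"
  shows "theta p holomorphic_on (-{0})"
proof -
  have eq: "theta p = (\<lambda>z. qpoch p (p / z) * qpoch p z)"
    using theta_conv_qpoch[OF assms] by auto
  show ?thesis unfolding eq
    by (intro holomorphic_intros holomorphic_on_compose[OF _ holomorphic_on_subset[OF qpoch_entire[OF assms]], unfolded o_def]
         holomorphic_on_subset[OF qpoch_entire[OF assms]]) auto
qed

section \<open>Contour integrals over cycles\<close>

text \<open>An isolated point of Z lies in an interval with rational endpoints that contains no
  other point of Z; the pair of endpoints determines the point.\<close>

lemma countable_isolated_points:
  fixes Z :: "real set"
  shows "countable {t \<in> Z. \<not> t islimpt Z}"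
proof -
  have "\<exists>a b. a \<in> \<rat> \<and> b \<in> \<rat> \<and> a < t \<and> t < b \<and> Z \<inter> {a<..<b} \<subseteq> {t}" if "t \<in> Z" "\<not> t islimpt Z" for t
  proof -
    from that obtain T where T: "open T" "t \<in> T" "\<And>y. y \<in> Z \<Longrightarrow> y \<in> T \<Longrightarrow> y = t"
      unfolding islimpt_def by auto
    then obtain e where e: "e > 0" "ball t e \<subseteq> T"
      using openE by blast
    obtain a where a: "a \<in> \<rat>" "t - e < a" "a < t" using e Rats_dense_in_real[of "t - e" t] by auto
    obtain b where b: "b \<in> \<rat>" "t < b" "b < t + e" using e Rats_dense_in_real[of t "t + e"] by auto
    have "{a<..<b} \<subseteq> ball t e" using a b by (auto simp: dist_real_def)
    thus ?thesis using a b e T(3) by (intro exI[of _ a] exI[of _ b]) auto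
  qed
  then obtain a b where ab: "\<And>t. t \<in> Z \<Longrightarrow> \<not> t islimpt Z \<Longrightarrow>
      a t \<in> \<rat> \<and> b t \<in> \<rat> \<and> a t < t \<and> t < b t \<and> Z \<inter> {a t<..<b t} \<subseteq> {t}"
    by metis
  have "inj_on (\<lambda>t. (a t, b t)) {t \<in> Z. \<not> t islimpt Z}"
  proof (rule inj_onI)
    fix s t assume st: "s \<in> {t \<in> Z. \<not> t islimpt Z}" "t \<in> {t \<in> Z. \<not> t islimpt Z}" "(a s, b s) = (a t, b t)"
    hence "s \<in> Z \<inter> {a t<..<b t}" using ab[of s] by auto
    thus "s = t" using ab[of t] st by auto
  qed
  moreover have "countable ((\<lambda>t. (a t, b t)) ` {t \<in> Z. \<not> t islimpt Z})"
  proof (rule countable_subset)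
    show "countable (\<rat> \<times> \<rat> :: (real \<times> real) set)"
      using countable_rat by auto
  qed (use ab in auto)
  ultimately show ?thesis
    using countable_image_inj_on by blast
qed

text \<open>A path may stay at a point for a set of times of positive measure, but only with vanishing
  velocity at the non-isolated times.\<close>

lemma contour_integral_spike_countable:
  assumes g: "valid_path g" and A: "countable A"
    and eq: "\<And>z. z \<in> path_image g \<Longrightarrow> z \<notin> A \<Longrightarrow> f z = h z"
  shows "(f has_contour_integral I) g \<longleftrightarrow> (h has_contour_integral I) g"
proof -
  define v where "v = (\<lambda>t. vector_derivative g (at t within {0..1}))"
  define Z where "Z = (\<lambda>a. {t \<in> {0..1}. g t = a})"
  from g obtain T where T: "finite T" "g C1_differentiable_on {0..1} - T"
    unfolding valid_path_def piecewise_C1_differentiable_on_def by blast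
  \<comment> \<open>Along the times at which g equals a, the path is constant. If t is an
    accumulation point of these times, the derivative within that set is unique, so it is both 0 and
    the velocity.\<close>
  have v0: "v t = 0" if t: "t \<in> Z a" "t islimpt Z a" "t \<notin> T" for t a
  proof -
    have "g differentiable (at t within {0..1})"
      using T(2) t by (auto simp: C1_differentiable_on_eq Z_def differentiable_at_withinI)
    hence "(g has_vector_derivative v t) (at t within {0..1})"
      unfolding v_def by (simp add: vector_derivative_works)
    hence 1: "(g has_vector_derivative v t) (at t within Z a)"
      by (rule has_vector_derivative_within_subset) (auto simp: Z_def)
    have "((\<lambda>_. a) has_vector_derivative 0) (at t within Z a)"
      by (rule has_vector_derivative_const)
    hence 2: "(g has_vector_derivative 0) (at t within Z a)"
      by (rule has_vector_derivative_transform[rotated 2]) (use t in \<open>auto simp: Z_def\<close>)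
    show ?thesis
      by (rule vector_derivative_unique_within[OF _ 1 2]) (use t trivial_limit_within in blast)
  qed
  \<comment> \<open>Outside N, a time with g t in A is an accumulation point of its level set, so
    the velocity is 0 and the two integrands agree whatever f and h are there.\<close>
  define N where "N = T \<union> (\<Union>a\<in>A. {t \<in> Z a. \<not> t islimpt Z a})"
  have "countable N"
    unfolding N_def using A T(1) countable_isolated_points by (auto intro: countable_finite)
  hence N: "negligible N"
    by (simp add: negligible_iff_null_sets countable_imp_null_set_lborel null_sets_completionI)
  have *: "f (g t) * v t = h (g t) * v t" if "t \<in> {0..1} - N" for t
  proof (cases "g t \<in> A")
    case True
    thus ?thesis using that v0[of t "g t"] by (auto simp: N_def Z_def)
  next
    case False
    thus ?thesis using that eq[of "g t"] by (auto simp: path_image_def)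
  qed
  show ?thesis
    unfolding has_contour_integral_def
    by (rule has_integral_spike_eq[OF N]) (use *[symmetric] in \<open>auto simp: v_def\<close>)
qed

lemma contour_integral_spike_countable_cong:
  assumes "valid_path g" "countable A" "\<And>z. z \<in> path_image g \<Longrightarrow> z \<notin> A \<Longrightarrow> f z = h z"
  shows "contour_integral g f = contour_integral g h"
    and "f contour_integrable_on g \<longleftrightarrow> h contour_integrable_on g"
  using contour_integral_spike_countable[OF assms]
  by (simp_all add: contour_integral_def contour_integrable_on_def)

text \<open>A cycle is turned into a single loop by running back and forth along connecting paths, so that
  Cauchy's theorem for loops carries over to cycles.\<close>

lemma cycle_eq_loop:
  assumes S: "open S" "connected S" "z0 \<in> S"
    and C: "closed_contour C" "contour_image C \<subseteq> S"
  shows "\<exists>g. valid_path g \<and> pathstart g = z0 \<and> pathfinish g = z0 \<and> path_image g \<subseteq> S \<and>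
           (\<forall>f. f holomorphic_on S \<longrightarrow> contour_integral g f = (\<Sum>\<gamma>\<leftarrow>C. contour_integral \<gamma> f))"
  using C
proof (induction C)
  case Nil
  show ?case
    by (intro exI[of _ "linepath z0 z0"] conjI allI impI valid_path_linepath pathstart_linepath
          pathfinish_linepath)
       (use S in \<open>simp_all add: contour_integral_trivial[unfolded linepath_refl]\<close>)
next
  case (Cons \<gamma> C)
  have C: "closed_contour C" "contour_image C \<subseteq> S" and
    \<gamma>: "valid_path \<gamma>" "pathfinish \<gamma> = pathstart \<gamma>" "path_image \<gamma> \<subseteq> S"
    using Cons.prems by (auto simp: closed_contour_def contour_image_def)
  obtain g where g: "valid_path g" "pathstart g = z0" "pathfinish g = z0" "path_image g \<subseteq> S"
    "\<And>f. f holomorphic_on S \<Longrightarrow> contour_integral g f = (\<Sum>\<gamma>\<leftarrow>C. contour_integral \<gamma> f)"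
    using Cons.IH[OF C] by blast
  have "pathstart \<gamma> \<in> S" using \<gamma> by auto
  then obtain c where c: "polynomial_function c" "path_image c \<subseteq> S" "pathstart c = z0" "pathfinish c = pathstart \<gamma>"
    using connected_open_polynomial_connected[OF S] by blast
  have vc: "valid_path c" using c by (simp add: valid_path_polynomial_function)
  define l where "l = c +++ (\<gamma> +++ (reversepath c +++ g))"
  have "contour_integral l f = contour_integral \<gamma> f + contour_integral g f" if "f holomorphic_on S" for f
  proof -
    have int: "f contour_integrable_on k" if "valid_path k" "path_image k \<subseteq> S" for k
      by (rule contour_integrable_holomorphic_simple) (use that \<open>f holomorphic_on S\<close> S in auto)
    show ?thesis unfolding l_def using vc \<gamma> g c
      by (simp add: contour_integrable_joinI contour_integral_reversepath valid_path_join int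
           contour_integrable_reversepath)
  qed
  moreover have "valid_path l" "pathstart l = z0" "pathfinish l = z0" "path_image l \<subseteq> S"
    unfolding l_def using vc \<gamma> g c by (auto simp: path_image_join intro!: valid_path_join)
  ultimately show ?case
    using g(5) by (intro exI[of _ l]) auto
qed

lemma contour_index_eq_integral:
  assumes "closed_contour C" "w \<notin> contour_image C"
  shows "contour_index C w = 1 / (2 * pi * \<i>) * (\<Sum>\<gamma>\<leftarrow>C. contour_integral \<gamma> (\<lambda>z. 1 / (z - w)))"
  using assms
proof (induction C)
  case (Cons g C)
  thus ?case using winding_number_valid_path[of g w]
    by (simp add: closed_contour_def contour_image_def contour_index_def ring_distribs)
qed (auto simp: contour_index_def)

text \<open>With both cycles turned into loops at the same base point, the first followed by the
  reverse of the second is a single loop. Its winding number about a point outside S is the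
  difference of the two indices, since 1/(z - w) is itself holomorphic on S.\<close>

lemma Cauchy_theorem_cycles:
  assumes S: "open S" "connected S"
    and C: "closed_contour C" "contour_image C \<subseteq> S"
    and D: "closed_contour D" "contour_image D \<subseteq> S"
    and index: "\<And>w. w \<notin> S \<Longrightarrow> contour_index C w = contour_index D w"
    and f: "f holomorphic_on S"
  shows "(\<Sum>\<gamma>\<leftarrow>C. contour_integral \<gamma> f) = (\<Sum>\<gamma>\<leftarrow>D. contour_integral \<gamma> f)"
proof (cases "S = {}")
  case True
  have "C = []" "D = []"
    using C D path_image_nonempty True by (auto simp: contour_image_def neq_Nil_conv)
  thus ?thesis by simp
next
  case False
  then obtain z0 where z0: "z0 \<in> S" by blast
  obtain g where g: "valid_path g" "pathstart g = z0" "pathfinish g = z0" "path_image g \<subseteq> S"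
    "\<And>f. f holomorphic_on S \<Longrightarrow> contour_integral g f = (\<Sum>\<gamma>\<leftarrow>C. contour_integral \<gamma> f)"
    using cycle_eq_loop[OF S z0 C] by blast
  obtain k where k: "valid_path k" "pathstart k = z0" "pathfinish k = z0" "path_image k \<subseteq> S"
    "\<And>f. f holomorphic_on S \<Longrightarrow> contour_integral k f = (\<Sum>\<gamma>\<leftarrow>D. contour_integral \<gamma> f)"
    using cycle_eq_loop[OF S z0 D] by blast
  define l where "l = g +++ reversepath k"
  have l: "valid_path l" "pathfinish l = pathstart l" "path_image l \<subseteq> S"
    unfolding l_def using g k by (auto simp: path_image_join intro!: valid_path_join)
  have int: "contour_integral l h = (\<Sum>\<gamma>\<leftarrow>C. contour_integral \<gamma> h) - (\<Sum>\<gamma>\<leftarrow>D. contour_integral \<gamma> h)"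
    if "h holomorphic_on S" for h
  proof -
    have "h contour_integrable_on m" if "valid_path m" "path_image m \<subseteq> S" for m
      by (rule contour_integrable_holomorphic_simple) (use that \<open>h holomorphic_on S\<close> S in auto)
    thus ?thesis
      unfolding l_def using g k that by (simp add: contour_integral_reversepath contour_integrable_reversepath)
  qed
  have "winding_number l w = 0" if "w \<notin> S" for w
  proof -
    have w: "w \<notin> path_image l" "w \<notin> contour_image C" "w \<notin> contour_image D"
      using that l C D by auto
    have "(\<lambda>z. 1 / (z - w)) holomorphic_on S"
      using that by (auto intro!: holomorphic_intros)
    hence "winding_number l w = contour_index C w - contour_index D w"
      using w l C D by (simp add: winding_number_valid_path contour_index_eq_integral int diff_divide_distrib)
    thus ?thesis using index[OF that] by simp
  qed
  hence "contour_integral l f = 0"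
    by (intro contour_integral_unique Cauchy_theorem_global[OF S(1) f l])
  thus ?thesis using int[OF f] by simp
qed

section \<open>Integrals of holomorphic functions against a meromorphic weight\<close>

definition dlog_integrable :: "contour \<Rightarrow> (complex \<Rightarrow> complex) \<Rightarrow> bool" where
  "dlog_integrable C f \<longleftrightarrow>
     (\<forall>\<gamma>\<in>set C. (\<lambda>z. f z / (2 * complex_of_real pi * \<i> * z)) contour_integrable_on \<gamma>)"

lemma dlog_integrable_Cons:
  "dlog_integrable (\<gamma> # C) f \<longleftrightarrow>
     (\<lambda>z. f z / (2 * complex_of_real pi * \<i> * z)) contour_integrable_on \<gamma> \<and> dlog_integrable C f"
  by (simp add: dlog_integrable_def)

lemma dlog_integral_Nil [simp]: "dlog_integral [] f = 0"
  by (simp add: dlog_integral_def)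

lemma dlog_integral_Cons: "dlog_integral (\<gamma> # C) f =
    contour_integral \<gamma> (\<lambda>z. f z / (2 * complex_of_real pi * \<i> * z)) + dlog_integral C f"
  by (simp add: dlog_integral_def)

lemma dlog_integral_cmult:
  assumes "dlog_integrable C f"
  shows "dlog_integral C (\<lambda>z. c * f z) = c * dlog_integral C f"
  using assms
proof (induction C)
  case (Cons \<gamma> C)
  thus ?case
    using contour_integral_lmul[of "\<lambda>z. f z / (2 * complex_of_real pi * \<i> * z)" \<gamma> c]
    by (simp add: dlog_integral_Cons dlog_integrable_Cons ring_distribs)
qed simp

lemma dlog_integrable_cmult: "dlog_integrable C f \<Longrightarrow> dlog_integrable C (\<lambda>z. c * f z)"
  using contour_integrable_lmul[of "\<lambda>z. f z / (2 * complex_of_real pi * \<i> * z)" _ c]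
  by (simp add: dlog_integrable_def)

lemma dlog_integral_sum:
  assumes "finite K" "\<And>k. k \<in> K \<Longrightarrow> dlog_integrable C (f k)"
  shows "dlog_integral C (\<lambda>z. \<Sum>k\<in>K. f k z) = (\<Sum>k\<in>K. dlog_integral C (f k))"
  using assms(2)
proof (induction C)
  case (Cons \<gamma> C)
  thus ?case
    using contour_integral_sum[OF assms(1), of "\<lambda>k z. f k z / (2 * complex_of_real pi * \<i> * z)" \<gamma>]
    by (simp add: dlog_integral_Cons dlog_integrable_Cons sum.distrib sum_divide_distrib)
qed simp

lemma
  assumes "closed_contour C" "countable A" "\<And>z. z \<in> contour_image C \<Longrightarrow> z \<notin> A \<Longrightarrow> f z = h z"
  shows dlog_integral_spike: "dlog_integral C f = dlog_integral C h"
    and dlog_integrable_spike: "dlog_integrable C f \<longleftrightarrow> dlog_integrable C h"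
proof -
  have *: "contour_integral g (\<lambda>z. f z / (2 * complex_of_real pi * \<i> * z)) =
             contour_integral g (\<lambda>z. h z / (2 * complex_of_real pi * \<i> * z))"
          "(\<lambda>z. f z / (2 * complex_of_real pi * \<i> * z)) contour_integrable_on g \<longleftrightarrow>
           (\<lambda>z. h z / (2 * complex_of_real pi * \<i> * z)) contour_integrable_on g"
    if "g \<in> set C" for g
  proof -
    have 1: "valid_path g" using assms that by (auto simp: closed_contour_def)
    have 2: "f z / (2 * complex_of_real pi * \<i> * z) = h z / (2 * complex_of_real pi * \<i> * z)"
      if "z \<in> path_image g" "z \<notin> A" for z
      using assms(3)[of z] that \<open>g \<in> set C\<close> by (auto simp: contour_image_def)
    show "contour_integral g (\<lambda>z. f z / (2 * complex_of_real pi * \<i> * z)) =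
             contour_integral g (\<lambda>z. h z / (2 * complex_of_real pi * \<i> * z))"
          "(\<lambda>z. f z / (2 * complex_of_real pi * \<i> * z)) contour_integrable_on g \<longleftrightarrow>
           (\<lambda>z. h z / (2 * complex_of_real pi * \<i> * z)) contour_integrable_on g"
      using contour_integral_spike_countable_cong[OF 1 assms(2),
          where f = "\<lambda>z. f z / (2 * complex_of_real pi * \<i> * z)" and h = "\<lambda>z. h z / (2 * complex_of_real pi * \<i> * z)"] 2
      by blast+
  qed
  show "dlog_integral C f = dlog_integral C h"
    unfolding dlog_integral_def using * by (intro arg_cong[of _ _ sum_list] map_cong) auto
  show "dlog_integrable C f \<longleftrightarrow> dlog_integrable C h"
    unfolding dlog_integrable_def using * by blast
qed

text \<open>Prepares Cauchy's theorem for a weight with default values at removable singularities: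
  the poles are sparse, so their complement stays open and connected, and the corrected function is
  holomorphic there and differs from W at countably many points only.\<close>

lemma remove_sings_punctured_plane:
  assumes W: "W meromorphic_on (-{0})"
  defines "S \<equiv> {w. w \<noteq> 0 \<and> \<not> is_pole W w}"
  shows "open S" "connected S" "remove_sings W holomorphic_on S"
    "countable {z \<in> -{0}. W z \<noteq> remove_sings W z}"
proof -
  have sparse: "{z. is_pole W z} sparse_in (-{0})"
    using meromorphic_on_imp_not_pole_cosparse[OF W] by (simp add: eventually_cosparse)
  have S: "S = -{0} - {z. is_pole W z}" by (auto simp: S_def)
  show "open S" unfolding S by (intro open_diff_sparse_pts sparse) auto
  show "connected S" unfolding S
    by (intro sparse_imp_connected sparse connected_punctured_universe) auto
  show "remove_sings W holomorphic_on S"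
  proof (intro analytic_imp_holomorphic)
    have "remove_sings W analytic_on {z}" if "z \<in> S" for z
      using nicely_meromorphic_on_imp_analytic_at[OF remove_sings_nicely_meromorphic[OF W], of z] that W
      by (auto simp: S_def meromorphic_on_altdef)
    thus "remove_sings W analytic_on S"
      using analytic_on_analytic_at by blast
  qed
  have "{z. W z \<noteq> remove_sings W z} sparse_in (-{0})"
    using eventually_remove_sings_eq[OF W] by (simp add: eventually_cosparse eq_commute)
  from sparse_imp_countable[OF _ this]
  show "countable {z \<in> -{0}. W z \<noteq> remove_sings W z}"
    by (simp add: Int_def open_Compl)
qed

lemma closed_contour_0: "closed_contour C \<Longrightarrow> 0 \<notin> contour_image C"
  by (auto simp: closed_contour_def contour_image_def)

lemma dlog_integrable_weight:
  assumes C: "closed_contour C" and W: "W meromorphic_on (-{0})"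
    and poles: "\<And>w. w \<noteq> 0 \<Longrightarrow> is_pole W w \<Longrightarrow> w \<notin> contour_image C"
    and h: "h holomorphic_on (-{0})"
  shows "dlog_integrable C (\<lambda>z. h z * W z)"
proof -
  note W' = remove_sings_punctured_plane[OF W]
  have sub: "path_image g \<subseteq> {w. w \<noteq> 0 \<and> \<not> is_pole W w}" if "g \<in> set C" for g
  proof
    fix w assume "w \<in> path_image g"
    hence w: "w \<in> contour_image C" using that by (auto simp: contour_image_def)
    hence "w \<noteq> 0" using closed_contour_0[OF C] by metis
    thus "w \<in> {w. w \<noteq> 0 \<and> \<not> is_pole W w}" using poles[of w] w by auto
  qed
  have "dlog_integrable C (\<lambda>z. h z * remove_sings W z)"
    unfolding dlog_integrable_def
  proof
    fix g assume g: "g \<in> set C"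
    show "(\<lambda>z. h z * remove_sings W z / (2 * complex_of_real pi * \<i> * z)) contour_integrable_on g"
    proof (rule contour_integrable_holomorphic_simple[OF _ W'(1)])
      show "(\<lambda>z. h z * remove_sings W z / (2 * complex_of_real pi * \<i> * z)) holomorphic_on
              {w. w \<noteq> 0 \<and> \<not> is_pole W w}"
        by (intro holomorphic_intros W'(3) holomorphic_on_subset[OF h]) auto
    qed (use g C sub in \<open>auto simp: closed_contour_def\<close>)
  qed
  also have "?this \<longleftrightarrow> ?thesis"
    by (rule dlog_integrable_spike[OF C W'(4)]) (use closed_contour_0[OF C] in auto)
  finally show ?thesis .
qed

text \<open>The origin counts as one more singularity, because of dz/z and because h is holomorphic
  on the punctured plane only; hence the separate assumption about the index of 0.\<close>

lemma dlog_integral_weight_contour_independent: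
  assumes C: "closed_contour C" and D: "closed_contour D" and W: "W meromorphic_on (-{0})"
    and poles: "\<And>w. w \<noteq> 0 \<Longrightarrow> is_pole W w \<Longrightarrow>
      w \<notin> contour_image C \<and> w \<notin> contour_image D \<and> contour_index C w = contour_index D w"
    and index_0: "contour_index C 0 = contour_index D 0"
    and h: "h holomorphic_on (-{0})"
  shows "dlog_integral C (\<lambda>z. h z * W z) = dlog_integral D (\<lambda>z. h z * W z)"
proof -
  note W' = remove_sings_punctured_plane[OF W]
  have sub: "contour_image C \<subseteq> {w. w \<noteq> 0 \<and> \<not> is_pole W w}"
            "contour_image D \<subseteq> {w. w \<noteq> 0 \<and> \<not> is_pole W w}"
    using closed_contour_0[OF C] closed_contour_0[OF D] by (safe; use poles in metis)+
  have "dlog_integral C (\<lambda>z. h z * W z) = dlog_integral C (\<lambda>z. h z * remove_sings W z)"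
    by (rule dlog_integral_spike[OF C W'(4)]) (use closed_contour_0[OF C] in auto)
  also have "\<dots> = dlog_integral D (\<lambda>z. h z * remove_sings W z)"
    unfolding dlog_integral_def
  proof (rule Cauchy_theorem_cycles[OF W'(1,2) C sub(1) D sub(2)])
    fix w assume "w \<notin> {w. w \<noteq> 0 \<and> \<not> is_pole W w}"
    thus "contour_index C w = contour_index D w"
      using poles[of w] index_0 by auto
  next
    show "(\<lambda>z. h z * remove_sings W z / (2 * complex_of_real pi * \<i> * z)) holomorphic_on
              {w. w \<noteq> 0 \<and> \<not> is_pole W w}"
      by (intro holomorphic_intros W'(3) holomorphic_on_subset[OF h]) auto
  qed
  also have "\<dots> = dlog_integral D (\<lambda>z. h z * W z)"
    by (rule dlog_integral_spike[OF D W'(4)]) (use closed_contour_0[OF D] in auto)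
  finally show ?thesis .
qed

section \<open>Contours invariant under inversion\<close>

lemma
  assumes g: "valid_path g" "0 \<notin> path_image g"
  shows valid_path_inverse: "valid_path (\<lambda>t. inverse (g t))"
    and winding_number_inverse: "\<And>w. w \<noteq> 0 \<Longrightarrow> inverse w \<notin> path_image g \<Longrightarrow>
      winding_number (\<lambda>t. inverse (g t)) w = winding_number g (inverse w) - winding_number g 0"
proof -
  have sub: "path_image g \<subseteq> -{0}" using g by auto
  have hol: "inverse holomorphic_on (-{0})" by (intro holomorphic_intros) auto
  have ana: "inverse analytic_on (-{0})" using hol by (simp add: analytic_on_open open_Compl)
  have eq: "(\<lambda>t. inverse (g t)) = inverse \<circ> g" by auto
  show valid: "valid_path (\<lambda>t. inverse (g t))"
    unfolding eq by (rule valid_path_compose_holomorphic[OF g(1) hol _ sub]) auto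
  fix w assume w: "w \<noteq> 0" "inverse w \<notin> path_image g"
  have "w \<notin> path_image (\<lambda>t. inverse (g t))"
    using w by (auto simp: path_image_def)
  hence "winding_number (\<lambda>t. inverse (g t)) w =
           1 / (2 * pi * \<i>) * contour_integral (\<lambda>t. inverse (g t)) (\<lambda>z. 1 / (z - w))"
    by (intro winding_number_valid_path valid)
  also have "contour_integral (\<lambda>t. inverse (g t)) (\<lambda>z. 1 / (z - w)) =
      contour_integral g (\<lambda>z. deriv inverse z * (1 / (inverse z - w)))"
    unfolding eq by (rule contour_integral_comp_analyticW[OF ana g(1) sub])
  \<comment> \<open>Under z -> 1/z the form dz/(z - w) becomes dz/(z - 1/w) - dz/z; the last term is
    the origin of \<open>winding_number g 0\<close>.\<close>
  also have "\<dots> = contour_integral g (\<lambda>z. 1 / (z - inverse w) - 1 / (z - 0))"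
  proof (rule contour_integral_eq)
    fix z assume z: "z \<in> path_image g"
    have z': "z \<noteq> 0" "z \<noteq> inverse w" using z g w by metis+
    hence z'': "1 \<noteq> w * z" using inverse_unique[of w z] by metis
    have "deriv inverse z = - inverse (z ^ 2)"
      by (intro DERIV_imp_deriv) (use z' in \<open>auto intro!: derivative_eq_intros simp: power2_eq_square field_simps\<close>)
    thus "deriv inverse z * (1 / (inverse z - w)) = 1 / (z - inverse w) - 1 / (z - 0)"
      using z' z'' w by (simp add: divide_simps power2_eq_square)
  qed
  also have "\<dots> = contour_integral g (\<lambda>z. 1 / (z - inverse w)) - contour_integral g (\<lambda>z. 1 / (z - 0))"
    by (intro contour_integral_diff contour_integrable_inversediff g w)
  also have "1 / (2 * pi * \<i>) * \<dots> = winding_number g (inverse w) - winding_number g 0"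
    using g w by (simp add: winding_number_valid_path right_diff_distrib)
  finally show "winding_number (\<lambda>t. inverse (g t)) w = winding_number g (inverse w) - winding_number g 0" .
qed

lemma contour_index_contour_inverse:
  assumes "closed_contour C" "w \<noteq> 0" "inverse w \<notin> contour_image C"
  shows "contour_index (contour_inverse C) w = contour_index C 0 - contour_index C (inverse w)"
  using assms
proof (induction C)
  case (Cons g C)
  have g: "valid_path g" "0 \<notin> path_image g" "inverse w \<notin> path_image g"
    using Cons.prems by (auto simp: closed_contour_def contour_image_def)
  have "w \<notin> path_image (\<lambda>t. inverse (g t))"
    using g by (auto simp: path_image_def)
  hence "winding_number (reversepath (\<lambda>t. inverse (g t))) w = winding_number g 0 - winding_number g (inverse w)"
    using winding_number_inverse[OF g(1,2) _ g(3)] valid_path_inverse[OF g(1,2)] Cons.prems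
    by (simp add: winding_number_reversepath valid_path_imp_path)
  moreover have "contour_index (contour_inverse C) w = contour_index C 0 - contour_index C (inverse w)"
    using Cons by (auto simp: closed_contour_def contour_image_def)
  ultimately show ?case by (simp add: contour_index_def contour_inverse_def)
qed (auto simp: contour_index_def contour_inverse_def)

lemma contour_image_contour_inverse: "contour_image (contour_inverse C) = inverse ` contour_image C"
proof -
  have "path_image (reversepath (\<lambda>t. inverse (g t :: complex))) = inverse ` path_image g" for g
    using path_image_reversepath[of "\<lambda>t. inverse (g t)"] by (auto simp: path_image_def)
  thus ?thesis by (simp add: contour_image_def contour_inverse_def image_UN)
qed

lemma
  assumes "symmetric_contour C" "w \<noteq> 0"
  shows symmetric_contour_image: "inverse w \<in> contour_image C \<longleftrightarrow> w \<in> contour_image C"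
    and symmetric_contour_index: "w \<notin> contour_image C \<Longrightarrow>
           contour_index C (inverse w) = contour_index C 0 - contour_index C w"
proof -
  have C: "closed_contour C" "contour_image C = inverse ` contour_image C"
    "\<And>w. w \<notin> contour_image C \<Longrightarrow> contour_index C w = contour_index (contour_inverse C) w"
    using assms by (auto simp: symmetric_contour_def same_contour_def contour_image_contour_inverse)
  show eq: "inverse w \<in> contour_image C \<longleftrightarrow> w \<in> contour_image C"
    by (subst C(2)) auto
  show "contour_index C (inverse w) = contour_index C 0 - contour_index C w" if "w \<notin> contour_image C"
    using contour_index_contour_inverse[OF C(1), of "inverse w"] C(3)[of "inverse w"] eq that assms by simp
qed

text \<open>With index 1 at the origin, the indices at w and 1/w add up to 1, so inversion sends
  interior points to points of index 0.\<close>

lemma symmetric_contour_not_interior: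
  assumes "symmetric_contour C" "0 \<in> contour_interior C" "inverse w \<in> contour_interior C" "w \<noteq> 0"
  shows "w \<notin> contour_image C" "contour_index C w = 0"
  using symmetric_contour_image[OF assms(1,4)] symmetric_contour_index[OF assms(1,4)] assms
  by (auto simp: contour_interior_def)

text \<open>The index is continuous off the contour, and the points p^i a, all of index 1, tend to
  0. This supplies the condition at the origin in \<open>II_contour\<close>.\<close>

lemma contour_interior_0:
  assumes C: "closed_contour C" and p: "norm p < 1" and "\<And>i. p ^ i * a \<in> contour_interior C"
  shows "0 \<in> contour_interior C"
proof -
  have 0: "0 \<notin> contour_image C" by (rule closed_contour_0[OF C])
  have "continuous (at 0) (contour_index C)"
    using C
  proof (induction C)
    case Nil
    show ?case by (simp add: contour_index_def[abs_def])
  next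
    case (Cons g C)
    have eq: "contour_index (g # C) = (\<lambda>w. winding_number g w + contour_index C w)"
      by (auto simp: contour_index_def)
    have "continuous (at 0) (winding_number g)"
      using Cons.prems by (intro continuous_at_winding_number) (auto simp: closed_contour_def valid_path_imp_path)
    moreover have "continuous (at 0) (contour_index C)"
      using Cons by (simp add: closed_contour_def)
    ultimately show ?case unfolding eq by (rule continuous_add)
  qed
  moreover have "(\<lambda>i. p ^ i * a) \<longlonglongrightarrow> 0"
    using p by (intro tendsto_mult_left_zero LIMSEQ_power_zero)
  ultimately have "(\<lambda>i. contour_index C (p ^ i * a)) \<longlonglongrightarrow> contour_index C 0"
    by (rule isCont_tendsto_compose)
  moreover have "contour_index C (p ^ i * a) = 1" for i
    using assms(3)[of i] by (auto simp: contour_interior_def)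
  ultimately have "contour_index C 0 = 1"
    by (simp add: LIMSEQ_const_iff)
  thus ?thesis using 0 by (simp add: contour_interior_def)
qed

section \<open>Iterated integrals of separable functions\<close>

text \<open>For fixed earlier variables, only countably many values of the next one are excluded:
  those in A and those in B(z) for an earlier z. In the induction B(z) for the outermost variable z
  is added to A.\<close>

lemma multi_dlog_integral_generic_cong:
  assumes C: "closed_contour C" and "countable A" "\<And>z. countable (B z)"
    and "\<And>zs. length zs = N \<Longrightarrow> set zs \<subseteq> contour_image C \<Longrightarrow> set zs \<inter> A = {} \<Longrightarrow>
           (\<And>i j. i < j \<Longrightarrow> j < N \<Longrightarrow> zs ! j \<notin> B (zs ! i)) \<Longrightarrow> f zs = h zs"
  shows "multi_dlog_integral C N f = multi_dlog_integral C N h"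
  using assms(2,4)
proof (induction N arbitrary: A f h)
  case 0
  thus ?case by simp
next
  case (Suc N)
  show ?case unfolding multi_dlog_integral.simps
  proof (rule dlog_integral_spike[OF C Suc.prems(1)])
    fix z assume z: "z \<in> contour_image C" "z \<notin> A"
    show "multi_dlog_integral C N (\<lambda>zs. f (z # zs)) = multi_dlog_integral C N (\<lambda>zs. h (z # zs))"
    proof (rule Suc.IH[of "A \<union> B z"])
      show "countable (A \<union> B z)" using Suc.prems assms(3) by auto
      fix zs assume zs: "length zs = N" "set zs \<subseteq> contour_image C" "set zs \<inter> (A \<union> B z) = {}"
        "\<And>i j. i < j \<Longrightarrow> j < N \<Longrightarrow> zs ! j \<notin> B (zs ! i)"
      show "f (z # zs) = h (z # zs)"
      proof (rule Suc.prems(2))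
        fix i j assume ij: "i < j" "j < Suc N"
        then obtain j' where j: "j = Suc j'" "j' < N" by (cases j) auto
        show "(z # zs) ! j \<notin> B ((z # zs) ! i)"
        proof (cases i)
          case 0
          have "zs ! j' \<in> set zs" using j zs by auto
          thus ?thesis using 0 j zs(3) by auto
        next
          case (Suc i')
          thus ?thesis using zs(4)[of i' j'] j ij by simp
        qed
      qed (use z zs in auto)
    qed
  qed
qed

lemma multi_dlog_integral_cong:
  assumes C: "closed_contour C"
    and "\<And>zs. length zs = N \<Longrightarrow> set zs \<subseteq> contour_image C \<Longrightarrow> f zs = h zs"
  shows "multi_dlog_integral C N f = multi_dlog_integral C N h"
  by (rule multi_dlog_integral_generic_cong[OF C, of "{}" "\<lambda>_. {}"]) (use assms in auto)

text \<open>Collects all that the algebra of iterated integrals requires of a contour and a weight.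
  Every use of linearity needs integrability, since integrals of non-integrable functions are
  default values.\<close>

definition dlog_weight :: "contour \<Rightarrow> (complex \<Rightarrow> complex) \<Rightarrow> bool" where
  "dlog_weight C E \<longleftrightarrow> closed_contour C \<and>
     (\<forall>h. h holomorphic_on (-{0}) \<longrightarrow> dlog_integrable C (\<lambda>z. h z * E z))"

text \<open>The coefficients c are arbitrary for the sake of the induction: while the inner
  integrals are evaluated, the factor of the outermost variable is a constant and is absorbed into
  them.\<close>

lemma multi_dlog_integral_separated:
  fixes g :: "'a \<Rightarrow> nat \<Rightarrow> complex \<Rightarrow> complex"
  assumes K: "finite K" and E: "dlog_weight C E"
    and g: "\<And>k i. k \<in> K \<Longrightarrow> i < N \<Longrightarrow> g k i holomorphic_on (-{0})"
  shows "multi_dlog_integral C N (\<lambda>zs. (\<Sum>k\<in>K. c k * (\<Prod>i<N. g k i (zs ! i))) * (\<Prod>i<N. E (zs ! i))) =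
           (\<Sum>k\<in>K. c k * (\<Prod>i<N. dlog_integral C (\<lambda>z. g k i z * E z)))"
  using g
proof (induction N arbitrary: c g)
  case 0
  show ?case by simp
next
  case (Suc N)
  define L where "L = (\<lambda>k. \<Prod>i<N. dlog_integral C (\<lambda>z. g k (Suc i) z * E z))"
  have "multi_dlog_integral C N (\<lambda>zs. (\<Sum>k\<in>K. c k * (\<Prod>i<Suc N. g k i ((z # zs) ! i))) * (\<Prod>i<Suc N. E ((z # zs) ! i)))
      = (\<Sum>k\<in>K. (c k * L k) * (g k 0 z * E z))" for z
  proof -
    have "multi_dlog_integral C N (\<lambda>zs. (\<Sum>k\<in>K. c k * (\<Prod>i<Suc N. g k i ((z # zs) ! i))) * (\<Prod>i<Suc N. E ((z # zs) ! i)))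
      = multi_dlog_integral C N (\<lambda>zs. (\<Sum>k\<in>K. (c k * g k 0 z * E z) * (\<Prod>i<N. g k (Suc i) (zs ! i))) * (\<Prod>i<N. E (zs ! i)))"
      unfolding prod.lessThan_Suc_shift by (simp add: sum_distrib_left sum_distrib_right mult_ac)
    also have "\<dots> = (\<Sum>k\<in>K. (c k * g k 0 z * E z) * L k)"
      unfolding L_def by (rule Suc.IH) (use Suc.prems in auto)
    finally show ?thesis by (simp add: mult_ac)
  qed
  hence "multi_dlog_integral C (Suc N) (\<lambda>zs. (\<Sum>k\<in>K. c k * (\<Prod>i<Suc N. g k i (zs ! i))) * (\<Prod>i<Suc N. E (zs ! i))) =
    dlog_integral C (\<lambda>z. \<Sum>k\<in>K. (c k * L k) * (g k 0 z * E z))"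
    by simp
  also have "\<dots> = (\<Sum>k\<in>K. dlog_integral C (\<lambda>z. (c k * L k) * (g k 0 z * E z)))"
    by (rule dlog_integral_sum[OF K]) (use E Suc.prems in \<open>auto simp: dlog_weight_def intro!: dlog_integrable_cmult\<close>)
  also have "\<dots> = (\<Sum>k\<in>K. (c k * L k) * dlog_integral C (\<lambda>z. g k 0 z * E z))"
    by (intro sum.cong refl dlog_integral_cmult) (use E Suc.prems in \<open>auto simp: dlog_weight_def\<close>)
  also have "\<dots> = (\<Sum>k\<in>K. c k * (\<Prod>i<Suc N. dlog_integral C (\<lambda>z. g k i z * E z)))"
    unfolding L_def prod.lessThan_Suc_shift by (simp add: mult_ac)
  finally show ?case .
qed

definition separated_form ::
    "nat \<Rightarrow> (complex list \<Rightarrow> complex) \<Rightarrow> 'a set \<Rightarrow> ('a \<Rightarrow> nat \<Rightarrow> complex \<Rightarrow> complex) \<Rightarrow> bool" where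
  "separated_form N f K g \<longleftrightarrow> finite K \<and> (\<forall>k\<in>K. \<forall>i<N. g k i holomorphic_on (-{0})) \<and>
     (\<forall>zs. length zs = N \<longrightarrow> 0 \<notin> set zs \<longrightarrow> f zs = (\<Sum>k\<in>K. \<Prod>i<N. g k i (zs ! i)))"

text \<open>The index type is fixed because a definition cannot quantify over types;
  \<open>separableI\<close> encodes any countable index type in it.\<close>

definition separable :: "nat \<Rightarrow> (complex list \<Rightarrow> complex) \<Rightarrow> bool" where
  "separable N f \<longleftrightarrow> (\<exists>(K :: nat set) g. separated_form N f K g)"

lemma separated_formD:
  assumes "separated_form N f K g"
  shows "finite K" "\<And>k i. k \<in> K \<Longrightarrow> i < N \<Longrightarrow> g k i holomorphic_on (-{0})"
    "\<And>zs. length zs = N \<Longrightarrow> 0 \<notin> set zs \<Longrightarrow> f zs = (\<Sum>k\<in>K. \<Prod>i<N. g k i (zs ! i))"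
  using assms by (auto simp: separated_form_def)

lemma separableI:
  fixes K :: "'a :: countable set"
  assumes "finite K" "\<And>k i. k \<in> K \<Longrightarrow> i < N \<Longrightarrow> g k i holomorphic_on (-{0})"
    "\<And>zs. length zs = N \<Longrightarrow> 0 \<notin> set zs \<Longrightarrow> f zs = (\<Sum>k\<in>K. \<Prod>i<N. g k i (zs ! i))"
  shows "separable N f"
  unfolding separable_def separated_form_def
proof (intro exI conjI ballI allI impI)
  show "finite (to_nat ` K)" using assms by auto
  show "g (from_nat k) i holomorphic_on (-{0})" if "k \<in> to_nat ` K" "i < N" for k i
    using that assms(2) by auto
  show "f zs = (\<Sum>k\<in>to_nat ` K. \<Prod>i<N. g (from_nat k) i (zs ! i))" if "length zs = N" "0 \<notin> set zs" for zs
    using assms(3)[OF that] by (subst sum.reindex) auto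
qed

lemma separable_mult:
  assumes "separable N f" "separable N h"
  shows "separable N (\<lambda>zs. f zs * h zs)"
proof -
  obtain K :: "nat set" and g where "separated_form N f K g"
    using assms(1) unfolding separable_def by blast
  note K = separated_formD[OF this]
  obtain L :: "nat set" and l where "separated_form N h L l"
    using assms(2) unfolding separable_def by blast
  note L = separated_formD[OF this]
  show ?thesis
  proof (rule separableI[of "K \<times> L" _ "\<lambda>k i z. g (fst k) i z * l (snd k) i z"])
    show "f zs * h zs = (\<Sum>k\<in>K \<times> L. \<Prod>i<N. g (fst k) i (zs ! i) * l (snd k) i (zs ! i))"
      if "length zs = N" "0 \<notin> set zs" for zs
      using K(3)[OF that] L(3)[OF that]
      by (simp add: sum_product sum.cartesian_product prod.distrib case_prod_unfold)
  qed (use K L in \<open>auto intro!: holomorphic_intros\<close>)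
qed

lemma separable_sum:
  fixes I :: "nat set"
  assumes "finite I" "\<And>a. a \<in> I \<Longrightarrow> separable N (f a)"
  shows "separable N (\<lambda>zs. \<Sum>a\<in>I. f a zs)"
proof -
  have "\<forall>a\<in>I. \<exists>(K :: nat set) g. separated_form N (f a) K g"
    using assms(2) unfolding separable_def by blast
  then obtain K :: "nat \<Rightarrow> nat set" and g where "\<And>a. a \<in> I \<Longrightarrow> separated_form N (f a) (K a) (g a)"
    by metis
  note K = separated_formD[OF this]
  show ?thesis
  proof (rule separableI[of "Sigma I K" _ "\<lambda>k. g (fst k) (snd k)"])
    show "(\<Sum>a\<in>I. f a zs) = (\<Sum>k\<in>Sigma I K. \<Prod>i<N. g (fst k) (snd k) i (zs ! i))"
      if "length zs = N" "0 \<notin> set zs" for zs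
      using K(1) K(3)[OF _ that] assms(1) by (simp add: sum.Sigma case_prod_unfold)
  qed (use K assms in auto)
qed

lemma separable_1 [simp, intro]: "separable N (\<lambda>_. 1)"
  by (rule separableI[of "{0::nat}" _ "\<lambda>_ i _. 1"]) auto

lemma separable_slot:
  assumes "h holomorphic_on (-{0})" "j < N"
  shows "separable N (\<lambda>zs. h (zs ! j))"
proof (rule separableI[of "{0::nat}" _ "\<lambda>_ i. if i = j then h else (\<lambda>_. 1)"])
  fix zs :: "complex list"
  have "(\<Prod>i<N. (if i = j then h else (\<lambda>_. 1)) (zs ! i)) = (\<Prod>i<N. if i = j then h (zs ! i) else 1)"
    by (intro prod.cong) auto
  thus "h (zs ! j) = (\<Sum>k\<in>{0::nat}. \<Prod>i<N. (if i = j then h else (\<lambda>_. 1)) (zs ! i))"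
    using assms by (simp add: prod.delta)
qed (use assms in auto)

lemma separable_prod:
  assumes "\<And>a. a \<in> I \<Longrightarrow> separable N (f a)"
  shows "separable N (\<lambda>zs. \<Prod>a\<in>I. f a zs)"
  using assms
proof (induction I rule: infinite_finite_induct)
  case (insert a I)
  thus ?case by (simp add: separable_mult)
qed auto

lemma separable_power: "separable N f \<Longrightarrow> separable N (\<lambda>zs. f zs ^ n)"
  by (induction n) (auto simp: separable_mult)

lemma separable_cong:
  assumes "separable N f" "\<And>zs. length zs = N \<Longrightarrow> 0 \<notin> set zs \<Longrightarrow> f zs = h zs"
  shows "separable N h"
  using assms unfolding separable_def separated_form_def by simp

lemma contour_image_nonzero: "closed_contour C \<Longrightarrow> set zs \<subseteq> contour_image C \<Longrightarrow> 0 \<notin> set zs"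
  using closed_contour_0 by blast

lemma multi_dlog_integral_separated_form:
  fixes g :: "'a \<Rightarrow> nat \<Rightarrow> complex \<Rightarrow> complex"
  assumes K: "finite K" and E: "dlog_weight C E"
    and g: "\<And>k i. k \<in> K \<Longrightarrow> i < N \<Longrightarrow> g k i holomorphic_on (-{0})"
    and f: "\<And>zs. length zs = N \<Longrightarrow> 0 \<notin> set zs \<Longrightarrow> f zs = (\<Sum>k\<in>K. \<Prod>i<N. g k i (zs ! i))"
  shows "multi_dlog_integral C N (\<lambda>zs. f zs * (\<Prod>i<N. E (zs ! i))) =
           (\<Sum>k\<in>K. \<Prod>i<N. dlog_integral C (\<lambda>z. g k i z * E z))"
proof -
  have C: "closed_contour C" using E by (simp add: dlog_weight_def)
  have "multi_dlog_integral C N (\<lambda>zs. f zs * (\<Prod>i<N. E (zs ! i))) =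
          multi_dlog_integral C N (\<lambda>zs. (\<Sum>k\<in>K. 1 * (\<Prod>i<N. g k i (zs ! i))) * (\<Prod>i<N. E (zs ! i)))"
    by (rule multi_dlog_integral_cong[OF C]) (use f contour_image_nonzero[OF C] in auto)
  also have "\<dots> = (\<Sum>k\<in>K. 1 * (\<Prod>i<N. dlog_integral C (\<lambda>z. g k i z * E z)))"
    by (rule multi_dlog_integral_separated[OF K E g])
  finally show ?thesis by simp
qed

lemma multi_dlog_integral_contour_independent:
  assumes "separable N f" "dlog_weight C E" "dlog_weight D E"
    "\<And>h. h holomorphic_on (-{0}) \<Longrightarrow> dlog_integral C (\<lambda>z. h z * E z) = dlog_integral D (\<lambda>z. h z * E z)"
  shows "multi_dlog_integral C N (\<lambda>zs. f zs * (\<Prod>i<N. E (zs ! i))) =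
         multi_dlog_integral D N (\<lambda>zs. f zs * (\<Prod>i<N. E (zs ! i)))"
proof -
  obtain K :: "nat set" and g where "separated_form N f K g"
    using assms(1) unfolding separable_def by blast
  note K = separated_formD[OF this]
  have eq: "multi_dlog_integral X N (\<lambda>zs. f zs * (\<Prod>i<N. E (zs ! i))) =
          (\<Sum>k\<in>K. \<Prod>i<N. dlog_integral X (\<lambda>z. g k i z * E z))" if "dlog_weight X E" for X
    by (rule multi_dlog_integral_separated_form[OF K(1) that]) (rule K, assumption+)+
  show ?thesis
    unfolding eq[OF assms(2)] eq[OF assms(3)]
    by (intro sum.cong prod.cong refl assms(4) K(2)) auto
qed

lemma multi_dlog_integral_cmult:
  assumes "separable N f" "dlog_weight C E"
  shows "multi_dlog_integral C N (\<lambda>zs. c * f zs * (\<Prod>i<N. E (zs ! i))) =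
         c * multi_dlog_integral C N (\<lambda>zs. f zs * (\<Prod>i<N. E (zs ! i)))"
proof -
  obtain K :: "nat set" and g where "separated_form N f K g"
    using assms(1) unfolding separable_def by blast
  note K = separated_formD[OF this]
  have C: "closed_contour C" using assms(2) by (simp add: dlog_weight_def)
  have "multi_dlog_integral C N (\<lambda>zs. c * f zs * (\<Prod>i<N. E (zs ! i))) =
          multi_dlog_integral C N (\<lambda>zs. (\<Sum>k\<in>K. c * (\<Prod>i<N. g k i (zs ! i))) * (\<Prod>i<N. E (zs ! i)))"
  proof (rule multi_dlog_integral_cong[OF C])
    fix zs :: "complex list" assume zs: "length zs = N" "set zs \<subseteq> contour_image C"
    show "c * f zs * (\<Prod>i<N. E (zs ! i)) = (\<Sum>k\<in>K. c * (\<Prod>i<N. g k i (zs ! i))) * (\<Prod>i<N. E (zs ! i))"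
      unfolding K(3)[OF zs(1) contour_image_nonzero[OF C zs(2)]] by (simp only: sum_distrib_left)
  qed
  also have "\<dots> = (\<Sum>k\<in>K. c * (\<Prod>i<N. dlog_integral C (\<lambda>z. g k i z * E z)))"
    by (rule multi_dlog_integral_separated[OF K(1) assms(2)]) (rule K, assumption+)
  also have "\<dots> = c * (\<Sum>k\<in>K. \<Prod>i<N. dlog_integral C (\<lambda>z. g k i z * E z))"
    by (simp only: sum_distrib_left)
  also have "(\<Sum>k\<in>K. \<Prod>i<N. dlog_integral C (\<lambda>z. g k i z * E z)) =
      multi_dlog_integral C N (\<lambda>zs. f zs * (\<Prod>i<N. E (zs ! i)))"
    by (rule multi_dlog_integral_separated_form[OF K(1) assms(2), symmetric]) (rule K, assumption+)+
  finally show ?thesis .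
qed

lemma multi_dlog_integral_sum:
  fixes I :: "nat set"
  assumes I: "finite I" "\<And>a. a \<in> I \<Longrightarrow> separable N (f a)" and E: "dlog_weight C E"
  shows "multi_dlog_integral C N (\<lambda>zs. (\<Sum>a\<in>I. f a zs) * (\<Prod>i<N. E (zs ! i))) =
         (\<Sum>a\<in>I. multi_dlog_integral C N (\<lambda>zs. f a zs * (\<Prod>i<N. E (zs ! i))))"
proof -
  have "\<forall>a\<in>I. \<exists>(K :: nat set) g. separated_form N (f a) K g"
    using assms(2) unfolding separable_def by blast
  then obtain K :: "nat \<Rightarrow> nat set" and g where "\<And>a. a \<in> I \<Longrightarrow> separated_form N (f a) (K a) (g a)"
    by metis
  note K = separated_formD[OF this]
  have "multi_dlog_integral C N (\<lambda>zs. (\<Sum>a\<in>I. f a zs) * (\<Prod>i<N. E (zs ! i))) =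
      (\<Sum>k\<in>Sigma I K. \<Prod>i<N. dlog_integral C (\<lambda>z. g (fst k) (snd k) i z * E z))"
  proof (rule multi_dlog_integral_separated_form[OF _ E])
    show "(\<Sum>a\<in>I. f a zs) = (\<Sum>k\<in>Sigma I K. \<Prod>i<N. g (fst k) (snd k) i (zs ! i))"
      if "length zs = N" "0 \<notin> set zs" for zs
      using K(1) K(3)[OF _ that] I(1) by (simp add: sum.Sigma case_prod_unfold)
  qed (use K I in auto)
  also have "\<dots> = (\<Sum>a\<in>I. \<Sum>k\<in>K a. \<Prod>i<N. dlog_integral C (\<lambda>z. g a k i z * E z))"
    using K(1) I(1) by (simp add: sum.Sigma case_prod_unfold)
  also have "\<dots> = (\<Sum>a\<in>I. multi_dlog_integral C N (\<lambda>zs. f a zs * (\<Prod>i<N. E (zs ! i))))"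
  proof (intro sum.cong refl)
    fix a assume a: "a \<in> I"
    show "(\<Sum>k\<in>K a. \<Prod>i<N. dlog_integral C (\<lambda>z. g a k i z * E z)) =
            multi_dlog_integral C N (\<lambda>zs. f a zs * (\<Prod>i<N. E (zs ! i)))"
      by (rule multi_dlog_integral_separated_form[OF K(1)[OF a] E, symmetric]) (rule K[OF a], assumption+)+
  qed
  finally show ?thesis .
qed

text \<open>Permuting the variables only permutes the factors of each separated term, and the
  resulting product of one-variable integrals is commutative. No order of integration is ever
  exchanged.\<close>

lemma
  assumes f: "separable N f" and \<pi>: "\<pi> permutes {..<N}"
  defines "f' \<equiv> (\<lambda>zs. f (map (\<lambda>i. zs ! \<pi> i) [0..<N]))"
  shows separable_permute: "separable N f'"
    and multi_dlog_integral_permute: "dlog_weight C E \<Longrightarrow>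
         multi_dlog_integral C N (\<lambda>zs. f' zs * (\<Prod>i<N. E (zs ! i))) =
         multi_dlog_integral C N (\<lambda>zs. f zs * (\<Prod>i<N. E (zs ! i)))"
proof -
  obtain K :: "nat set" and g where "separated_form N f K g"
    using f unfolding separable_def by blast
  note K = separated_formD[OF this]
  have \<pi>_lt: "\<pi> i < N \<longleftrightarrow> i < N" "inv \<pi> i < N \<longleftrightarrow> i < N" for i
    using permutes_in_image[OF \<pi>, of i] permutes_in_image[OF permutes_inv[OF \<pi>], of i] by auto
  have inv: "inv \<pi> (\<pi> i) = i" for i
    using permutes_inverses[OF \<pi>] by simp
  \<comment> \<open>After the permutation, slot i carries the factor that belonged to slot
    \<open>inv \<pi> i\<close>; reindexing by \<pi> restores the original order.\<close>
  have perm: "(\<Prod>i<N. F (inv \<pi> i) i) = (\<Prod>i<N. F i (\<pi> i))" for F :: "nat \<Rightarrow> nat \<Rightarrow> complex"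
    using prod.permute[OF \<pi>, of "\<lambda>i. F (inv \<pi> i) i"] by (simp add: o_def inv)
  have f': "f' zs = (\<Sum>k\<in>K. \<Prod>i<N. g k (inv \<pi> i) (zs ! i))" if zs: "length zs = N" "0 \<notin> set zs" for zs
  proof -
    have "zs ! \<pi> i \<in> set zs" if "i < N" for i
      using \<pi>_lt(1)[of i] zs(1) that by (intro nth_mem) simp
    hence "set (map (\<lambda>i. zs ! \<pi> i) [0..<N]) \<subseteq> set zs"
      by (simp add: image_subset_iff)
    hence 0: "0 \<notin> set (map (\<lambda>i. zs ! \<pi> i) [0..<N])"
      using zs(2) by (rule contra_subsetD)
    have "f' zs = (\<Sum>k\<in>K. \<Prod>i<N. g k i (map (\<lambda>i. zs ! \<pi> i) [0..<N] ! i))"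
      unfolding f'_def by (rule K(3)[OF _ 0]) simp
    also have "\<dots> = (\<Sum>k\<in>K. \<Prod>i<N. g k i (zs ! \<pi> i))"
      by (intro sum.cong prod.cong) auto
    also have "\<dots> = (\<Sum>k\<in>K. \<Prod>i<N. g k (inv \<pi> i) (zs ! i))"
      by (intro sum.cong refl perm[symmetric])
    finally show ?thesis .
  qed
  show "separable N f'"
  proof (rule separableI[of K N "\<lambda>k i. g k (inv \<pi> i)"])
    fix k i assume "k \<in> K" "i < N"
    thus "g k (inv \<pi> i) holomorphic_on (-{0})" by (intro K(2)) (simp_all add: \<pi>_lt)
  qed (rule K(1), rule f')
  assume E: "dlog_weight C E"
  have "multi_dlog_integral C N (\<lambda>zs. f' zs * (\<Prod>i<N. E (zs ! i))) =
          (\<Sum>k\<in>K. \<Prod>i<N. dlog_integral C (\<lambda>z. g k (inv \<pi> i) z * E z))"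
  proof (rule multi_dlog_integral_separated_form[OF K(1) E])
    fix k i assume "k \<in> K" "i < N"
    thus "g k (inv \<pi> i) holomorphic_on (-{0})" by (intro K(2)) (simp_all add: \<pi>_lt)
  qed (rule f')
  also have "\<dots> = (\<Sum>k\<in>K. \<Prod>i<N. dlog_integral C (\<lambda>z. g k i z * E z))"
    by (intro sum.cong refl perm)
  also have "\<dots> = multi_dlog_integral C N (\<lambda>zs. f zs * (\<Prod>i<N. E (zs ! i)))"
    by (rule multi_dlog_integral_separated_form[OF K(1) E, symmetric]) (rule K, assumption+)+
  finally show "multi_dlog_integral C N (\<lambda>zs. f' zs * (\<Prod>i<N. E (zs ! i))) =
         multi_dlog_integral C N (\<lambda>zs. f zs * (\<Prod>i<N. E (zs ! i)))" .
qed

text \<open>Only the N transpositions of 0 with k are summed, including the identity for k = 0,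
  because the function to be symmetrized singles out slot 0: one term per choice of the
  distinguished variable, as in an interpolation formula.\<close>

lemma multi_dlog_integral_symmetrize:
  assumes f: "separable N f" and E: "dlog_weight C E"
    and AB: "countable A" "\<And>z. countable (B z)"
    and sym: "\<And>zs. length zs = N \<Longrightarrow> set zs \<subseteq> contour_image C \<Longrightarrow> set zs \<inter> A = {} \<Longrightarrow>
           (\<And>i j. i < j \<Longrightarrow> j < N \<Longrightarrow> zs ! j \<notin> B (zs ! i)) \<Longrightarrow>
           (\<Sum>k<N. f (map (\<lambda>i. zs ! Transposition.transpose 0 k i) [0..<N])) = h zs"
  shows "multi_dlog_integral C N (\<lambda>zs. h zs * (\<Prod>i<N. E (zs ! i))) =
         of_nat N * multi_dlog_integral C N (\<lambda>zs. f zs * (\<Prod>i<N. E (zs ! i)))"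
proof -
  have C: "closed_contour C" using E by (simp add: dlog_weight_def)
  have \<pi>: "Transposition.transpose 0 k permutes {..<N}" if "k \<in> {..<N}" for k
    using that by (intro permutes_swap_id) auto
  have "multi_dlog_integral C N (\<lambda>zs. h zs * (\<Prod>i<N. E (zs ! i))) =
      multi_dlog_integral C N (\<lambda>zs. (\<Sum>k<N. f (map (\<lambda>i. zs ! Transposition.transpose 0 k i) [0..<N])) * (\<Prod>i<N. E (zs ! i)))"
  proof (rule multi_dlog_integral_generic_cong[where A = A and B = B, OF C AB])
    fix zs :: "complex list"
    assume zs: "length zs = N" "set zs \<subseteq> contour_image C" "set zs \<inter> A = {}"
           "\<And>i j. i < j \<Longrightarrow> j < N \<Longrightarrow> zs ! j \<notin> B (zs ! i)"
    show "h zs * (\<Prod>i<N. E (zs ! i)) =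
          (\<Sum>k<N. f (map (\<lambda>i. zs ! Transposition.transpose 0 k i) [0..<N])) * (\<Prod>i<N. E (zs ! i))"
      by (subst sym[OF zs]) simp_all
  qed
  also have "\<dots> = (\<Sum>k<N. multi_dlog_integral C N (\<lambda>zs. f (map (\<lambda>i. zs ! Transposition.transpose 0 k i) [0..<N]) * (\<Prod>i<N. E (zs ! i))))"
    by (rule multi_dlog_integral_sum[OF _ _ E]) (auto intro!: separable_permute[OF f \<pi>])
  also have "\<dots> = (\<Sum>k<N. multi_dlog_integral C N (\<lambda>zs. f zs * (\<Prod>i<N. E (zs ! i))))"
    by (intro sum.cong refl multi_dlog_integral_permute[OF f \<pi> E])
  finally show ?thesis by simp
qed

section \<open>Symmetric theta functions\<close>

locale nome =
  fixes p :: complex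
  assumes p_nz: "p \<noteq> 0" and p_lt: "norm p < 1"
begin

section \<open>Quasi-periodicity and zeros of the theta function\<close>

lemma theta_inv: "z \<noteq> 0 \<Longrightarrow> theta p (1 / z) = - theta p z / z"
  by (rule theta_inverse_arg[OF p_lt])

lemma theta_p: "z \<noteq> 0 \<Longrightarrow> theta p (p * z) = - theta p z / z"
  by (rule theta_mult_p[OF p_lt p_nz])

lemma theta_hol: "theta p holomorphic_on (-{0})"
  by (rule theta_holomorphic[OF p_lt])

lemma theta_zero_cases:
  assumes "theta p (x / y) = 0" "x \<noteq> 0" "y \<noteq> 0"
  obtains i where "x = p ^ i * y" | i where "y = p ^ i * x"
proof -
  have "(\<exists>i. x / y = p ^ Suc i) \<or> (\<exists>i. p ^ i * (x / y) = 1)"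
    using theta_eq_0_iff[OF p_lt _ p_nz, of "x / y"] assms by auto
  thus ?thesis
  proof
    assume "\<exists>i. x / y = p ^ Suc i"
    then obtain i where "x / y = p ^ Suc i" by blast
    hence "x = p ^ Suc i * y" using assms by (simp add: field_simps)
    thus ?thesis by (rule that(1))
  next
    assume "\<exists>i. p ^ i * (x / y) = 1"
    then obtain i where "p ^ i * (x / y) = 1" by blast
    hence "y = p ^ i * x" using assms by (simp add: field_simps)
    thus ?thesis by (rule that(2))
  qed
qed

text \<open>At 1 the factor 1 - w splits off and the derivative is -(p;p)^2. Differentiating
  \<theta>(pw) = -\<theta>(w)/w at a zero, where the term with \<theta>(w) drops out, carries
  simplicity to all zeros, which are the integral powers of p.\<close>

lemma theta_deriv_nonzero:
  assumes "theta p z = 0" "z \<noteq> 0"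
  shows "deriv (theta p) z \<noteq> 0"
proof -
  have der: "(theta p has_field_derivative deriv (theta p) w) (at w)" if "w \<noteq> 0" for w
    by (rule holomorphic_derivI[OF theta_hol]) (use that in \<open>auto simp: open_Compl\<close>)
  have step: "deriv (theta p) (p * w) = - deriv (theta p) w / (p * w)" if w: "w \<noteq> 0" "theta p w = 0" for w
  proof -
    have 1: "((\<lambda>w. theta p (p * w)) has_field_derivative deriv (theta p) (p * w) * p) (at w)"
      by (rule DERIV_chain2[OF der]) (use w p_nz in \<open>auto intro!: derivative_eq_intros\<close>)
    have 2: "((\<lambda>w. - theta p w / w) has_field_derivative - deriv (theta p) w / w) (at w)"
      by (rule derivative_eq_intros der refl w)+ (use w in simp)
    have ev: "\<forall>\<^sub>F w in nhds w. w \<noteq> 0"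
      using w by (intro t1_space_nhds) auto
    have "((\<lambda>w. theta p (p * w)) has_field_derivative - deriv (theta p) w / w) (at w)"
      by (rule DERIV_cong_ev[THEN iffD2, OF refl _ refl 2])
         (use ev in \<open>auto elim!: eventually_mono simp: theta_p\<close>)
    from DERIV_unique[OF 1 this] show ?thesis using w p_nz by (simp add: field_simps)
  qed
  have zero: "theta p (p ^ i * w) = 0 \<longleftrightarrow> theta p w = 0" if "w \<noteq> 0" for w i
    using that p_nz by (induction i) (auto simp: theta_p mult.assoc)
  have pow: "deriv (theta p) (p ^ i * w) = 0 \<longleftrightarrow> deriv (theta p) w = 0" if "w \<noteq> 0" "theta p w = 0" for w i
  proof (induction i)
    case (Suc i)
    have "deriv (theta p) (p * (p ^ i * w)) = - deriv (theta p) (p ^ i * w) / (p * (p ^ i * w))"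
      by (rule step) (use that p_nz zero in auto)
    thus ?case using Suc that p_nz by (simp add: mult.assoc)
  qed simp
  have "deriv (theta p) 1 \<noteq> 0"
  proof -
    have "(\<lambda>w. qpoch p (p / w) * qpoch p (p * w)) holomorphic_on (-{0})"
      by (intro holomorphic_intros holomorphic_on_compose[OF _ holomorphic_on_subset[OF qpoch_entire[OF p_lt]], unfolded o_def]) auto
    from holomorphic_derivI[OF this, of 1] obtain D where
      D: "((\<lambda>w. qpoch p (p / w) * qpoch p (p * w)) has_field_derivative D) (at 1)"
      by (auto simp: open_Compl)
    have "((\<lambda>w. (1 - w) * (qpoch p (p / w) * qpoch p (p * w))) has_field_derivative - (qpoch p p)\<^sup>2) (at 1)"
      by (rule derivative_eq_intros D refl)+ (simp add: power2_eq_square)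
    moreover have "(\<lambda>w. (1 - w) * (qpoch p (p / w) * qpoch p (p * w))) = theta p"
    proof
      fix w
      have "theta p w = qpoch p (p / w) * ((1 - w) * qpoch p (p * w))"
        by (simp only: theta_conv_qpoch[OF p_lt] qpoch_rec[OF p_lt, symmetric])
      thus "(1 - w) * (qpoch p (p / w) * qpoch p (p * w)) = theta p w"
        by (simp only: mult.left_commute)
    qed
    ultimately have "deriv (theta p) 1 = - (qpoch p p)\<^sup>2"
      by (simp add: DERIV_imp_deriv)
    thus ?thesis using qpoch_nonzero_same[OF p_lt] by simp
  qed
  moreover have "theta p (z / 1) = 0" using assms by simp
  ultimately show ?thesis
  proof (elim theta_zero_cases)
    fix i assume 1: "deriv (theta p) 1 \<noteq> 0" and z: "z = p ^ i * 1"
    thus ?thesis using pow[of 1 i] p_lt by simp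
  next
    fix i assume 1: "deriv (theta p) 1 \<noteq> 0" and z: "1 = p ^ i * z"
    thus ?thesis using pow[of z i] assms by simp
  qed (use assms in auto)
qed

section \<open>Symmetric theta functions and the basic example of degree 1\<close>

lemma psi_hol [holomorphic_intros]:
  assumes "z \<noteq> 0"
  shows "(\<lambda>x. psi p x z) holomorphic_on (-{0})"
  unfolding psi_def
  by (intro holomorphic_intros holomorphic_on_compose[OF _ holomorphic_on_subset[OF theta_hol], unfolded o_def])
     (use assms in auto)

lemma psi_antisym:
  assumes "x \<noteq> 0" "z \<noteq> 0"
  shows "psi p x z = - psi p z x"
proof -
  have "theta p (z / x) = - theta p (x / z) * z / x"
    using theta_inv[of "x / z"] assms by simp
  hence "psi p z x = inverse z * (theta p (x * z) * (- theta p (x / z) * z / x))"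
    by (simp only: psi_def mult.commute[of z x])
  also have "\<dots> = - psi p x z"
    using assms by (simp add: psi_def field_simps)
  finally show ?thesis by simp
qed

lemma psi_self: "x \<noteq> 0 \<Longrightarrow> psi p x x = 0"
  using p_lt by (simp add: psi_def)

lemma bc1_theta_psi:
  assumes "z \<noteq> 0"
  shows "bc1_theta p 1 (\<lambda>x. psi p x z)"
  unfolding bc1_theta_def
proof (intro conjI allI impI psi_hol assms)
  fix x :: complex assume x: "x \<noteq> 0"
  have "theta p (1 / (x * z)) = - theta p (x * z) / (x * z)" "theta p (z / x) = - theta p (x / z) * z / x"
    using theta_inv[of "x * z"] theta_inv[of "x / z"] assms x by simp_all
  moreover have "1 / x * z = z / x" "1 / x / z = 1 / (x * z)"
    by simp_all
  ultimately have "psi p (1 / x) z = x * ((- theta p (x / z) * z / x) * (- theta p (x * z) / (x * z)))"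
    by (simp only: psi_def) simp
  also have "\<dots> = psi p x z"
    using assms x by (simp add: psi_def field_simps)
  finally show "psi p (1 / x) z = psi p x z" .
  have "theta p (p * (x * z)) = - theta p (x * z) / (x * z)" "theta p (p * (x / z)) = - theta p (x / z) * z / x"
    using theta_p[of "x * z"] theta_p[of "x / z"] assms x by simp_all
  hence "psi p (p * x) z = inverse (p * x) * ((- theta p (x * z) / (x * z)) * (- theta p (x / z) * z / x))"
    by (simp only: psi_def mult.assoc times_divide_eq_right)
  also have "\<dots> = inverse ((p * x\<^sup>2) ^ 1) * psi p x z"
    using assms x p_nz by (simp add: psi_def field_simps power2_eq_square)
  finally show "psi p (p * x) z = inverse ((p * x\<^sup>2) ^ 1) * psi p x z" .
qed

lemma bc1_theta_mult:
  assumes "bc1_theta p n f" "bc1_theta p m g"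
  shows "bc1_theta p (n + m) (\<lambda>x. f x * g x)"
  using assms by (auto simp: bc1_theta_def power_add intro!: holomorphic_intros)

lemma bc1_theta_1: "bc1_theta p 0 (\<lambda>_. 1)"
  by (auto simp: bc1_theta_def)

lemma bc1_theta_prod:
  assumes "finite I" "\<And>i. i \<in> I \<Longrightarrow> bc1_theta p 1 (f i)"
  shows "bc1_theta p (card I) (\<lambda>x. \<Prod>i\<in>I. f i x)"
  using assms
proof (induction I)
  case empty
  show ?case using bc1_theta_1 by simp
next
  case (insert i I)
  thus ?case using bc1_theta_mult[of 1 "f i" "card I"] by simp
qed

lemma bc1_theta_cmult: "bc1_theta p n f \<Longrightarrow> bc1_theta p n (\<lambda>x. c * f x)"
  by (auto simp: bc1_theta_def intro!: holomorphic_intros)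

lemma bc1_theta_diff: "bc1_theta p n f \<Longrightarrow> bc1_theta p n g \<Longrightarrow> bc1_theta p n (\<lambda>x. f x - g x)"
  by (auto simp: bc1_theta_def algebra_simps intro!: holomorphic_intros)

lemma bc1_theta_sum:
  assumes "finite I" "\<And>i. i \<in> I \<Longrightarrow> bc1_theta p n (f i)"
  shows "bc1_theta p n (\<lambda>x. \<Sum>i\<in>I. f i x)"
  using assms by (auto simp: bc1_theta_def sum_distrib_left intro!: holomorphic_intros sum.cong)

lemma bc1_theta_zero_shift:
  assumes G: "bc1_theta p n G" and xy: "x \<noteq> 0" "y \<noteq> 0" and "theta p (x / y) = 0"
  shows "G x = 0 \<longleftrightarrow> G y = 0"
proof -
  have pow: "G (p ^ i * w) = 0 \<longleftrightarrow> G w = 0" if "w \<noteq> 0" for w i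
  proof (induction i)
    case (Suc i)
    have "G (p * (p ^ i * w)) = inverse ((p * (p ^ i * w)\<^sup>2) ^ n) * G (p ^ i * w)"
      using G that p_nz by (auto simp: bc1_theta_def)
    thus ?case using Suc that p_nz by (simp add: mult.assoc)
  qed simp
  from assms(4) xy show ?thesis
    by (elim theta_zero_cases) (use pow xy in auto)
qed

text \<open>\<psi>(x,y) vanishes only if x equals y or 1/y up to a power of p, and the zero set of G
  is invariant under multiplication by p and under inversion.\<close>

lemma bc1_theta_zero_psi:
  assumes G: "bc1_theta p n G" and xy: "x \<noteq> 0" "y \<noteq> 0" and "psi p x y = 0"
  shows "G x = 0 \<longleftrightarrow> G y = 0"
proof -
  have "theta p (x / y) = 0 \<or> theta p (x / (1 / y)) = 0"
    using assms by (auto simp: psi_def)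
  thus ?thesis
    using bc1_theta_zero_shift[OF G xy] bc1_theta_zero_shift[OF G xy(1), of "1 / y"] G xy
    by (auto simp: bc1_theta_def)
qed

text \<open>If \<theta>(xz) and \<theta>(x/z) vanished together, z and 1/z would agree up to a power
  of p, which \<open>theta p (z\<^sup>2) \<noteq> 0\<close> rules out. So exactly one factor
  vanishes, and its zero is simple.\<close>

lemma psi_deriv_nonzero:
  assumes xz: "x \<noteq> 0" "z \<noteq> 0" and "psi p x z = 0" "theta p (z\<^sup>2) \<noteq> 0"
  shows "deriv (\<lambda>x. psi p x z) x \<noteq> 0"
proof -
  have zero: "theta p (p ^ i * w) = 0 \<longleftrightarrow> theta p w = 0" if "w \<noteq> 0" for w i
    using that p_nz by (induction i) (auto simp: theta_p mult.assoc)
  have shift: "theta p (a * c) = 0 \<longleftrightarrow> theta p (b * c) = 0"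
    if "theta p (a / b) = 0" "a \<noteq> 0" "b \<noteq> 0" "c \<noteq> 0" for a b c
    using that(1-3) by (elim theta_zero_cases) (use zero[of "_ * c"] that in \<open>auto simp: mult.assoc\<close>)
  have one: "\<not> (theta p (x / z) = 0 \<and> theta p (x * z) = 0)"
    using shift[of x z z] assms by (auto simp: power2_eq_square)
  have der: "(theta p has_field_derivative deriv (theta p) w) (at w)" if "w \<noteq> 0" for w
    by (rule holomorphic_derivI[OF theta_hol]) (use that in \<open>auto simp: open_Compl\<close>)
  have d1: "((\<lambda>x. theta p (x * z)) has_field_derivative deriv (theta p) (x * z) * z) (at x)"
    by (rule DERIV_chain2[OF der]) (use xz in \<open>auto intro!: derivative_eq_intros\<close>)
  have d2: "((\<lambda>x. theta p (x / z)) has_field_derivative deriv (theta p) (x / z) * (1 / z)) (at x)"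
    by (rule DERIV_chain2[OF der]) (use xz in \<open>auto intro!: derivative_eq_intros\<close>)
  have "((\<lambda>x. psi p x z) has_field_derivative
      (- (inverse x * 1 * inverse x)) * (theta p (x * z) * theta p (x / z)) +
      (deriv (theta p) (x * z) * z * theta p (x / z) + deriv (theta p) (x / z) * (1 / z) * theta p (x * z)) * inverse x) (at x)"
    unfolding psi_def by (intro DERIV_mult DERIV_inverse' DERIV_ident d1 d2 xz)
  hence "deriv (\<lambda>x. psi p x z) x =
      (- (inverse x * 1 * inverse x)) * (theta p (x * z) * theta p (x / z)) +
      (deriv (theta p) (x * z) * z * theta p (x / z) + deriv (theta p) (x / z) * (1 / z) * theta p (x * z)) * inverse x"
    by (rule DERIV_imp_deriv)
  moreover have "theta p (x * z) = 0 \<or> theta p (x / z) = 0"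
    using assms by (auto simp: psi_def)
  ultimately show ?thesis
    using one xz theta_deriv_nonzero[of "x * z"] theta_deriv_nonzero[of "x / z"] by auto
qed

text \<open>Powers of p move every nonzero point into the compact annulus |p| \<le> |x| \<le> 1, so
  K is bounded. Then K(exp t) is a bounded entire function, and Liouville's theorem applies.\<close>

lemma p_periodic_constant:
  assumes hol: "K holomorphic_on (-{0})" and per: "\<And>x. x \<noteq> 0 \<Longrightarrow> K (p * x) = K x"
  obtains c where "\<And>x. x \<noteq> 0 \<Longrightarrow> K x = c"
proof -
  have pow: "K (p ^ i * x) = K x" if "x \<noteq> 0" for x i
    using that p_nz by (induction i) (auto simp: per mult.assoc)
  define A where "A = cball (0::complex) 1 - ball 0 (norm p)"
  have "compact A" unfolding A_def by (intro compact_diff compact_cball open_ball)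
  moreover have "continuous_on A K"
    by (rule holomorphic_on_imp_continuous_on, rule holomorphic_on_subset[OF hol]) (use p_nz in \<open>auto simp: A_def\<close>)
  ultimately have "bounded (K ` A)"
    by (intro compact_imp_bounded compact_continuous_image)
  have repr: "K x \<in> K ` A" if x: "x \<noteq> 0" for x
  proof (cases "norm x \<le> 1")
    case True
    \<comment> \<open>The least such k satisfies |p|^(k+1) \<le> |x| \<le> |p|^k, so dividing by p^k
      lands in the annulus.\<close>
    define k where "k = (LEAST k. norm p ^ Suc k \<le> norm x)"
    have "\<exists>k. norm p ^ k < norm x" using x p_lt by (intro real_arch_pow_inv) auto
    then obtain k0 where "norm p ^ k0 < norm x" by blast
    moreover have "norm p ^ Suc k0 \<le> norm p ^ k0" using p_lt by (intro power_decreasing) auto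
    ultimately have "norm p ^ Suc k0 \<le> norm x" by linarith
    hence k: "norm p ^ Suc k \<le> norm x" unfolding k_def by (rule LeastI)
    have k': "norm x \<le> norm p ^ k"
    proof (cases k)
      case 0
      thus ?thesis using True by simp
    next
      case (Suc j)
      thus ?thesis using not_less_Least[of j "\<lambda>k. norm p ^ Suc k \<le> norm x"] unfolding k_def[symmetric] by auto
    qed
    have "x / p ^ k \<in> A"
      using k k' p_nz by (auto simp: A_def norm_divide norm_power divide_simps mult.commute)
    moreover have "K x = K (x / p ^ k)"
      using pow[of "x / p ^ k" k] x p_nz by simp
    ultimately show ?thesis by auto
  next
    case False
    \<comment> \<open>Here x is too large and is multiplied by p^k; minimality of k keeps the
      modulus of the result above |p|.\<close>
    define k where "k = (LEAST k. norm p ^ k * norm x \<le> 1)"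
    have "\<exists>k. norm p ^ k < 1 / norm x" using x p_lt by (intro real_arch_pow_inv) auto
    then obtain k0 where "norm p ^ k0 < 1 / norm x" by blast
    hence "norm p ^ k0 * norm x \<le> 1" using x by (simp add: field_simps)
    hence k: "norm p ^ k * norm x \<le> 1" unfolding k_def by (rule LeastI)
    have "k \<noteq> 0" using k False by (intro notI) simp
    then obtain j where j: "k = Suc j" by (cases k) auto
    have "norm p ^ j * norm x > 1"
      using not_less_Least[of j "\<lambda>k. norm p ^ k * norm x \<le> 1"] j unfolding k_def[symmetric] by auto
    hence "norm p * (norm p ^ j * norm x) \<ge> norm p * 1"
      using p_nz by (intro mult_left_mono) auto
    hence "p ^ k * x \<in> A"
      using k j by (auto simp: A_def norm_mult norm_power mult.assoc)
    moreover have "K x = K (p ^ k * x)"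
      using pow[of x k] x by simp
    ultimately show ?thesis by auto
  qed
  have "range (\<lambda>t. K (exp t)) \<subseteq> K ` A" using repr by auto
  hence bdd: "bounded (range (\<lambda>t. K (exp t)))"
    using \<open>bounded (K ` A)\<close> bounded_subset by blast
  have "(\<lambda>t. K (exp t)) holomorphic_on UNIV"
    by (intro holomorphic_on_compose[OF _ holomorphic_on_subset[OF hol], unfolded o_def] holomorphic_intros) auto
  then obtain c where c: "\<And>t. K (exp t) = c"
    using Liouville_theorem[OF _ bdd] unfolding constant_on_def by blast
  have "K x = c" if "x \<noteq> 0" for x
    using c[of "Ln x"] that by simp
  thus ?thesis by (rule that)
qed

section \<open>Lagrange interpolation for symmetric theta functions\<close>

lemma psi_hol_right:
  assumes "x \<noteq> 0"
  shows "(\<lambda>y. psi p x y) holomorphic_on (-{0})"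
proof (rule holomorphic_transform)
  show "(\<lambda>y. - psi p y x) holomorphic_on (-{0})"
    by (intro holomorphic_intros assms)
  show "- psi p y x = psi p x y" if "y \<in> -{0}" for y
    using psi_antisym[of x y] assms that by simp
qed

text \<open>Up to powers of p, the nodes and their inverses are pairwise distinct points. Exactly
  this makes all zeros of the product of the \<psi>(x, w_i) simple.\<close>

definition generic_nodes :: "nat \<Rightarrow> (nat \<Rightarrow> complex) \<Rightarrow> bool" where
  "generic_nodes n w \<longleftrightarrow> (\<forall>i<n. w i \<noteq> 0 \<and> theta p ((w i)\<^sup>2) \<noteq> 0) \<and>
     (\<forall>i<n. \<forall>j<n. i \<noteq> j \<longrightarrow> psi p (w i) (w j) \<noteq> 0)"

text \<open>The product of the \<psi>(x, w_i) has the same degree as H and only simple zeros, at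
  each of which H vanishes. The quotient is therefore p-periodic and holomorphic on the punctured
  plane, hence constant.\<close>

lemma bc1_theta_vanishing:
  assumes H: "bc1_theta p n H" and w: "generic_nodes n w" and zero: "\<And>i. i < n \<Longrightarrow> H (w i) = 0"
  obtains c where "\<And>x. x \<noteq> 0 \<Longrightarrow> H x = c * (\<Prod>i<n. psi p x (w i))"
proof -
  define \<Psi> where "\<Psi> = (\<lambda>x. \<Prod>i<n. psi p x (w i))"
  have w0: "w i \<noteq> 0" if "i < n" for i using w that by (auto simp: generic_nodes_def)
  have \<Psi>: "bc1_theta p n \<Psi>"
    using bc1_theta_prod[of "{..<n}" "\<lambda>i x. psi p x (w i)"] w0 bc1_theta_psi by (simp add: \<Psi>_def)
  have hol: "H holomorphic_on (-{0})" "\<Psi> holomorphic_on (-{0})"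
    using H \<Psi> by (auto simp: bc1_theta_def)
  have derH: "(H has_field_derivative deriv H x) (at x)"
    and der\<Psi>: "(\<Psi> has_field_derivative deriv \<Psi> x) (at x)" if "x \<noteq> 0" for x
    by (rule holomorphic_derivI[OF hol(1)] holomorphic_derivI[OF hol(2)]; use that in \<open>simp add: open_Compl\<close>)+
  \<comment> \<open>At a zero of the k-th factor the product rule leaves only the term in which that
    factor is differentiated. The other factors do not vanish there, since a common zero would force
    \<psi>(w_k, w_i) = 0.\<close>
  have zeros: "H x = 0 \<and> deriv \<Psi> x \<noteq> 0" if x: "x \<noteq> 0" "\<Psi> x = 0" for x
  proof -
    from x obtain k where k: "k < n" "psi p x (w k) = 0" by (auto simp: \<Psi>_def)
    have "H x = 0"
      using bc1_theta_zero_psi[OF H x(1) w0[OF k(1)] k(2)] zero[OF k(1)] by simp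
    moreover have "deriv \<Psi> x \<noteq> 0"
    proof -
      define R where "R = (\<lambda>x. \<Prod>i\<in>{..<n}-{k}. psi p x (w i))"
      have \<Psi>_eq: "\<Psi> = (\<lambda>x. psi p x (w k) * R x)"
        using k(1) by (auto simp: \<Psi>_def R_def fun_eq_iff intro!: prod.remove)
      have "R holomorphic_on (-{0})"
        unfolding R_def by (intro holomorphic_intros w0) auto
      hence dR: "(R has_field_derivative deriv R x) (at x)"
        by (rule holomorphic_derivI) (use x in \<open>auto simp: open_Compl\<close>)
      have dpsi: "((\<lambda>x. psi p x (w k)) has_field_derivative deriv (\<lambda>x. psi p x (w k)) x) (at x)"
        by (rule holomorphic_derivI[OF psi_hol[OF w0[OF k(1)]]]) (use x in \<open>auto simp: open_Compl\<close>)
      have "deriv \<Psi> x = deriv (\<lambda>x. psi p x (w k)) x * R x"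
        unfolding \<Psi>_eq using DERIV_imp_deriv[OF DERIV_mult[OF dpsi dR]] k(2) by simp
      moreover have "deriv (\<lambda>x. psi p x (w k)) x \<noteq> 0"
        using w k x(1) by (intro psi_deriv_nonzero w0) (auto simp: generic_nodes_def)
      moreover have "R x \<noteq> 0"
      proof
        assume "R x = 0"
        then obtain i where i: "i < n" "i \<noteq> k" "psi p x (w i) = 0" by (auto simp: R_def)
        have "psi p (w k) (w i) = 0"
          using bc1_theta_zero_psi[OF bc1_theta_psi[OF w0[OF i(1)]] x(1) w0[OF k(1)] k(2)] i(3) by simp
        thus False using w i k by (auto simp: generic_nodes_def)
      qed
      ultimately show ?thesis by simp
    qed
    ultimately show ?thesis ..
  qed
  have ev: "\<forall>\<^sub>F y in at x. \<Psi> y \<noteq> 0" if x: "x \<noteq> 0" for x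
  proof (cases "\<Psi> x = 0")
    case True
    have "((\<lambda>y. (\<Psi> y - \<Psi> x) / (y - x)) \<longlongrightarrow> deriv \<Psi> x) (at x)"
      using der\<Psi>[OF x] by (simp add: has_field_derivative_iff)
    hence "\<forall>\<^sub>F y in at x. (\<Psi> y - \<Psi> x) / (y - x) \<noteq> 0"
      using zeros[OF x True] by (intro tendsto_imp_eventually_ne) auto
    thus ?thesis by eventually_elim (use True in auto)
  next
    case False
    have "\<Psi> \<midarrow>x\<rightarrow> \<Psi> x"
      using DERIV_isCont[OF der\<Psi>[OF x]] by (simp add: isCont_def)
    thus ?thesis by (rule tendsto_imp_eventually_ne) fact
  qed
  define K where "K = remove_sings (\<lambda>x. H x / \<Psi> x)"
  have mer: "(\<lambda>x. H x / \<Psi> x) meromorphic_on (-{0})"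
    using hol by (intro meromorphic_intros analytic_on_imp_meromorphic_on) (auto simp: analytic_on_open open_Compl)
  have lim: "\<exists>c. (\<lambda>x. H x / \<Psi> x) \<midarrow>x\<rightarrow> c" if x: "x \<noteq> 0" for x
  proof (cases "\<Psi> x = 0")
    case True
    show ?thesis
      using lhopital_complex_simple[OF derH[OF x] der\<Psi>[OF x] _ True _ refl] zeros[OF x True] by blast
  next
    case False
    have "(\<lambda>x. H x / \<Psi> x) \<midarrow>x\<rightarrow> H x / \<Psi> x"
      using DERIV_isCont[OF der\<Psi>[OF x]] DERIV_isCont[OF derH[OF x]] False
      by (intro tendsto_divide) (auto simp: isCont_def)
    thus ?thesis by blast
  qed
  have K_hol: "K holomorphic_on (-{0})"
  proof (rule analytic_imp_holomorphic, subst analytic_on_analytic_at, intro ballI)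
    fix x :: complex assume x: "x \<in> -{0}"
    then obtain c where c: "(\<lambda>x. H x / \<Psi> x) \<midarrow>x\<rightarrow> c" using lim[of x] by auto
    show "K analytic_on {x}"
      unfolding K_def by (rule remove_sings_analytic_at[OF _ c]) (use mer x in \<open>auto simp: meromorphic_on_altdef\<close>)
  qed
  have K_eq: "K x = H x / \<Psi> x" if "x \<noteq> 0" "\<Psi> x \<noteq> 0" for x
  proof -
    have ana: "H analytic_on -{0}" "\<Psi> analytic_on -{0}"
      using hol by (simp_all add: analytic_on_open open_Compl)
    have "H analytic_on {x}" "\<Psi> analytic_on {x}"
      by (rule analytic_on_subset[OF ana(1)] analytic_on_subset[OF ana(2)]; use that in simp)+
    hence "(\<lambda>x. H x / \<Psi> x) analytic_on {x}"
      using that by (intro analytic_on_divide) auto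
    thus ?thesis by (simp add: K_def)
  qed
  \<comment> \<open>Where the product is nonzero, both automorphy factors cancel in the quotient.
    The remaining points are isolated and follow by continuity.\<close>
  have K_per: "K (p * x) = K x" if x: "x \<noteq> 0" for x
  proof -
    have cont: "isCont K y" if "y \<noteq> 0" for y
      using holomorphic_on_imp_continuous_on[OF K_hol] that by (simp add: continuous_on_eq_continuous_at open_Compl)
    have 1: "K \<midarrow>x\<rightarrow> K x" using cont[OF x] by (simp add: isCont_def)
    have "isCont (\<lambda>y. K (p * y)) x"
      by (rule isCont_o2[OF _ cont]) (use x p_nz in auto)
    hence 2: "(\<lambda>y. K (p * y)) \<midarrow>x\<rightarrow> K (p * x)" by (simp add: isCont_def)
    have ev0: "\<forall>\<^sub>F y in at x. y \<noteq> 0"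
      using t1_space_nhds[OF x] by (simp add: eventually_at_filter eventually_mono)
    have "\<forall>\<^sub>F y in at x. K (p * y) = K y"
      using ev[OF x] ev0
    proof eventually_elim
      case (elim y)
      have "\<Psi> (p * y) = inverse ((p * y\<^sup>2) ^ n) * \<Psi> y" "H (p * y) = inverse ((p * y\<^sup>2) ^ n) * H y"
        using \<Psi> H elim by (auto simp: bc1_theta_def)
      thus ?case using elim p_nz K_eq[of y] K_eq[of "p * y"] by simp
    qed
    from tendsto_unique[OF _ tendsto_cong[THEN iffD1, OF this 2] 1] show ?thesis by simp
  qed
  obtain c where c: "\<And>x. x \<noteq> 0 \<Longrightarrow> K x = c"
    using p_periodic_constant[OF K_hol K_per] by metis
  have "H x = c * \<Psi> x" if "x \<noteq> 0" for x
    using c[OF that] K_eq[OF that] zeros[OF that] by (cases "\<Psi> x = 0") (auto simp: field_simps)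
  thus ?thesis unfolding \<Psi>_def by (rule that)
qed

text \<open>The difference of the two sides vanishes at all n+1 nodes. The first n of them make it a
  multiple of a product that is nonzero at the last node, so the multiple is 0.\<close>

lemma bc1_theta_lagrange:
  assumes G: "bc1_theta p n G" and w: "generic_nodes (Suc n) w" and x: "x \<noteq> 0"
  shows "G x = (\<Sum>k<Suc n. G (w k) * (\<Prod>i\<in>{..<Suc n}-{k}. psi p x (w i) / psi p (w k) (w i)))"
proof -
  define L where "L = (\<lambda>k x. G (w k) * (\<Prod>i\<in>{..<Suc n}-{k}. psi p x (w i) / psi p (w k) (w i)))"
  define H where "H = (\<lambda>x. G x - (\<Sum>k<Suc n. L k x))"
  have w0: "w i \<noteq> 0" if "i < Suc n" for i using w that by (auto simp: generic_nodes_def)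
  have psi_nz: "psi p (w i) (w j) \<noteq> 0" if "i < Suc n" "j < Suc n" "i \<noteq> j" for i j
    using w that by (auto simp: generic_nodes_def)
  have L: "bc1_theta p n (L k)" if k: "k < Suc n" for k
  proof -
    have "bc1_theta p (card ({..<Suc n} - {k})) (\<lambda>x. \<Prod>i\<in>{..<Suc n}-{k}. inverse (psi p (w k) (w i)) * psi p x (w i))"
      by (intro bc1_theta_prod bc1_theta_cmult bc1_theta_psi w0) auto
    moreover have "card ({..<Suc n} - {k}) = n" using k by simp
    ultimately show ?thesis unfolding L_def
      by (intro bc1_theta_cmult) (simp add: divide_inverse mult.commute)
  qed
  have H: "bc1_theta p n H"
    unfolding H_def by (intro bc1_theta_diff G bc1_theta_sum L) auto
  have H_zero: "H (w j) = 0" if j: "j < Suc n" for j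
  proof -
    have "L k (w j) = (if k = j then G (w j) else 0)" if k: "k < Suc n" for k
    proof (cases "k = j")
      case True
      have "(\<Prod>i\<in>{..<Suc n}-{k}. psi p (w j) (w i) / psi p (w k) (w i)) = 1"
        using True psi_nz[OF j] by (intro prod.neutral) auto
      thus ?thesis using True by (simp add: L_def)
    next
      case False
      have "(\<Prod>i\<in>{..<Suc n}-{k}. psi p (w j) (w i) / psi p (w k) (w i)) = 0"
        using False j psi_self[OF w0[OF j]] by (intro prod_zero) (auto intro!: bexI[of _ j])
      thus ?thesis using False by (simp add: L_def)
    qed
    thus ?thesis using j by (simp add: H_def del: sum.lessThan_Suc)
  qed
  have "generic_nodes n w" using w by (auto simp: generic_nodes_def)
  then obtain c where c: "\<And>x. x \<noteq> 0 \<Longrightarrow> H x = c * (\<Prod>i<n. psi p x (w i))"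
    using bc1_theta_vanishing[OF H, of w] H_zero by (metis less_SucI)
  have "c * (\<Prod>i<n. psi p (w n) (w i)) = 0"
    using c[of "w n"] H_zero[of n] w0[of n] by simp
  moreover have "(\<Prod>i<n. psi p (w n) (w i)) \<noteq> 0"
    using psi_nz[of n] by auto
  ultimately have "c = 0" by simp
  hence "H x = 0" using c[OF x] by simp
  thus ?thesis by (simp add: H_def L_def del: sum.lessThan_Suc)
qed

section \<open>Countability of the exceptional points, and separation of variables\<close>

lemma countable_theta_zeros: "countable {z. z \<noteq> 0 \<and> theta p z = 0}"
proof (rule countable_subset)
  show "{z. z \<noteq> 0 \<and> theta p z = 0} \<subseteq> range (\<lambda>i. p ^ Suc i) \<union> range (\<lambda>i. 1 / p ^ i)"
    using p_nz by (auto simp: theta_eq_0_iff[OF p_lt _ p_nz] field_simps)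
qed auto

lemma countable_theta_square_zeros: "countable {z. z \<noteq> 0 \<and> theta p (z\<^sup>2) = 0}"
proof (rule countable_subset)
  show "{z. z \<noteq> 0 \<and> theta p (z\<^sup>2) = 0} \<subseteq>
          csqrt ` {z. z \<noteq> 0 \<and> theta p z = 0} \<union> (\<lambda>z. - csqrt z) ` {z. z \<noteq> 0 \<and> theta p z = 0}"
  proof safe
    fix z assume z: "z \<noteq> 0" "theta p (z\<^sup>2) = 0" "z \<notin> (\<lambda>z. - csqrt z) ` {z. z \<noteq> 0 \<and> theta p z = 0}"
    have "z = csqrt (z\<^sup>2) \<or> z = - csqrt (z\<^sup>2)"
      by (metis csqrt_square power2_csqrt power2_eq_iff)
    thus "z \<in> csqrt ` {z. z \<noteq> 0 \<and> theta p z = 0}" using z by auto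
  qed
qed (use countable_theta_zeros in auto)

lemma countable_psi_zeros:
  assumes "z \<noteq> 0"
  shows "countable {w. w \<noteq> 0 \<and> psi p z w = 0}"
proof (rule countable_subset)
  show "{w. w \<noteq> 0 \<and> psi p z w = 0} \<subseteq>
    (\<lambda>y. y / z) ` {z. z \<noteq> 0 \<and> theta p z = 0} \<union> (\<lambda>y. z / y) ` {z. z \<noteq> 0 \<and> theta p z = 0}"
  proof
    fix w assume "w \<in> {w. w \<noteq> 0 \<and> psi p z w = 0}"
    hence w: "w \<noteq> 0" "theta p (z * w) = 0 \<or> theta p (z / w) = 0"
      using assms by (auto simp: psi_def)
    from w(2) show "w \<in> (\<lambda>y. y / z) ` {z. z \<noteq> 0 \<and> theta p z = 0} \<union> (\<lambda>y. z / y) ` {z. z \<noteq> 0 \<and> theta p z = 0}"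
    proof
      assume "theta p (z * w) = 0"
      thus ?thesis using w(1) assms by (intro UnI1 image_eqI[of _ _ "z * w"]) auto
    next
      assume "theta p (z / w) = 0"
      thus ?thesis using w(1) assms by (intro UnI2 image_eqI[of _ _ "z / w"]) auto
    qed
  qed
qed (use countable_theta_zeros in auto)

text \<open>As a function of its first argument \<psi> is a theta function of degree 1, so
  interpolation at two fixed nodes d, e separates the variables. Suitable nodes exist because only
  countably many points are forbidden.\<close>

lemma psi_decomposition:
  obtains a b a' b' where "a holomorphic_on (-{0})" "b holomorphic_on (-{0})"
    "a' holomorphic_on (-{0})" "b' holomorphic_on (-{0})"
    "\<And>z w. z \<noteq> 0 \<Longrightarrow> w \<noteq> 0 \<Longrightarrow> psi p z w = a z * b w + a' z * b' w"
proof -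
  define X where "X = {0} \<union> {z. z \<noteq> 0 \<and> theta p (z\<^sup>2) = 0}"
  have X: "countable X" using countable_theta_square_zeros by (simp add: X_def)
  have ex: "\<exists>d. d \<notin> S" if "countable S" for S :: "complex set"
    using that uncountable_UNIV_complex by (metis UNIV_eq_I)
  obtain d where d: "d \<notin> X" using ex[OF X] by blast
  have d0: "d \<noteq> 0" using d by (simp add: X_def)
  have "countable (X \<union> {w. w \<noteq> 0 \<and> psi p d w = 0})" using X countable_psi_zeros[OF d0] by simp
  then obtain e where e: "e \<notin> X \<union> {w. w \<noteq> 0 \<and> psi p d w = 0}" using ex by blast
  have de: "d \<noteq> 0" "e \<noteq> 0" "psi p d e \<noteq> 0" "psi p e d \<noteq> 0"
    using d e psi_antisym[of d e] by (auto simp: X_def)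
  define w where "w = (\<lambda>i::nat. if i = 0 then d else e)"
  have nodes: "generic_nodes (Suc 1) w"
    unfolding generic_nodes_def w_def using d e de by (auto simp: X_def)
  have eq: "psi p x y = psi p x e * (psi p d y / psi p d e) + psi p x d * (psi p e y / psi p e d)"
    if "x \<noteq> 0" "y \<noteq> 0" for x y
  proof -
    have 1: "{..<Suc 1} - {0::nat} = {1}" "{..<Suc 1} - {1::nat} = {0}" by auto
    show ?thesis
      using bc1_theta_lagrange[OF bc1_theta_psi[OF that(2)] nodes that(1)] 1 by (simp add: w_def mult_ac)
  qed
  have quot: "(\<lambda>y. psi p c y / c') holomorphic_on (-{0})" if "c \<noteq> 0" "c' \<noteq> 0" for c c'
    by (rule holomorphic_on_divide[OF psi_hol_right[OF that(1)] holomorphic_on_const]) (rule that(2))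
  show ?thesis
    by (rule that[OF psi_hol[OF de(2)] quot[OF de(1,3)] psi_hol[OF de(1)] quot[OF de(2,4)] eq])
qed

lemma separable_psi:
  assumes "i < N" "j < N"
  shows "separable N (\<lambda>zs. psi p (zs ! i) (zs ! j))"
proof -
  obtain a b a' b' where ab: "a holomorphic_on (-{0})" "b holomorphic_on (-{0})"
    "a' holomorphic_on (-{0})" "b' holomorphic_on (-{0})"
    "\<And>z w. z \<noteq> 0 \<Longrightarrow> w \<noteq> 0 \<Longrightarrow> psi p z w = a z * b w + a' z * b' w"
    using psi_decomposition by metis
  have "separable N (\<lambda>zs. \<Sum>k\<in>{0,1::nat}. if k = 0 then a (zs ! i) * b (zs ! j) else a' (zs ! i) * b' (zs ! j))"
  proof (rule separable_sum)
    fix k assume "k \<in> {0,1::nat}"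
    show "separable N (\<lambda>zs. if k = 0 then a (zs ! i) * b (zs ! j) else a' (zs ! i) * b' (zs ! j))"
      by (cases "k = 0") (auto intro!: separable_mult separable_slot ab assms)
  qed auto
  thus ?thesis
  proof (rule separable_cong)
    fix zs :: "complex list" assume zs: "length zs = N" "0 \<notin> set zs"
    have "zs ! i \<noteq> 0" "zs ! j \<noteq> 0" using zs assms nth_mem by metis+
    thus "(\<Sum>k\<in>{0,1::nat}. if k = 0 then a (zs ! i) * b (zs ! j) else a' (zs ! i) * b' (zs ! j)) =
          psi p (zs ! i) (zs ! j)"
      by (simp add: ab(5))
  qed
qed

section \<open>The elliptic analogue of the squared Vandermonde product\<close>

definition vand :: "nat \<Rightarrow> complex list \<Rightarrow> complex" where
  "vand N zs = (\<Prod>j<N. \<Prod>i<j. (psi p (zs ! i) (zs ! j))\<^sup>2)"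

lemma separable_vand: "separable N (vand N)"
  unfolding vand_def[abs_def]
  by (intro separable_prod separable_power separable_psi) auto

lemma vand_Cons: "vand (Suc n) (z # zs) = (\<Prod>i<n. (psi p z (zs ! i))\<^sup>2) * vand n zs"
  unfolding vand_def by (simp add: prod.lessThan_Suc_shift prod.distrib del: prod.lessThan_Suc)

lemma prod_off_diagonal:
  fixes t :: "nat \<Rightarrow> nat \<Rightarrow> complex"
  shows "(\<Prod>i<N. \<Prod>j\<in>{..<N}-{i}. t i j) = (\<Prod>j<N. \<Prod>i<j. t i j * t j i)"
proof (induction N)
  case (Suc N)
  have "(\<Prod>j\<in>{..<Suc N}-{i}. t i j) = t i N * (\<Prod>j\<in>{..<N}-{i}. t i j)" if "i < N" for i
  proof -
    have "{..<Suc N}-{i} = insert N ({..<N}-{i})" using that by auto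
    thus ?thesis by simp
  qed
  moreover have "{..<Suc N}-{N} = {..<N}" by auto
  ultimately show ?case by (simp add: Suc prod.distrib mult_ac)
qed simp

text \<open>Up to a sign that depends on \<open>N\<close> only, the product is the one over all ordered pairs of
  distinct indices, which is visibly invariant.\<close>

lemma vand_permute:
  assumes \<pi>: "\<pi> permutes {..<N}" and zs: "length zs = N" "0 \<notin> set zs"
  shows "vand N (map (\<lambda>i. zs ! \<pi> i) [0..<N]) = vand N zs"
proof -
  define S where "S = (\<Prod>j<N. \<Prod>i<j. - 1 :: complex)"
  have S: "S \<noteq> 0" by (simp add: S_def)
  have *: "S * vand N ys = (\<Prod>i<N. \<Prod>j\<in>{..<N}-{i}. psi p (ys ! i) (ys ! j))"
    if ys: "length ys = N" "0 \<notin> set ys" for ys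
  proof -
    have nz: "ys ! i \<noteq> 0" if "i < N" for i using ys that nth_mem by metis
    have "S * vand N ys = (\<Prod>j<N. \<Prod>i<j. - 1 * (psi p (ys ! i) (ys ! j))\<^sup>2)"
      unfolding S_def vand_def by (simp only: prod.distrib)
    also have "\<dots> = (\<Prod>j<N. \<Prod>i<j. psi p (ys ! i) (ys ! j) * psi p (ys ! j) (ys ! i))"
    proof (intro prod.cong refl)
      fix j i assume "j \<in> {..<N}" "i \<in> {..<j}"
      thus "- 1 * (psi p (ys ! i) (ys ! j))\<^sup>2 = psi p (ys ! i) (ys ! j) * psi p (ys ! j) (ys ! i)"
        using psi_antisym[OF nz[of j] nz[of i]] by (simp add: power2_eq_square)
    qed
    finally show ?thesis by (simp only: prod_off_diagonal)
  qed
  have \<pi>_lt: "\<pi> i < N \<longleftrightarrow> i < N" for i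
    using permutes_in_image[OF \<pi>, of i] by auto
  define ys where "ys = map (\<lambda>i. zs ! \<pi> i) [0..<N]"
  have "zs ! \<pi> i \<in> set zs" if "i < N" for i
    using \<pi>_lt[of i] zs(1) that by (intro nth_mem) simp
  hence "set ys \<subseteq> set zs"
    unfolding ys_def by (simp add: image_subset_iff)
  hence ys: "length ys = N" "0 \<notin> set ys"
    using zs(2) by (auto simp: ys_def)
  have "S * vand N ys = (\<Prod>i<N. \<Prod>j\<in>{..<N}-{i}. psi p (zs ! \<pi> i) (zs ! \<pi> j))"
    unfolding *[OF ys] by (intro prod.cong refl) (auto simp: ys_def)
  also have "\<dots> = (\<Prod>i<N. \<Prod>j\<in>{..<N}-{\<pi> i}. psi p (zs ! \<pi> i) (zs ! j))"
  proof (rule prod.cong[OF refl])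
    fix i assume "i \<in> {..<N}"
    have "bij_betw \<pi> ({..<N} - {i}) (\<pi> ` ({..<N} - {i}))"
      using permutes_inj_on[OF \<pi>] inj_on_imp_bij_betw by blast
    moreover have "\<pi> ` ({..<N} - {i}) = {..<N} - {\<pi> i}"
      using permutes_image[OF \<pi>] permutes_inj[OF \<pi>] by (simp add: image_set_diff)
    ultimately show "(\<Prod>j\<in>{..<N}-{i}. psi p (zs ! \<pi> i) (zs ! \<pi> j)) =
                     (\<Prod>j\<in>{..<N}-{\<pi> i}. psi p (zs ! \<pi> i) (zs ! j))"
      using prod.reindex_bij_betw[of \<pi> "{..<N}-{i}" "{..<N}-{\<pi> i}" "\<lambda>j. psi p (zs ! \<pi> i) (zs ! j)"] by simp
  qed
  also have "\<dots> = (\<Prod>i<N. \<Prod>j\<in>{..<N}-{i}. psi p (zs ! i) (zs ! j))"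
    using prod.permute[OF \<pi>, of "\<lambda>i. \<Prod>j\<in>{..<N}-{i}. psi p (zs ! i) (zs ! j)"] by (simp add: o_def)
  also have "\<dots> = S * vand N zs"
    by (rule *[OF zs, symmetric])
  finally show ?thesis using S by (simp add: ys_def)
qed

text \<open>The integrand of the one-variable integral over the \<open>n\<close>-fold one, stripped of its weight.\<close>

definition kernel :: "(complex \<Rightarrow> complex) \<Rightarrow> complex \<Rightarrow> nat \<Rightarrow> complex list \<Rightarrow> complex" where
  "kernel G x n zs = G (zs ! 0) * (\<Prod>i<n. psi p (zs ! 0) (zs ! Suc i) * psi p x (zs ! Suc i)) * vand n (tl zs)"

lemma separable_kernel:
  assumes "G holomorphic_on (-{0})" "x \<noteq> 0"
  shows "separable (Suc n) (kernel G x n)"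
proof -
  have "separable (Suc n) (\<lambda>zs. G (zs ! 0) * (\<Prod>i<n. psi p (zs ! 0) (zs ! Suc i) * psi p x (zs ! Suc i)) *
           (\<Prod>j<n. \<Prod>i<j. (psi p (zs ! Suc i) (zs ! Suc j))\<^sup>2))"
    by (intro separable_mult separable_prod separable_power separable_psi separable_slot assms separable_slot[OF psi_hol_right]) auto
  thus ?thesis
    by (rule separable_cong) (auto simp: kernel_def vand_def nth_tl intro!: prod.cong)
qed

text \<open>With z_k in slot 0, one of the two factors \<psi>(z_k,z_i) in \<open>vand\<close> is
  matched by the kernel and the other is replaced by \<psi>(x,z_i). Dividing by \<open>vand\<close>
  thus leaves the k-th Lagrange term for G at x.\<close>

lemma kernel_symmetrize:
  assumes G: "bc1_theta p n G" and x: "x \<noteq> 0" and zs: "length zs = Suc n" "0 \<notin> set zs"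
    and nodes: "generic_nodes (Suc n) (\<lambda>i. zs ! i)"
  shows "(\<Sum>k<Suc n. kernel G x n (map (\<lambda>i. zs ! Transposition.transpose 0 k i) [0..<Suc n])) =
           G x * vand (Suc n) zs"
proof -
  have "kernel G x n (map (\<lambda>i. zs ! Transposition.transpose 0 k i) [0..<Suc n]) =
         G (zs ! k) * (\<Prod>i\<in>{..<Suc n}-{k}. psi p x (zs ! i) / psi p (zs ! k) (zs ! i)) * vand (Suc n) zs"
    if k: "k < Suc n" for k
  proof -
    define \<pi> where "\<pi> = Transposition.transpose 0 k"
    have \<pi>: "\<pi> permutes {..<Suc n}"
      unfolding \<pi>_def using k by (intro permutes_swap_id) auto
    have \<pi>_lt: "\<pi> i < Suc n \<longleftrightarrow> i < Suc n" for i
      using permutes_in_image[OF \<pi>, of i] by auto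
    define ys where "ys = map (\<lambda>i. zs ! \<pi> i) [0..<Suc n]"
    have ys_nth: "ys ! i = zs ! \<pi> i" if "i < Suc n" for i
      using that unfolding ys_def by (simp del: upt_Suc)
    have len: "length ys = Suc n" by (simp add: ys_def)
    have ys0: "ys ! 0 = zs ! k" using ys_nth[of 0] by (simp add: \<pi>_def)
    have "vand (Suc n) zs = vand (Suc n) ys"
      unfolding ys_def by (rule vand_permute[OF \<pi> zs, symmetric])
    also have "\<dots> = vand (Suc n) (ys ! 0 # tl ys)"
      using len by (cases ys) auto
    also have "\<dots> = (\<Prod>i<n. (psi p (ys ! 0) (ys ! Suc i))\<^sup>2) * vand n (tl ys)"
      unfolding vand_Cons using len by (intro arg_cong2[of _ _ _ _ "(*)"] prod.cong refl) (auto simp: nth_tl)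
    finally have V: "vand (Suc n) zs = (\<Prod>i<n. (psi p (ys ! 0) (ys ! Suc i))\<^sup>2) * vand n (tl ys)" .
    have nz: "psi p (ys ! 0) (ys ! Suc i) \<noteq> 0" if "i < n" for i
    proof -
      have "\<pi> 0 \<noteq> \<pi> (Suc i)"
        using permutes_inj[OF \<pi>] by (auto dest: injD)
      thus ?thesis
        using nodes that \<pi>_lt[of 0] \<pi>_lt[of "Suc i"] by (auto simp: generic_nodes_def ys_nth)
    qed
    have img: "\<pi> ` ({..<Suc n} - {0}) = {..<Suc n} - {k}"
      using permutes_image[OF \<pi>] permutes_inj[OF \<pi>] by (simp add: image_set_diff \<pi>_def)
    have "(\<Prod>i\<in>{..<Suc n}-{k}. psi p x (zs ! i) / psi p (zs ! k) (zs ! i)) =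
          (\<Prod>i\<in>{..<Suc n}-{0}. psi p x (zs ! \<pi> i) / psi p (zs ! k) (zs ! \<pi> i))"
      unfolding img[symmetric] using permutes_inj_on[OF \<pi>] by (subst prod.reindex) (auto simp: o_def)
    also have "{..<Suc n}-{0} = Suc ` {..<n}"
      by (auto simp: image_iff less_Suc_eq_0_disj)
    also have "(\<Prod>i\<in>Suc ` {..<n}. psi p x (zs ! \<pi> i) / psi p (zs ! k) (zs ! \<pi> i)) =
          (\<Prod>i<n. psi p x (ys ! Suc i) / psi p (ys ! 0) (ys ! Suc i))"
      by (subst prod.reindex) (auto simp: ys_nth ys0[symmetric] intro!: prod.cong)
    finally have "G (zs ! k) * (\<Prod>i\<in>{..<Suc n}-{k}. psi p x (zs ! i) / psi p (zs ! k) (zs ! i)) * vand (Suc n) zs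
       = G (zs ! k) * (\<Prod>i<n. psi p x (ys ! Suc i) / psi p (ys ! 0) (ys ! Suc i) * (psi p (ys ! 0) (ys ! Suc i))\<^sup>2) * vand n (tl ys)"
      unfolding V by (simp only: prod.distrib mult_ac)
    also have "(\<Prod>i<n. psi p x (ys ! Suc i) / psi p (ys ! 0) (ys ! Suc i) * (psi p (ys ! 0) (ys ! Suc i))\<^sup>2) =
       (\<Prod>i<n. psi p (ys ! 0) (ys ! Suc i) * psi p x (ys ! Suc i))"
      using nz by (intro prod.cong) (auto simp: power2_eq_square)
    finally show ?thesis
      unfolding kernel_def ys0[symmetric] unfolding ys_def[symmetric] \<pi>_def[symmetric]
      by (rule sym)
  qed
  hence "(\<Sum>k<Suc n. kernel G x n (map (\<lambda>i. zs ! Transposition.transpose 0 k i) [0..<Suc n])) =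
     (\<Sum>k<Suc n. G (zs ! k) * (\<Prod>i\<in>{..<Suc n}-{k}. psi p x (zs ! i) / psi p (zs ! k) (zs ! i))) * vand (Suc n) zs"
    unfolding sum_distrib_right by (intro sum.cong) auto
  also have "(\<Sum>k<Suc n. G (zs ! k) * (\<Prod>i\<in>{..<Suc n}-{k}. psi p x (zs ! i) / psi p (zs ! k) (zs ! i))) = G x"
    by (rule bc1_theta_lagrange[OF G nodes x, symmetric])
  finally show ?thesis .
qed

end

section \<open>The elliptic gamma weight\<close>

text \<open>Excludes a pole, ignores the possibly meaningless value at w itself, and is preserved
  under products; this is how poles of the weight are ruled out factor by factor.\<close>

definition tame :: "(complex \<Rightarrow> complex) \<Rightarrow> complex \<Rightarrow> bool" where
  "tame f w \<longleftrightarrow> (\<exists>c. f \<midarrow>w\<rightarrow> c)"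

lemma tame_mult: "tame f w \<Longrightarrow> tame g w \<Longrightarrow> tame (\<lambda>x. f x * g x) w"
  unfolding tame_def using tendsto_mult by blast

lemma tame_holomorphic:
  assumes "f holomorphic_on S" "open S" "w \<in> S"
  shows "tame f w"
proof -
  have "isCont f w"
    using holomorphic_on_imp_continuous_on[OF assms(1)] assms(2,3)
    by (simp add: continuous_on_eq_continuous_at)
  thus ?thesis unfolding tame_def isCont_def by blast
qed

lemma tame_not_pole: "tame f w \<Longrightarrow> \<not> is_pole f w"
  unfolding tame_def is_pole_def using not_tendsto_and_filterlim_at_infinity[of "at w" f] by auto

lemma tame_cong: "tame f w \<Longrightarrow> eventually (\<lambda>x. f x = g x) (at w) \<Longrightarrow> tame g w"
  unfolding tame_def using tendsto_cong by blast

lemma tame_meromorphic: "f meromorphic_on A \<Longrightarrow> w \<in> A \<Longrightarrow> \<not> is_pole f w \<Longrightarrow> tame f w"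
  by (auto simp: meromorphic_on_altdef not_essential_def tame_def)

lemma tame_inverse_arg:
  assumes "tame f (1 / w)" "w \<noteq> 0"
  shows "tame (\<lambda>x. f (1 / x)) w"
proof -
  from assms obtain c where c: "f \<midarrow>1 / w\<rightarrow> c" unfolding tame_def by blast
  have "filterlim (\<lambda>x. 1 / x) (at (1 / w)) (at w)"
  proof (rule filterlim_atI)
    show "((\<lambda>x. 1 / x) \<longlongrightarrow> 1 / w) (at w)"
      using assms(2) by (intro tendsto_intros)
    have "\<forall>\<^sub>F x in at w. x \<noteq> w" by (simp add: eventually_at_filter)
    thus "\<forall>\<^sub>F x in at w. 1 / x \<noteq> 1 / w"
      by eventually_elim (use assms(2) in \<open>auto simp: divide_simps\<close>)
  qed
  from filterlim_compose[OF c this] show ?thesis unfolding tame_def by blast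
qed

section \<open>Generic points\<close>

lemma holomorphic_nonzero_cosparse:
  assumes "h holomorphic_on (-{0})" "w \<noteq> 0" "h w \<noteq> 0"
  shows "eventually (\<lambda>w. h w \<noteq> 0) (cosparse (-{0}))"
proof -
  have mer: "h meromorphic_on (-{0})"
    using assms(1) by (intro analytic_on_imp_meromorphic_on) (simp add: analytic_on_open open_Compl)
  have "eventually (\<lambda>w. h w = 0) (cosparse (-{0})) \<or> eventually (\<lambda>w. h w \<noteq> 0) (cosparse (-{0}))"
    by (rule meromorphic_imp_constant_or_avoid[OF mer])
       (auto simp: connected_punctured_universe open_Compl)
  moreover have "\<not> eventually (\<lambda>w. h w = 0) (cosparse (-{0}))"
  proof
    assume "eventually (\<lambda>w. h w = 0) (cosparse (-{0}))"
    hence ev: "eventually (\<lambda>w. h w = 0) (at w)"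
      by (rule eventually_cosparse_imp_eventually_at) (use assms in auto)
    have "h \<midarrow>w\<rightarrow> h w"
      using holomorphic_on_imp_continuous_on[OF assms(1)] assms(2)
      by (simp add: continuous_on_eq_continuous_at open_Compl isCont_def)
    hence "\<forall>\<^sub>F x in at w. h x \<noteq> 0"
      using assms(3) by (rule tendsto_imp_eventually_ne)
    with ev have "\<forall>\<^sub>F x in at w. False" by eventually_elim auto
    thus False by simp
  qed
  ultimately show ?thesis by blast
qed

lemma cosparse_countable:
  assumes "eventually P (cosparse (-{0::complex}))"
  shows "countable {w. w \<noteq> 0 \<and> \<not> P w}"
proof -
  have "countable (-{0} \<inter> {w. \<not> P w})"
    using assms by (intro sparse_imp_countable) (auto simp: eventually_cosparse open_Compl)
  moreover have "-{0} \<inter> {w. \<not> P w} = {w. w \<noteq> 0 \<and> \<not> P w}" by auto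
  ultimately show ?thesis by simp
qed

locale elliptic = nome +
  fixes q :: complex
  assumes q_nz: "q \<noteq> 0" and q_lt: "norm q < 1"
begin

abbreviation D :: "complex \<Rightarrow> complex" where "D \<equiv> dpoch p q"

lemma D_hol: "f holomorphic_on S \<Longrightarrow> (\<lambda>w. D (f w)) holomorphic_on S"
  by (intro holomorphic_on_compose[OF _ holomorphic_on_subset[OF dpoch_entire[OF p_lt q_lt]], unfolded o_def]) auto

lemma qpoch_hol: "f holomorphic_on S \<Longrightarrow> (\<lambda>w. qpoch p (f w)) holomorphic_on S"
  by (intro holomorphic_on_compose[OF _ holomorphic_on_subset[OF qpoch_entire[OF p_lt]], unfolded o_def]) auto

lemma qpoch_q_hol: "f holomorphic_on S \<Longrightarrow> (\<lambda>w. qpoch q (f w)) holomorphic_on S"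
  by (intro holomorphic_on_compose[OF _ holomorphic_on_subset[OF qpoch_entire[OF q_lt]], unfolded o_def]) auto

text \<open>A zero x of D satisfies p^i q^j x = 1 and so has modulus at least 1. The value 1/2 is
  the sample argument showing that the functions in \<open>D_nz\<close> are not identically
  zero.\<close>

lemma D_half: "D (1 / 2) \<noteq> 0"
proof
  assume "D (1 / 2) = 0"
  then obtain i j where "p ^ i * q ^ j * (1 / 2) = 1"
    by (auto simp: dpoch_eq_0_iff[OF p_lt q_lt])
  hence "p ^ i * q ^ j = 2" by simp
  hence "norm (p ^ i * q ^ j) = 2" by simp
  moreover have "norm (p ^ i * q ^ j) \<le> 1"
    unfolding norm_mult norm_power using p_lt q_lt by (intro mult_le_one power_le_one) auto
  ultimately show False by simp
qed

lemma D_nz: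
  assumes "c \<noteq> 0"
  shows "eventually (\<lambda>w. D (c * w) \<noteq> 0) (cosparse (-{0}))"
    and "eventually (\<lambda>w. D (c / w) \<noteq> 0) (cosparse (-{0}))"
    and "eventually (\<lambda>w. D (c * w\<^sup>2) \<noteq> 0) (cosparse (-{0}))"
    and "eventually (\<lambda>w. D (c / w\<^sup>2) \<noteq> 0) (cosparse (-{0}))"
proof -
  show "eventually (\<lambda>w. D (c * w) \<noteq> 0) (cosparse (-{0}))"
    by (rule holomorphic_nonzero_cosparse[where w = "1 / (2 * c)"])
       (use assms D_half in \<open>auto intro!: D_hol holomorphic_intros\<close>)
  show "eventually (\<lambda>w. D (c / w) \<noteq> 0) (cosparse (-{0}))"
    by (rule holomorphic_nonzero_cosparse[where w = "2 * c"])
       (use assms D_half in \<open>auto intro!: D_hol holomorphic_intros\<close>)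
  define r s where "r = csqrt (1 / (2 * c))" and "s = csqrt (2 * c)"
  have e: "c * r\<^sup>2 = 1 / 2" "c / s\<^sup>2 = 1 / 2"
    using assms by (simp_all add: r_def s_def)
  have rs: "D (c * r\<^sup>2) \<noteq> 0" "D (c / s\<^sup>2) \<noteq> 0" "r \<noteq> 0" "s \<noteq> 0"
    unfolding e using D_half assms by (auto simp: r_def s_def)
  show "eventually (\<lambda>w. D (c * w\<^sup>2) \<noteq> 0) (cosparse (-{0}))"
    by (rule holomorphic_nonzero_cosparse[where w = r])
       (use rs in \<open>auto intro!: D_hol holomorphic_intros\<close>)
  show "eventually (\<lambda>w. D (c / w\<^sup>2) \<noteq> 0) (cosparse (-{0}))"
    by (rule holomorphic_nonzero_cosparse[where w = s])
       (use rs in \<open>auto intro!: D_hol holomorphic_intros\<close>)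
qed

lemma D_q: "D x = qpoch p x * D (q * x)"
  by (rule dpoch_rec_q[OF p_lt q_lt])

lemma D_p: "D x = qpoch q x * D (p * x)"
  by (rule dpoch_rec_p[OF p_lt q_lt])

lemma egamma_D: "egamma p q z = D (p * q / z) / D z"
  by (rule egamma_conv_dpoch[OF p_lt q_lt])

lemma theta_qpoch: "theta p z = qpoch p (p / z) * qpoch p z"
  by (rule theta_conv_qpoch[OF p_lt])

definition gamma2 :: "complex \<Rightarrow> complex" where
  "gamma2 w = 1 / (egamma p q (w\<^sup>2) * egamma p q (inverse (w\<^sup>2)))"

text \<open>D(x)/D(pqx) is (x;p)(qx;q). Hence the denominator of \<open>Delta\<close> contributes no
  poles on the punctured plane, only removable default values.\<close>

lemma gamma2_generic:
  "eventually (\<lambda>w. gamma2 w = qpoch p (w\<^sup>2) * qpoch q (q * w\<^sup>2) * (qpoch p (1 / w\<^sup>2) * qpoch q (q / w\<^sup>2)))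
     (cosparse (-{0}))"
proof -
  have "p * q \<noteq> 0" using p_nz q_nz by simp
  from D_nz(3)[OF this] D_nz(4)[OF this] show ?thesis
  proof eventually_elim
    case (elim w)
    have *: "D x = qpoch p x * qpoch q (q * x) * D (p * q * x)" for x
      using D_q[of x] D_p[of "q * x"] by (simp add: mult_ac)
    have "gamma2 w = (D (w\<^sup>2) / D (p * q * w\<^sup>2)) * (D (1 / w\<^sup>2) / D (p * q / w\<^sup>2))"
      unfolding gamma2_def egamma_D by (simp add: field_simps)
    also have "D (w\<^sup>2) / D (p * q * w\<^sup>2) = qpoch p (w\<^sup>2) * qpoch q (q * w\<^sup>2)"
      using *[of "w\<^sup>2"] elim by simp
    also have "D (1 / w\<^sup>2) / D (p * q / w\<^sup>2) = qpoch p (1 / w\<^sup>2) * qpoch q (q / w\<^sup>2)"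
      using *[of "1 / w\<^sup>2"] elim by simp
    finally show ?case .
  qed
qed

lemma tame_gamma2: "w \<noteq> 0 \<Longrightarrow> tame gamma2 w"
proof (rule tame_cong)
  assume w: "w \<noteq> 0"
  show "tame (\<lambda>w. qpoch p (w\<^sup>2) * qpoch q (q * w\<^sup>2) * (qpoch p (1 / w\<^sup>2) * qpoch q (q / w\<^sup>2))) w"
    by (rule tame_holomorphic[of _ "-{0}"])
       (use w in \<open>auto simp: open_Compl intro!: holomorphic_intros qpoch_hol qpoch_q_hol\<close>)
  have "w \<in> -{0}" using w by simp
  from eventually_cosparse_imp_eventually_at[OF gamma2_generic this]
  show "eventually (\<lambda>w. qpoch p (w\<^sup>2) * qpoch q (q * w\<^sup>2) * (qpoch p (1 / w\<^sup>2) * qpoch q (q / w\<^sup>2)) = gamma2 w) (at w)"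
    by eventually_elim simp
qed

section \<open>Poles of the weight and admissible contours\<close>

lemma Delta_eq: "Delta p q as z = (\<Prod>a\<leftarrow>as. egamma p q (a * z) * egamma p q (a / z)) * gamma2 z"
  by (simp add: Delta_def gamma2_def)

lemma Delta_inverse: "Delta p q as (1 / z) = Delta p q as z"
  by (simp add: Delta_def power_divide inverse_eq_divide mult_ac)

lemma inner_factor_D: "inner_factor p q as w = (\<Prod>a\<leftarrow>as. D (p * q / (a * w)) / D (a / w))"
  by (rule inner_factor_conv_dpoch[OF p_lt q_lt])

lemma Delta_inner_factor: "Delta p q as w = inner_factor p q as w * inner_factor p q as (1 / w) * gamma2 w"
proof -
  have "(\<Prod>a\<leftarrow>as. egamma p q (a * w) * egamma p q (a / w)) =
          inner_factor p q as w * inner_factor p q as (1 / w)"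
    by (induction as) (simp_all add: inner_factor_D egamma_D mult_ac)
  thus ?thesis by (simp add: Delta_eq)
qed

lemma inner_factor_meromorphic: "inner_factor p q as meromorphic_on (-{0})"
proof -
  have "(\<lambda>w. \<Prod>a\<leftarrow>as. D (p * q / (a * w)) / D (a / w)) meromorphic_on (-{0})"
  proof (induction as)
    case (Cons a as)
    have "(\<lambda>w. D (p * q / (a * w))) holomorphic_on (-{0})"
    proof (cases "a = 0")
      case False
      thus ?thesis by (auto intro!: D_hol holomorphic_intros)
    qed simp
    moreover have "(\<lambda>w. D (a / w)) holomorphic_on (-{0})"
      by (auto intro!: D_hol holomorphic_intros)
    ultimately have "(\<lambda>w. D (p * q / (a * w)) / D (a / w)) meromorphic_on (-{0})"
      by (intro meromorphic_on_divide analytic_on_imp_meromorphic_on) (simp_all add: analytic_on_open open_Compl)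
    from meromorphic_on_mult[OF this Cons] show ?case by simp
  qed (simp add: meromorphic_on_const)
  thus ?thesis by (simp add: inner_factor_D[abs_def])
qed

lemma inner_factor_inverse_meromorphic: "(\<lambda>w. inner_factor p q as (1 / w)) meromorphic_on (-{0})"
proof (rule meromorphic_on_compose[OF inner_factor_meromorphic])
  have "(\<lambda>w::complex. 1 / w) holomorphic_on (-{0})" by (intro holomorphic_intros) auto
  thus "(\<lambda>w::complex. 1 / w) analytic_on (-{0})" by (simp add: analytic_on_open open_Compl)
qed auto

lemma gamma2_meromorphic: "gamma2 meromorphic_on (-{0})"
proof -
  have h: "(\<lambda>w. D (w\<^sup>2)) holomorphic_on (-{0})" "(\<lambda>w. D (inverse (w\<^sup>2))) holomorphic_on (-{0})"
          "(\<lambda>w. D (p * q / w\<^sup>2)) holomorphic_on (-{0})" "(\<lambda>w. D (p * q / inverse (w\<^sup>2))) holomorphic_on (-{0})"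
    by (auto intro!: D_hol holomorphic_intros)
  hence m: "(\<lambda>w. D (w\<^sup>2)) meromorphic_on (-{0})" "(\<lambda>w. D (inverse (w\<^sup>2))) meromorphic_on (-{0})"
          "(\<lambda>w. D (p * q / w\<^sup>2)) meromorphic_on (-{0})" "(\<lambda>w. D (p * q / inverse (w\<^sup>2))) meromorphic_on (-{0})"
    by (auto intro!: analytic_on_imp_meromorphic_on simp: analytic_on_open open_Compl)
  show ?thesis
    unfolding gamma2_def[abs_def] egamma_D
    by (intro meromorphic_on_divide meromorphic_on_mult m meromorphic_on_const)
qed

lemma Delta_meromorphic: "Delta p q as meromorphic_on (-{0})"
  unfolding Delta_inner_factor[abs_def]
  by (intro meromorphic_on_mult inner_factor_meromorphic inner_factor_inverse_meromorphic gamma2_meromorphic)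

text \<open>\<open>Delta\<close> is I(w) I(1/w) times a factor without poles, and it is invariant
  under inversion. The second alternative includes that 1/w is a pole of \<open>Delta\<close> as
  well, since \<open>II_contour\<close> constrains only common poles of \<open>Delta\<close> and
  I.\<close>

lemma Delta_pole:
  assumes w: "w \<noteq> 0" and pole: "is_pole (Delta p q as) w"
  shows "is_pole (inner_factor p q as) w \<or>
         is_pole (inner_factor p q as) (1 / w) \<and> is_pole (Delta p q as) (1 / w)"
proof (rule ccontr)
  assume neg: "\<not> ?thesis"
  have pole': "is_pole (Delta p q as) (1 / w)"
  proof (rule ccontr)
    assume "\<not> is_pole (Delta p q as) (1 / w)"
    hence "tame (Delta p q as) (1 / w)"
      by (intro tame_meromorphic[OF Delta_meromorphic]) (use w in auto)
    hence "tame (\<lambda>w. Delta p q as (1 / w)) w" by (rule tame_inverse_arg[OF _ w])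
    thus False using pole tame_not_pole by (simp add: Delta_inverse)
  qed
  have 1: "tame (inner_factor p q as) w"
    by (rule tame_meromorphic[OF inner_factor_meromorphic]) (use w neg in auto)
  have "tame (inner_factor p q as) (1 / w)"
    by (rule tame_meromorphic[OF inner_factor_meromorphic]) (use w neg pole' in auto)
  hence 2: "tame (\<lambda>w. inner_factor p q as (1 / w)) w"
    by (rule tame_inverse_arg[OF _ w])
  have "tame (Delta p q as) w"
    unfolding Delta_inner_factor[abs_def] by (intro tame_mult 1 2 tame_gamma2 w)
  thus False using pole tame_not_pole by blast
qed

lemma tame_inner_factor:
  assumes "w \<noteq> 0" "\<And>a i j. a \<in> set as \<Longrightarrow> w \<noteq> p ^ i * q ^ j * a" "0 \<notin> set as"
  shows "tame (inner_factor p q as) w"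
proof -
  have "tame (\<lambda>w. \<Prod>a\<leftarrow>as. D (p * q / (a * w)) / D (a / w)) w"
    using assms(2,3)
  proof (induction as)
    case Nil
    show ?case by (auto simp: tame_def)
  next
    case (Cons a as)
    have "D (a / w) \<noteq> 0"
    proof
      assume "D (a / w) = 0"
      then obtain i j where "p ^ i * q ^ j * (a / w) = 1"
        by (auto simp: dpoch_eq_0_iff[OF p_lt q_lt])
      hence "w = p ^ i * q ^ j * a" using assms(1) by (simp add: field_simps)
      thus False using Cons.prems(1)[of a i j] by simp
    qed
    have cont: "isCont (\<lambda>w. D (c / w)) w" for c
    proof -
      have "(\<lambda>w. D (c / w)) holomorphic_on (-{0})"
        by (auto intro!: D_hol holomorphic_intros)
      from holomorphic_on_imp_continuous_on[OF this] show ?thesis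
        using assms(1) by (simp add: continuous_on_eq_continuous_at open_Compl)
    qed
    have "isCont (\<lambda>w. D (p * q / a / w) / D (a / w)) w"
      by (intro isCont_divide cont) fact
    hence "tame (\<lambda>w. D (p * q / (a * w)) / D (a / w)) w"
      unfolding isCont_def tame_def by auto
    moreover have "tame (\<lambda>w. \<Prod>a\<leftarrow>as. D (p * q / (a * w)) / D (a / w)) w"
      by (rule Cons.IH) (use Cons.prems in auto)
    ultimately have "tame (\<lambda>w. D (p * q / (a * w)) / D (a / w) * (\<Prod>a\<leftarrow>as. D (p * q / (a * w)) / D (a / w))) w"
      by (rule tame_mult)
    thus ?case by simp
  qed
  thus ?thesis by (simp add: inner_factor_D[abs_def])
qed

text \<open>The index found does not depend on C, which is the source of contour independence.
  Common poles with I are interior by admissibility; at any other pole w, the point 1/w is such a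
  common pole, and inversion symmetry gives w the index 0.\<close>

lemma Delta_pole_index:
  assumes as: "0 \<notin> set as" and C: "II_contour p q as C"
    and w: "w \<noteq> 0" and pole: "is_pole (Delta p q as) w"
  shows "w \<notin> contour_image C"
    and "contour_index C w = (if is_pole (inner_factor p q as) w then 1 else 0)"
proof -
  have sym: "symmetric_contour C" "0 \<in> contour_interior C" using C by (auto simp: II_contour_def)
  have inner: "y \<in> contour_interior C"
    if y: "y \<noteq> 0" "is_pole (Delta p q as) y" "is_pole (inner_factor p q as) y" for y
  proof -
    obtain a i j where "a \<in> set as" "y = p ^ i * q ^ j * a"
      using tame_inner_factor[OF y(1) _ as] tame_not_pole y(3) by blast
    thus ?thesis using C y by (auto simp: II_contour_def)
  qed
  show "w \<notin> contour_image C"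
    and "contour_index C w = (if is_pole (inner_factor p q as) w then 1 else 0)"
  proof -
    have "w \<notin> contour_image C \<and> contour_index C w = (if is_pole (inner_factor p q as) w then 1 else 0)"
    proof (cases "is_pole (inner_factor p q as) w")
      case True
      thus ?thesis using inner[OF w pole] by (simp add: contour_interior_def)
    next
      case False
      hence "inverse w \<in> contour_interior C"
        using Delta_pole[OF w pole] inner[of "1 / w"] w by (simp add: inverse_eq_divide)
      thus ?thesis using symmetric_contour_not_interior[OF sym _ w] False by simp
    qed
    thus "w \<notin> contour_image C"
      and "contour_index C w = (if is_pole (inner_factor p q as) w then 1 else 0)" by simp_all
  qed
qed

lemma II_contour_closed: "II_contour p q as C \<Longrightarrow> closed_contour C"
  by (simp add: II_contour_def symmetric_contour_def)

lemma II_contour_weight: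
  assumes "0 \<notin> set as" "II_contour p q as C"
  shows "dlog_weight C (Delta p q as)"
  unfolding dlog_weight_def
  using II_contour_closed[OF assms(2)] Delta_pole_index(1)[OF assms]
  by (auto intro!: dlog_integrable_weight[OF _ Delta_meromorphic])

lemma II_contour_independent:
  assumes "0 \<notin> set as" "II_contour p q as C" "II_contour p q as C'" "h holomorphic_on (-{0})"
  shows "dlog_integral C (\<lambda>z. h z * Delta p q as z) = dlog_integral C' (\<lambda>z. h z * Delta p q as z)"
proof (rule dlog_integral_weight_contour_independent[OF _ _ Delta_meromorphic])
  show "closed_contour C" "closed_contour C'" using assms II_contour_closed by auto
  show "contour_index C 0 = contour_index C' 0"
    using assms by (auto simp: II_contour_def contour_interior_def)
qed (use Delta_pole_index[OF assms(1,2)] Delta_pole_index[OF assms(1,3)] assms(4) in auto)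

section \<open>Gamma factors that combine to theta functions\<close>

lemma
  assumes "t \<noteq> 0" "D (q * t) \<noteq> 0" "D (p * q / t) \<noteq> 0"
  shows egamma_pair: "egamma p q t * egamma p q (p / t) = 1 / theta p t"
    and egamma_pair_q: "egamma p q (q * t) * egamma p q (p * q / t) = theta p t"
proof -
  have 1: "D t = qpoch p t * D (q * t)" "D (p / t) = qpoch p (p / t) * D (p * q / t)"
    using D_q[of t] D_q[of "p / t"] by (simp_all add: mult_ac)
  have 2: "p * q / (p / t) = q * t" "p * q / (q * t) = p / t" "p * q / (p * q / t) = t"
    using p_nz q_nz assms by simp_all
  \<comment> \<open>Only D(qt) and D(pq/t) cancel and have to be nonzero. At zeros of theta both
    sides are 0 by the convention x/0 = 0.\<close>
  show "egamma p q t * egamma p q (p / t) = 1 / theta p t"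
    unfolding egamma_D 2 theta_qpoch 1 using assms by simp
  show "egamma p q (q * t) * egamma p q (p * q / t) = theta p t"
    unfolding egamma_D 2 theta_qpoch 1 using assms by simp
qed

lemma egamma_ratio:
  assumes "t \<noteq> 0" "D t \<noteq> 0" "D (p * q / t) \<noteq> 0"
  shows "egamma p q (q * t) / egamma p q t = theta p t"
proof -
  have "qpoch p t \<noteq> 0" using assms(2) D_q[of t] by auto
  hence "egamma p q (q * t) = theta p t * egamma p q t"
    by (intro egamma_q_mult p_lt q_lt q_nz assms)
  moreover have "egamma p q t \<noteq> 0" using assms by (simp add: egamma_D)
  ultimately show ?thesis by simp
qed

text \<open>The non-vanishing conditions of \<open>egamma_pair\<close> for t = cw and t = c/w
  together.\<close>

definition pair_regular :: "complex \<Rightarrow> complex \<Rightarrow> bool" where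
  "pair_regular c w \<longleftrightarrow> D (q * (c * w)) \<noteq> 0 \<and> D (q * (c / w)) \<noteq> 0 \<and>
     D (p * q / (c * w)) \<noteq> 0 \<and> D (p * q / (c / w)) \<noteq> 0"

lemma pair_regular_generic:
  assumes "c \<noteq> 0"
  shows "eventually (pair_regular c) (cosparse (-{0}))"
proof -
  have c: "q * c \<noteq> 0" "p * q / c \<noteq> 0" using assms p_nz q_nz by auto
  have "pair_regular c = (\<lambda>w. D (q * c * w) \<noteq> 0 \<and> D (q * c / w) \<noteq> 0 \<and> D (p * q / c / w) \<noteq> 0 \<and> D (p * q / c * w) \<noteq> 0)"
    by (auto simp: pair_regular_def fun_eq_iff mult_ac)
  thus ?thesis
    using D_nz(1)[OF c(1)] D_nz(2)[OF c(1)] D_nz(2)[OF c(2)] D_nz(1)[OF c(2)]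
    by (simp add: eventually_conj_iff)
qed

text \<open>The factors are regrouped crosswise: the one with argument cw belongs to the one with
  argument p/(cw), which comes from the other parameter and 1/w. The same holds for c/w.\<close>

lemma
  assumes "c \<noteq> 0" "w \<noteq> 0" "pair_regular c w"
  shows gamma_factor_pair:
      "egamma p q (c * w) * egamma p q (c / w) * (egamma p q (p / c * w) * egamma p q (p / c / w)) =
         1 / (c * psi p c w)"
    and gamma_factor_pair_q:
      "egamma p q (q * c * w) * egamma p q (q * c / w) * (egamma p q (p * q / c * w) * egamma p q (p * q / c / w)) =
         c * psi p c w"
proof -
  have c: "c * w \<noteq> 0" "c / w \<noteq> 0" using assms by auto
  have psi: "c * psi p c w = theta p (c * w) * theta p (c / w)"
    using assms by (simp add: psi_def)
  have 1: "p / c * w = p / (c / w)" "p / c / w = p / (c * w)"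
    "p * q / c * w = p * q / (c / w)" "p * q / c / w = p * q / (c * w)"
    "q * c * w = q * (c * w)" "q * c / w = q * (c / w)" by simp_all
  have reg: "D (q * (c * w)) \<noteq> 0" "D (p * q / (c * w)) \<noteq> 0"
            "D (q * (c / w)) \<noteq> 0" "D (p * q / (c / w)) \<noteq> 0"
    using assms(3) by (auto simp: pair_regular_def)
  have "egamma p q (c * w) * egamma p q (c / w) * (egamma p q (p / (c / w)) * egamma p q (p / (c * w)))
     = (egamma p q (c * w) * egamma p q (p / (c * w))) * (egamma p q (c / w) * egamma p q (p / (c / w)))"
    by (simp only: mult_ac)
  also have "\<dots> = 1 / (c * psi p c w)"
    unfolding psi egamma_pair[OF c(1) reg(1,2)] egamma_pair[OF c(2) reg(3,4)] by simp
  finally show "egamma p q (c * w) * egamma p q (c / w) * (egamma p q (p / c * w) * egamma p q (p / c / w)) =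
         1 / (c * psi p c w)" unfolding 1 .
  have "egamma p q (q * (c * w)) * egamma p q (q * (c / w)) * (egamma p q (p * q / (c / w)) * egamma p q (p * q / (c * w)))
     = (egamma p q (q * (c * w)) * egamma p q (p * q / (c * w))) * (egamma p q (q * (c / w)) * egamma p q (p * q / (c / w)))"
    by (simp only: mult_ac)
  also have "\<dots> = c * psi p c w"
    unfolding psi egamma_pair_q[OF c(1) reg(1,2)] egamma_pair_q[OF c(2) reg(3,4)] by simp
  finally show "egamma p q (q * c * w) * egamma p q (q * c / w) * (egamma p q (p * q / c * w) * egamma p q (p * q / c / w)) =
         c * psi p c w" unfolding 1 .
qed

text \<open>Each quotient \<Gamma>(qt)/\<Gamma>(t) is \<theta>(t). Inverting the arguments w/z and
  1/(zw) doubles the two other theta factors and produces the power z^(-2).\<close>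

lemma II_cross_eq:
  assumes "z \<noteq> 0" "w \<noteq> 0"
    and reg: "\<And>t. t \<in> {z * w, z / w, w / z, 1 / (z * w)} \<Longrightarrow> D t \<noteq> 0 \<and> D (p * q / t) \<noteq> 0"
  shows "II_cross p q z w = (psi p z w)\<^sup>2"
proof -
  have ratio: "egamma p q (q * t) / egamma p q t = theta p t" if "t \<in> {z * w, z / w, w / z, 1 / (z * w)}" for t
    by (rule egamma_ratio) (use that assms(1,2) reg[OF that] in auto)
  have e: "q * z * w = q * (z * w)" "q * z / w = q * (z / w)" "q * w / z = q * (w / z)" "q / (z * w) = q * (1 / (z * w))"
    by simp_all
  have "II_cross p q z w =
     (egamma p q (q * (z * w)) / egamma p q (z * w)) * (egamma p q (q * (z / w)) / egamma p q (z / w)) *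
     (egamma p q (q * (w / z)) / egamma p q (w / z)) * (egamma p q (q * (1 / (z * w))) / egamma p q (1 / (z * w)))"
    unfolding II_cross_def e by (simp only: times_divide_times_eq)
  also have "\<dots> = theta p (z * w) * theta p (z / w) * theta p (w / z) * theta p (1 / (z * w))"
    by (intro arg_cong2[of _ _ _ _ "(*)"] ratio) auto
  also have "theta p (w / z) = - theta p (z / w) * w / z"
    using theta_inv[of "z / w"] assms by simp
  also have "theta p (1 / (z * w)) = - theta p (z * w) / (z * w)"
    using theta_inv[of "z * w"] assms by simp
  also have "theta p (z * w) * theta p (z / w) * (- theta p (z / w) * w / z) * (- theta p (z * w) / (z * w)) = (psi p z w)\<^sup>2"
    using assms by (simp add: psi_def field_simps power2_eq_square)
  finally show ?thesis .
qed

lemma countable_II_cross_exceptions: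
  assumes "z \<noteq> 0"
  shows "countable {w. w \<noteq> 0 \<and> II_cross p q z w \<noteq> (psi p z w)\<^sup>2}"
proof (rule countable_subset)
  \<comment> \<open>These are D(t) and D(pq/t) for the four arguments t, rewritten as D(cw) or
    D(c/w) so that \<open>D_nz\<close> applies.\<close>
  define R where "R = (\<lambda>w. D (z * w) \<noteq> 0 \<and> D (p * q / z / w) \<noteq> 0 \<and> D (z / w) \<noteq> 0 \<and> D (p * q / z * w) \<noteq> 0 \<and>
      D (1 / z * w) \<noteq> 0 \<and> D (p * q * z / w) \<noteq> 0 \<and> D (1 / z / w) \<noteq> 0 \<and> D (p * q * z * w) \<noteq> 0)"
  have c: "p * q / z \<noteq> 0" "1 / z \<noteq> 0" "p * q * z \<noteq> 0" using assms p_nz q_nz by auto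
  have "eventually R (cosparse (-{0}))"
    unfolding R_def using D_nz(1,2)[OF assms] D_nz(1,2)[OF c(1)] D_nz(1,2)[OF c(2)] D_nz(1,2)[OF c(3)]
    by (simp only: eventually_conj_iff simp_thms)
  from cosparse_countable[OF this] show "countable {w. w \<noteq> 0 \<and> \<not> R w}" .
  show "{w. w \<noteq> 0 \<and> II_cross p q z w \<noteq> (psi p z w)\<^sup>2} \<subseteq> {w. w \<noteq> 0 \<and> \<not> R w}"
  proof safe
    fix w assume w: "w \<noteq> 0" "R w" "II_cross p q z w \<noteq> (psi p z w)\<^sup>2"
    have "II_cross p q z w = (psi p z w)\<^sup>2"
      by (rule II_cross_eq[OF assms w(1)]) (use w(2) in \<open>auto simp: R_def mult_ac\<close>)
    thus False using w by simp
  qed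
qed

section \<open>Evaluation of the integrals over an admissible contour\<close>

definition II_const :: "nat \<Rightarrow> complex" where
  "II_const N = qpoch p p ^ N * qpoch q q ^ N * egamma p q q ^ N / (2 ^ N * fact N)"

text \<open>Each additional variable costs a factor (p;p)^2/2, the prefactor in the claim; the
  1/(N+1) is compensated by the number of terms in the symmetrization.\<close>

lemma II_const_Suc: "II_const (Suc N) = (qpoch p p)\<^sup>2 / 2 * II_const N / of_nat (Suc N)"
proof -
  have "II_const N = (qpoch p p)\<^sup>2 ^ N / (2 ^ N * fact N)" for N
    unfolding II_const_def mult.assoc power_mult_distrib[symmetric] egamma_q[OF p_lt q_lt q_nz]
    by (simp add: power2_eq_square)
  thus ?thesis by simp
qed

text \<open>An admissible contour at hand settles which branch of the definition is taken and lets
  the arbitrarily chosen contour be exchanged for the given one. For N = 0 both sides are 1.\<close>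

lemma II_eq:
  assumes as: "0 \<notin> set as" and C: "II_contour p q as C"
  shows "II p q N as = II_const N * multi_dlog_integral C N (\<lambda>zs. vand N zs * (\<Prod>i<N. Delta p q as (zs ! i)))"
proof (cases "N = 0")
  case True
  thus ?thesis by (simp add: II_def II_const_def vand_def)
next
  case False
  define C' where "C' = (SOME C. II_contour p q as C)"
  have C': "II_contour p q as C'"
    unfolding C'_def using C by (rule someI)
  have "II p q N as = II_integral p q N as C'"
    using False C by (auto simp: II_def C'_def)
  also have "\<dots> = II_const N * multi_dlog_integral C' N (\<lambda>zs.
         (\<Prod>j<N. \<Prod>i<j. II_cross p q (zs ! i) (zs ! j)) * (\<Prod>i<N. Delta p q as (zs ! i)))"
    by (simp add: II_integral_def II_const_def)
  also have "multi_dlog_integral C' N (\<lambda>zs.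
         (\<Prod>j<N. \<Prod>i<j. II_cross p q (zs ! i) (zs ! j)) * (\<Prod>i<N. Delta p q as (zs ! i))) =
       multi_dlog_integral C' N (\<lambda>zs. vand N zs * (\<Prod>i<N. Delta p q as (zs ! i)))"
  proof (rule multi_dlog_integral_generic_cong[OF II_contour_closed[OF C'], where A = "{}" and
           B = "\<lambda>z. if z = 0 then {} else {w. w \<noteq> 0 \<and> II_cross p q z w \<noteq> (psi p z w)\<^sup>2}"])
    show "countable (if z = 0 then {} else {w. w \<noteq> 0 \<and> II_cross p q z w \<noteq> (psi p z w)\<^sup>2})" for z
      using countable_II_cross_exceptions by simp
  next
    fix zs :: "complex list"
    assume zs: "length zs = N" "set zs \<subseteq> contour_image C'"
      "\<And>i j. i < j \<Longrightarrow> j < N \<Longrightarrow> zs ! j \<notin> (if zs ! i = 0 then {} else {w. w \<noteq> 0 \<and> II_cross p q (zs ! i) w \<noteq> (psi p (zs ! i) w)\<^sup>2})"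
    have nz: "zs ! i \<noteq> 0" if "i < N" for i
      using contour_image_nonzero[OF II_contour_closed[OF C'] zs(2)] zs(1) that nth_mem by metis
    have "(\<Prod>j<N. \<Prod>i<j. II_cross p q (zs ! i) (zs ! j)) = vand N zs"
      unfolding vand_def
    proof (intro prod.cong refl)
      fix j i assume "j \<in> {..<N}" "i \<in> {..<j}"
      thus "II_cross p q (zs ! i) (zs ! j) = (psi p (zs ! i) (zs ! j))\<^sup>2"
        using zs(3)[of i j] nz[of i] nz[of j] by auto
    qed
    thus "(\<Prod>j<N. \<Prod>i<j. II_cross p q (zs ! i) (zs ! j)) * (\<Prod>i<N. Delta p q as (zs ! i)) =
          vand N zs * (\<Prod>i<N. Delta p q as (zs ! i))" by simp
  qed simp
  also have "multi_dlog_integral C' N (\<lambda>zs. vand N zs * (\<Prod>i<N. Delta p q as (zs ! i))) =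
             multi_dlog_integral C N (\<lambda>zs. vand N zs * (\<Prod>i<N. Delta p q as (zs ! i)))"
    by (intro multi_dlog_integral_contour_independent separable_vand II_contour_weight II_contour_independent as C C')
  finally show ?thesis .
qed

text \<open>For the pair c, p/c all factors with a positive power of q cancel, and I is generically
  1/((c/w;p)(p/(cw);p)). This is why only the points p^i c and p^(i+1)/c have to lie inside the
  contour.\<close>

lemma tame_inner_factor_pair:
  assumes c: "c \<noteq> 0" and w: "w \<noteq> 0" and "\<And>i. w \<noteq> p ^ i * c \<and> w \<noteq> p ^ Suc i / c"
  shows "tame (inner_factor p q [c, p / c]) w"
proof (rule tame_cong)
  have nz: "qpoch p (c / w) \<noteq> 0" "qpoch p (p / (c * w)) \<noteq> 0"
  proof -
    show "qpoch p (c / w) \<noteq> 0"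
    proof
      assume "qpoch p (c / w) = 0"
      then obtain i where "p ^ i * (c / w) = 1" using qpoch_eq_0_iff[OF p_lt] by blast
      hence "w = p ^ i * c" using w by (simp add: field_simps)
      thus False using assms(3)[of i] by simp
    qed
    show "qpoch p (p / (c * w)) \<noteq> 0"
    proof
      assume "qpoch p (p / (c * w)) = 0"
      then obtain i where "p ^ i * (p / (c * w)) = 1" using qpoch_eq_0_iff[OF p_lt] by blast
      hence "w = p ^ Suc i / c" using w c by (simp add: field_simps)
      thus False using assms(3)[of i] by simp
    qed
  qed
  have hol: "(\<lambda>w. qpoch p (c / w) * qpoch p (p / (c * w))) holomorphic_on (-{0})"
    using c by (auto intro!: holomorphic_intros qpoch_hol)
  hence "isCont (\<lambda>w. qpoch p (c / w) * qpoch p (p / (c * w))) w"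
    using holomorphic_on_imp_continuous_on[OF hol] w by (simp add: continuous_on_eq_continuous_at open_Compl)
  hence "isCont (\<lambda>w. 1 / (qpoch p (c / w) * qpoch p (p / (c * w)))) w"
    using nz by (intro isCont_divide continuous_const) auto
  thus "tame (\<lambda>w. 1 / (qpoch p (c / w) * qpoch p (p / (c * w)))) w"
    by (auto simp: tame_def isCont_def)
  have "w \<in> -{0}" using w by simp
  from eventually_cosparse_imp_eventually_at[OF pair_regular_generic[OF c] this]
  show "eventually (\<lambda>w. 1 / (qpoch p (c / w) * qpoch p (p / (c * w))) = inner_factor p q [c, p / c] w) (at w)"
  proof eventually_elim
    case (elim w)
    have 1: "D (c / w) = qpoch p (c / w) * D (q * (c / w))"
            "D (p / (c * w)) = qpoch p (p / (c * w)) * D (p * q / (c * w))"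
      using D_q[of "c / w"] D_q[of "p / (c * w)"] by (simp_all add: mult_ac)
    have 2: "p * q / (p / c * w) = q * (c / w)" "p / c / w = p / (c * w)"
      using p_nz by simp_all
    have "inner_factor p q [c, p / c] w = D (p * q / (c * w)) / D (c / w) * (D (q * (c / w)) / D (p / (c * w)))"
      unfolding inner_factor_D by (simp add: 2 p_nz q_nz)
    also have "\<dots> = 1 / (qpoch p (c / w) * qpoch p (p / (c * w)))"
      unfolding 1 using elim p_nz by (auto simp: pair_regular_def)
    finally show ?case ..
  qed
qed

text \<open>For the pair qc, pq/c the quotient is inverted, and I is generically (c/w;p)(p/(cw);p),
  which has no poles at all. So the contour of the inner integral in F need not depend on z.\<close>

lemma tame_inner_factor_pair_q:
  assumes c: "c \<noteq> 0" and w: "w \<noteq> 0"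
  shows "tame (inner_factor p q [q * c, p * q / c]) w"
proof (rule tame_cong)
  show "tame (\<lambda>w. qpoch p (c / w) * qpoch p (p / (c * w))) w"
    by (rule tame_holomorphic[of _ "-{0}"])
       (use w c in \<open>auto simp: open_Compl intro!: holomorphic_intros qpoch_hol\<close>)
  have "w \<in> -{0}" using w by simp
  from eventually_cosparse_imp_eventually_at[OF pair_regular_generic[OF c] this]
  show "eventually (\<lambda>w. qpoch p (c / w) * qpoch p (p / (c * w)) = inner_factor p q [q * c, p * q / c] w) (at w)"
  proof eventually_elim
    case (elim w)
    have 1: "D (c / w) = qpoch p (c / w) * D (q * (c / w))"
            "D (p / (c * w)) = qpoch p (p / (c * w)) * D (p * q / (c * w))"
      using D_q[of "c / w"] D_q[of "p / (c * w)"] by (simp_all add: mult_ac)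
    have 2: "p * q / (p * q / c * w) = c / w" "p * q / c / w = p * q / (c * w)" "p * q / (q * c * w) = p / (c * w)"
       "q * c / w = q * (c / w)"
      using p_nz q_nz by simp_all
    have "inner_factor p q [q * c, p * q / c] w = D (p / (c * w)) / D (q * (c / w)) * (D (c / w) / D (p * q / (c * w)))"
      unfolding inner_factor_D by (simp only: list.map prod_list.Cons prod_list.Nil mult_1_right 2)
    also have "\<dots> = qpoch p (c / w) * qpoch p (p / (c * w))"
      unfolding 1 using elim p_nz by (auto simp: pair_regular_def)
    finally show ?case ..
  qed
qed

lemma inner_factor_append: "inner_factor p q (as @ bs) w = inner_factor p q as w * inner_factor p q bs w"
  by (simp add: inner_factor_D)

lemma Delta_append: "Delta p q (as @ bs) w = Delta p q as w * (\<Prod>a\<leftarrow>bs. egamma p q (a * w) * egamma p q (a / w))"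
  by (simp add: Delta_eq mult_ac)

end

section \<open>The recursion for the integrals\<close>

context elliptic
begin

context
  fixes u :: "complex list" and v :: complex and C :: contour
  assumes u_nonempty: "u \<noteq> []" and u_nz: "0 \<notin> set u" and v_nz: "v \<noteq> 0"
    and sym: "symmetric_contour C"
    and u_int: "\<And>a i j. a \<in> set u \<Longrightarrow> p ^ i * q ^ j * a \<in> contour_interior C"
    and v_int: "\<And>i. p ^ i * v \<in> contour_interior C \<and> p ^ Suc i / v \<in> contour_interior C"
begin

section \<open>Reduction of both sides to a common weight\<close>

lemma C_closed: "closed_contour C"
  using sym by (simp add: symmetric_contour_def)

lemma C_nz: "z \<in> contour_image C \<Longrightarrow> z \<noteq> 0"
  using closed_contour_0[OF C_closed] by metis

text \<open>\<open>bs\<close> stands for the middle pair, qz, pq/z or x, p/x. A candidate point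
  outside the interior is a pole of none of the three parts of I, hence not a pole of I.\<close>

lemma II_contourI:
  assumes tame: "\<And>w. w \<noteq> 0 \<Longrightarrow> w \<notin> contour_interior C \<Longrightarrow> tame (inner_factor p q bs) w"
    and bs: "0 \<notin> set bs"
  shows "II_contour p q (u @ bs @ [v, p / v]) C"
  unfolding II_contour_def
proof (intro conjI ballI allI impI sym)
  have "p ^ i * hd u \<in> contour_interior C" for i
    using u_int[of "hd u" i 0] u_nonempty by simp
  thus "0 \<in> contour_interior C"
    by (rule contour_interior_0[OF C_closed p_lt])
  fix a i j
  assume a: "a \<in> set (u @ bs @ [v, p / v])"
    and pole: "is_pole (Delta p q (u @ bs @ [v, p / v])) (p ^ i * q ^ j * a) \<and>
      is_pole (inner_factor p q (u @ bs @ [v, p / v])) (p ^ i * q ^ j * a)"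
  define w where "w = p ^ i * q ^ j * a"
  have w: "w \<noteq> 0" using a u_nz bs v_nz p_nz q_nz by (auto simp: w_def)
  show "p ^ i * q ^ j * a \<in> contour_interior C"
  proof (rule ccontr)
    assume "p ^ i * q ^ j * a \<notin> contour_interior C"
    hence nint: "w \<notin> contour_interior C" by (simp add: w_def)
    have "tame (inner_factor p q u) w"
      by (rule tame_inner_factor[OF w _ u_nz]) (use u_int nint in metis)
    moreover have "tame (inner_factor p q [v, p / v]) w"
      by (rule tame_inner_factor_pair[OF v_nz w]) (use v_int nint in metis)
    ultimately have "tame (\<lambda>w. inner_factor p q u w * (inner_factor p q bs w * inner_factor p q [v, p / v] w)) w"
      by (intro tame_mult tame[OF w nint])
    hence "tame (inner_factor p q (u @ bs @ [v, p / v])) w"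
      by (simp only: inner_factor_append[symmetric])
    thus False using tame_not_pole pole by (simp add: w_def)
  qed
qed

lemma II_contour_q:
  assumes "z \<noteq> 0"
  shows "II_contour p q (u @ [q * z, p * q / z, v, p / v]) C"
  using II_contourI[of "[q * z, p * q / z]"] tame_inner_factor_pair_q[OF assms] assms p_nz q_nz by simp

context
  fixes x :: complex
  assumes x_nz: "x \<noteq> 0"
    and x_int: "\<And>i. p ^ i * x \<in> contour_interior C \<and> p ^ Suc i / x \<in> contour_interior C"
begin

abbreviation W :: "complex \<Rightarrow> complex" where
  "W \<equiv> Delta p q (u @ [x, p / x, v, p / v])"

lemma II_contour_x: "II_contour p q (u @ [x, p / x, v, p / v]) C"
proof -
  have "tame (inner_factor p q [x, p / x]) w" if "w \<noteq> 0" "w \<notin> contour_interior C" for w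
    by (rule tame_inner_factor_pair[OF x_nz that(1)]) (use x_int that in metis)
  from II_contourI[OF this] show ?thesis using x_nz p_nz by simp
qed

lemma W_weight: "dlog_weight C W"
  by (rule II_contour_weight[OF _ II_contour_x]) (use u_nz x_nz v_nz p_nz in auto)

text \<open>Contains the zeros of \<psi>(x,w) and \<psi>(v,w), by which the integrand is divided,
  and the points where gamma factors may take default values.\<close>

definition exceptional :: "complex set" where
  "exceptional = {w. w \<noteq> 0 \<and> (\<not> pair_regular x w \<or> \<not> pair_regular v w \<or> psi p x w = 0 \<or> psi p v w = 0)}"

lemma countable_exceptional: "countable exceptional"
proof -
  have "exceptional = {w. w \<noteq> 0 \<and> \<not> pair_regular x w} \<union> {w. w \<noteq> 0 \<and> \<not> pair_regular v w} \<union>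
      ({w. w \<noteq> 0 \<and> psi p x w = 0} \<union> {w. w \<noteq> 0 \<and> psi p v w = 0})"
    by (auto simp: exceptional_def)
  thus ?thesis
    by (simp only:) (intro countable_Un cosparse_countable pair_regular_generic countable_psi_zeros x_nz v_nz)
qed

lemma Delta_u_eq_W:
  assumes "w \<noteq> 0" "w \<notin> exceptional"
  shows "Delta p q u w / (psi p x w * psi p v w) = x * v * W w"
proof -
  have reg: "pair_regular x w" "pair_regular v w" "psi p x w \<noteq> 0" "psi p v w \<noteq> 0"
    using assms by (auto simp: exceptional_def)
  have "W w = Delta p q u w * ((egamma p q (x * w) * egamma p q (x / w) * (egamma p q (p / x * w) * egamma p q (p / x / w))) *
     (egamma p q (v * w) * egamma p q (v / w) * (egamma p q (p / v * w) * egamma p q (p / v / w))))"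
    unfolding Delta_append by simp
  also have "\<dots> = Delta p q u w * (1 / (x * psi p x w) * (1 / (v * psi p v w)))"
    unfolding gamma_factor_pair[OF x_nz assms(1) reg(1)] gamma_factor_pair[OF v_nz assms(1) reg(2)] ..
  finally show ?thesis using reg x_nz v_nz by (simp add: field_simps)
qed

text \<open>The pair x, p/x contributes 1/(x \<psi>(x,w)) to W, the pair qz, pq/z contributes z
  \<psi>(z,w) instead; the quotient is the stated factor.\<close>

lemma Delta_q_eq_W:
  assumes "w \<noteq> 0" "w \<notin> exceptional" "z \<noteq> 0" "pair_regular z w"
  shows "Delta p q (u @ [q * z, p * q / z, v, p / v]) w = z * x * (psi p z w * psi p x w) * W w"
proof -
  have reg: "pair_regular v w" "psi p x w \<noteq> 0" "psi p v w \<noteq> 0"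
    using assms by (auto simp: exceptional_def)
  have "Delta p q (u @ [q * z, p * q / z, v, p / v]) w = Delta p q u w *
     ((egamma p q (q * z * w) * egamma p q (q * z / w) * (egamma p q (p * q / z * w) * egamma p q (p * q / z / w))) *
     (egamma p q (v * w) * egamma p q (v / w) * (egamma p q (p / v * w) * egamma p q (p / v / w))))"
    unfolding Delta_append by simp
  also have "\<dots> = Delta p q u w * (z * psi p z w * (1 / (v * psi p v w)))"
    unfolding gamma_factor_pair_q[OF assms(3,1,4)] gamma_factor_pair[OF v_nz assms(1) reg(1)] ..
  also have "\<dots> = (Delta p q u w / (psi p x w * psi p v w)) * z * psi p z w * psi p x w / v"
    using reg v_nz by (simp add: field_simps)
  also have "\<dots> = z * x * (psi p z w * psi p x w) * W w"
    unfolding Delta_u_eq_W[OF assms(1,2)] using v_nz by (simp add: field_simps)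
  finally show ?thesis .
qed

lemma separable_psi_psi:
  assumes "z \<noteq> 0"
  shows "separable n (\<lambda>zs. \<Prod>i<n. psi p z (zs ! i) * psi p x (zs ! i))"
  by (intro separable_prod separable_mult separable_slot[OF psi_hol_right[OF assms]]
       separable_slot[OF psi_hol_right[OF x_nz]]) auto

text \<open>Each of the n variables contributes zx, so the prefactor z^(-n) v^n of F becomes (xv)^n.
  Its power of z is thereby cancelled, and z occurs only inside \<psi>(z, z_i).\<close>

lemma F_eq:
  assumes z: "z \<noteq> 0"
  shows "F p q u n z v = II_const n * (x * v) ^ n *
    multi_dlog_integral C n (\<lambda>zs. ((\<Prod>i<n. psi p z (zs ! i) * psi p x (zs ! i)) * vand n zs) * (\<Prod>i<n. W (zs ! i)))"
proof -
  have "0 \<notin> set (u @ [q * z, p * q / z, v, p / v])"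
    using u_nz z v_nz p_nz q_nz by auto
  hence "F p q u n z v = inverse (z ^ n) * v ^ n * (II_const n * multi_dlog_integral C n (\<lambda>zs. vand n zs *
           (\<Prod>i<n. Delta p q (u @ [q * z, p * q / z, v, p / v]) (zs ! i))))"
    unfolding F_def by (subst II_eq[OF _ II_contour_q[OF z]]) auto
  also have "multi_dlog_integral C n (\<lambda>zs. vand n zs *
           (\<Prod>i<n. Delta p q (u @ [q * z, p * q / z, v, p / v]) (zs ! i))) =
        multi_dlog_integral C n (\<lambda>zs. (z * x) ^ n * ((\<Prod>i<n. psi p z (zs ! i) * psi p x (zs ! i)) * vand n zs) * (\<Prod>i<n. W (zs ! i)))"
  proof (rule multi_dlog_integral_generic_cong[OF C_closed,
           where A = "exceptional \<union> {w. w \<noteq> 0 \<and> \<not> pair_regular z w}" and B = "\<lambda>_. {}"])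
    show "countable (exceptional \<union> {w. w \<noteq> 0 \<and> \<not> pair_regular z w})"
      by (intro countable_Un countable_exceptional cosparse_countable pair_regular_generic z)
  next
    fix zs :: "complex list"
    assume zs: "length zs = n" "set zs \<subseteq> contour_image C"
      "set zs \<inter> (exceptional \<union> {w. w \<noteq> 0 \<and> \<not> pair_regular z w}) = {}"
    have "(\<Prod>i<n. Delta p q (u @ [q * z, p * q / z, v, p / v]) (zs ! i)) =
            (\<Prod>i<n. z * x * (psi p z (zs ! i) * psi p x (zs ! i)) * W (zs ! i))"
    proof (rule prod.cong[OF refl])
      fix i assume "i \<in> {..<n}"
      hence "zs ! i \<in> set zs" using zs by simp
      thus "Delta p q (u @ [q * z, p * q / z, v, p / v]) (zs ! i) =
              z * x * (psi p z (zs ! i) * psi p x (zs ! i)) * W (zs ! i)"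
        using zs C_nz by (intro Delta_q_eq_W z) blast+
    qed
    also have "\<dots> = (z * x) ^ n * (\<Prod>i<n. psi p z (zs ! i) * psi p x (zs ! i)) * (\<Prod>i<n. W (zs ! i))"
      by (simp only: prod.distrib prod_constant card_lessThan power_mult_distrib)
    finally show "vand n zs * (\<Prod>i<n. Delta p q (u @ [q * z, p * q / z, v, p / v]) (zs ! i)) =
       (z * x) ^ n * ((\<Prod>i<n. psi p z (zs ! i) * psi p x (zs ! i)) * vand n zs) * (\<Prod>i<n. W (zs ! i))"
      by (simp only: mult_ac)
  qed simp
  also have "\<dots> = (z * x) ^ n * multi_dlog_integral C n (\<lambda>zs. ((\<Prod>i<n. psi p z (zs ! i) * psi p x (zs ! i)) * vand n zs) * (\<Prod>i<n. W (zs ! i)))"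
    by (intro multi_dlog_integral_cmult separable_mult separable_psi_psi separable_vand W_weight z)
  finally show ?thesis
    using z by (simp add: power_mult_distrib field_simps)
qed

lemma dlog_integral_F_eq:
  assumes G: "bc1_theta p n G"
  shows "(qpoch p p)\<^sup>2 / 2 *
          dlog_integral C (\<lambda>z. F p q u n z v * G z / (psi p x z * psi p v z) * Delta p q u z)
        = G x * x ^ (n + 1) * v ^ (n + 1) * II p q (n + 1) (u @ [x, p / x, v, p / v])"
proof -
  \<comment> \<open>The n factors xv come from \<open>F_eq\<close> and one more from
    \<open>Delta_u_eq_W\<close>. Absorbed into G, the constant leaves an integrand that is exactly a
    kernel.\<close>
  define c where "c = II_const n * (x * v) ^ Suc n"
  define G' where "G' = (\<lambda>z. c * G z)"
  have G': "bc1_theta p n G'" unfolding G'_def by (rule bc1_theta_cmult[OF G])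
  have G'_hol: "G' holomorphic_on (-{0})" using G' by (simp add: bc1_theta_def)
  define V where "V = multi_dlog_integral C (Suc n) (\<lambda>zs. vand (Suc n) zs * (\<Prod>i<Suc n. W (zs ! i)))"
  have "dlog_integral C (\<lambda>z. F p q u n z v * G z / (psi p x z * psi p v z) * Delta p q u z) =
        multi_dlog_integral C (Suc n) (\<lambda>zs. kernel G' x n zs * (\<Prod>i<Suc n. W (zs ! i)))"
    unfolding multi_dlog_integral.simps
  proof (rule dlog_integral_spike[OF C_closed countable_exceptional])
    fix z assume z: "z \<in> contour_image C" "z \<notin> exceptional"
    have z_nz: "z \<noteq> 0" using C_nz[OF z(1)] .
    let ?f = "\<lambda>zs. (\<Prod>i<n. psi p z (zs ! i) * psi p x (zs ! i)) * vand n zs"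
    have "F p q u n z v * G z / (psi p x z * psi p v z) * Delta p q u z =
          F p q u n z v * G z * (Delta p q u z / (psi p x z * psi p v z))"
      by simp
    also have "\<dots> = G' z * W z * multi_dlog_integral C n (\<lambda>zs. ?f zs * (\<Prod>i<n. W (zs ! i)))"
      unfolding Delta_u_eq_W[OF z_nz z(2)] F_eq[OF z_nz] G'_def c_def by (simp add: mult_ac)
    also have "\<dots> = multi_dlog_integral C n (\<lambda>zs. (G' z * W z) * ?f zs * (\<Prod>i<n. W (zs ! i)))"
      by (intro multi_dlog_integral_cmult[symmetric] separable_mult separable_psi_psi separable_vand W_weight z_nz)
    also have "\<dots> = multi_dlog_integral C n (\<lambda>zs. kernel G' x n (z # zs) * (\<Prod>i<Suc n. W ((z # zs) ! i)))"
      by (simp add: kernel_def prod.lessThan_Suc_shift mult_ac del: prod.lessThan_Suc)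
    finally show "F p q u n z v * G z / (psi p x z * psi p v z) * Delta p q u z =
       multi_dlog_integral C n (\<lambda>zs. kernel G' x n (z # zs) * (\<Prod>i<Suc n. W ((z # zs) ! i)))" .
  qed
  \<comment> \<open>Interpolation requires \<theta>(z_i^2) and \<psi>(z_i,z_j) to be nonzero. The
    first condition excludes countably many values of each variable (A), the second countably many
    values of a later variable for a given earlier one (B).\<close>
  moreover have "of_nat (Suc n) * multi_dlog_integral C (Suc n) (\<lambda>zs. kernel G' x n zs * (\<Prod>i<Suc n. W (zs ! i))) =
         multi_dlog_integral C (Suc n) (\<lambda>zs. G' x * vand (Suc n) zs * (\<Prod>i<Suc n. W (zs ! i)))"
  proof (rule multi_dlog_integral_symmetrize[symmetric, OF separable_kernel[OF G'_hol x_nz] W_weight,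
           where A = "{z. z \<noteq> 0 \<and> theta p (z\<^sup>2) = 0}" and B = "\<lambda>z. if z = 0 then {} else {w. w \<noteq> 0 \<and> psi p z w = 0}"])
    show "countable (if z = 0 then {} else {w. w \<noteq> 0 \<and> psi p z w = 0})" for z
      using countable_psi_zeros by simp
  next
    fix zs :: "complex list"
    assume zs: "length zs = Suc n" "set zs \<subseteq> contour_image C" "set zs \<inter> {z. z \<noteq> 0 \<and> theta p (z\<^sup>2) = 0} = {}"
      "\<And>i j. i < j \<Longrightarrow> j < Suc n \<Longrightarrow> zs ! j \<notin> (if zs ! i = 0 then {} else {w. w \<noteq> 0 \<and> psi p (zs ! i) w = 0})"
    have mem: "zs ! i \<in> set zs" if "i < Suc n" for i using zs(1) that by simp
    have nz: "zs ! i \<noteq> 0" if "i < Suc n" for i using mem[OF that] zs(2) C_nz by blast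
    have less: "psi p (zs ! i) (zs ! j) \<noteq> 0" if "i < j" "j < Suc n" for i j
      using zs(4)[OF that] nz[of i] nz[of j] that by auto
    have "generic_nodes (Suc n) (\<lambda>i. zs ! i)"
      unfolding generic_nodes_def
    proof (intro conjI allI impI)
      fix i j assume ij: "i < Suc n" "j < Suc n" "i \<noteq> j"
      show "psi p (zs ! i) (zs ! j) \<noteq> 0"
        using less[of i j] less[of j i] psi_antisym[OF nz[OF ij(1)] nz[OF ij(2)]] ij by (cases "i < j") auto
    next
      fix i assume i: "i < Suc n"
      show "theta p ((zs ! i)\<^sup>2) \<noteq> 0" using mem[OF i] zs(3) nz[OF i] by blast
    qed (use nz in auto)
    moreover have "0 \<notin> set zs" by (rule contour_image_nonzero[OF C_closed zs(2)])
    ultimately show "(\<Sum>k<Suc n. kernel G' x n (map (\<lambda>i. zs ! Transposition.transpose 0 k i) [0..<Suc n])) = G' x * vand (Suc n) zs"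
      by (intro kernel_symmetrize[OF G' x_nz zs(1)])
  qed (rule countable_theta_square_zeros)
  moreover have "multi_dlog_integral C (Suc n) (\<lambda>zs. G' x * vand (Suc n) zs * (\<Prod>i<Suc n. W (zs ! i))) = G' x * V"
    unfolding V_def by (intro multi_dlog_integral_cmult separable_vand W_weight)
  ultimately have "dlog_integral C (\<lambda>z. F p q u n z v * G z / (psi p x z * psi p v z) * Delta p q u z) =
      G' x * V / of_nat (Suc n)"
    by (simp add: field_simps del: of_nat_Suc)
  moreover have "0 \<notin> set (u @ [x, p / x, v, p / v])" using u_nz x_nz v_nz p_nz by auto
  hence "II p q (Suc n) (u @ [x, p / x, v, p / v]) = II_const (Suc n) * V"
    unfolding V_def by (rule II_eq[OF _ II_contour_x])
  ultimately show ?thesis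
    unfolding G'_def c_def by (simp add: II_const_Suc power_mult_distrib mult_ac del: of_nat_Suc)
qed

end

end

end

theorem theorem3p1:
  fixes p q v :: complex and m n :: nat and u :: "complex list" and C :: contour
  assumes "p \<noteq> 0" and "q \<noteq> 0" and "norm p < 1" and "norm q < 1"
    and "range (\<lambda>k::int. p powi k) \<inter> range (\<lambda>k::int. q powi k) = {1}"
    and "length u = 2 * m + 6" and "0 \<notin> set u"
    and "q powi (2 * int n - 2) * prod_list u = (p * q) ^ (m + 1)"
    and "v \<noteq> 0"
    and "symmetric_contour C"
    and "\<forall>a\<in>set u. \<forall>i j. p ^ i * q ^ j * a \<in> contour_interior C"
    and "\<forall>i. p ^ i * v \<in> contour_interior C \<and> p ^ Suc i / v \<in> contour_interior C"
  shows "(\<forall>G x. bc1_theta p n G \<and> x \<noteq> 0 \<and>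
            (\<forall>i. p ^ i * x \<in> contour_interior C \<and> p ^ Suc i / x \<in> contour_interior C) \<longrightarrow>
            (qpoch p p)\<^sup>2 / 2 *
              dlog_integral C (\<lambda>z. F p q u n z v * G z / (psi p x z * psi p v z) * Delta p q u z)
            = G x * x ^ (n + 1) * v ^ (n + 1) * II p q (n + 1) (u @ [x, p / x, v, p / v])) \<and>
         (n \<ge> 1 \<longrightarrow> (\<forall>H. bc1_theta p (n - 1) H \<longrightarrow>
            dlog_integral C (\<lambda>z. F p q u n z v * H z / psi p v z * Delta p q u z) = 0))"
proof -
  interpret elliptic p q by unfold_locales (use assms in auto)
  have "u \<noteq> []" using assms(6) by auto
  moreover have "p ^ i * q ^ j * a \<in> contour_interior C" if "a \<in> set u" for a i j
    using assms(11) that by blast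
  moreover have v_int: "p ^ i * v \<in> contour_interior C \<and> p ^ Suc i / v \<in> contour_interior C" for i
    using assms(12) by blast
  ultimately have main: "(qpoch p p)\<^sup>2 / 2 *
              dlog_integral C (\<lambda>z. F p q u n z v * G z / (psi p x z * psi p v z) * Delta p q u z)
            = G x * x ^ (n + 1) * v ^ (n + 1) * II p q (n + 1) (u @ [x, p / x, v, p / v])"
    if "bc1_theta p n G" "x \<noteq> 0" "\<And>i. p ^ i * x \<in> contour_interior C \<and> p ^ Suc i / x \<in> contour_interior C" for G x
    using dlog_integral_F_eq[of u v C x n G] assms(7,9,10) that by blast
  have "dlog_integral C (\<lambda>z. F p q u n z v * H z / psi p v z * Delta p q u z) = 0"
    if n: "n \<ge> 1" and H: "bc1_theta p (n - 1) H" for H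
  proof -
    \<comment> \<open>This is \<psi>(v,z) H(z). It is written through -\<psi>(z,v), because \<psi>
      is treated as a theta function in its first argument.\<close>
    define G where "G = (\<lambda>z. - 1 * (psi p z v * H z))"
    have "bc1_theta p (1 + (n - 1)) G"
      unfolding G_def by (intro bc1_theta_cmult bc1_theta_mult bc1_theta_psi assms(9) H)
    hence G: "bc1_theta p n G" using n by simp
    have "G v = 0" by (simp add: G_def psi_self assms(9))
    \<comment> \<open>The point x = v is admissible by the hypothesis on v, and the right-hand side
      contains the factor G(v) = 0.\<close>
    hence "(qpoch p p)\<^sup>2 / 2 *
        dlog_integral C (\<lambda>z. F p q u n z v * G z / (psi p v z * psi p v z) * Delta p q u z) = 0"
      by (subst main[OF G assms(9) v_int]) simp
    hence "dlog_integral C (\<lambda>z. F p q u n z v * G z / (psi p v z * psi p v z) * Delta p q u z) = 0"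
      using qpoch_nonzero_same[OF assms(3)] by simp
    moreover have "dlog_integral C (\<lambda>z. F p q u n z v * G z / (psi p v z * psi p v z) * Delta p q u z) =
          dlog_integral C (\<lambda>z. F p q u n z v * H z / psi p v z * Delta p q u z)"
    proof (rule dlog_integral_spike[of _ "{0}"])
      show "closed_contour C" using assms(10) by (simp add: symmetric_contour_def)
      fix z :: complex assume "z \<notin> {0}"
      hence "G z = psi p v z * H z"
        using psi_antisym[of v z] assms(9) by (simp add: G_def)
      \<comment> \<open>The cancellation is valid even where \<psi>(v,z) = 0: both sides are then 0
        by the convention x/0 = 0.\<close>
      thus "F p q u n z v * G z / (psi p v z * psi p v z) * Delta p q u z =
            F p q u n z v * H z / psi p v z * Delta p q u z" by simp
    qed simp
    ultimately show ?thesis by simp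
  qed
  with main show ?thesis by blast
qed

end
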